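(* The binary bracket $\{K\}\in\mathbb{Z}[A,A^{-1}]$ is invariant under regular isotopy of virtual link diagrams: if two unoriented virtual link diagrams $K,K'$ are regularly isotopic, then $\{K\}=\{K'\}$. Moreover it can be normalized to an invariant of ambient isotopy: for an oriented virtual link diagram $K$ with writhe $w(K)$, the Laurent polynomial $$Inv_K(A)=A^{-w(K)}\{K\}(A)$$ is unchanged under virtual equivalence (ambient isotopy) of oriented virtual link diagrams.
   Context: A virtual link diagram is a generic immersion of finitely many circles in the plane whose double points are each marked either as a classical crossing (with over/under information) or as a virtual crossing (a crossing that is neither over nor under). Virtual equivalence (ambient isotopy) of diagrams is generated by planar isotopy, the classical Reidemeister moves I, II, III (involving only classical crossings), and the detour move: an arc passing through a consecutive sequence of virtual crossings only may be replaced, keeping its endpoints fixed, by any other arc in the plane all of whose crossings (with the diagram and with itself) are virtual. Regular isotopy is the equivalence relation generated by the same moves with the classical Reidemeister move I omitted. Writhe: $w(K)$ is the sum of the signs ($\pm1$) of the classical crossings of the oriented diagram $K$, with the usual right-handed sign convention. Binary bracket: let $K$ be an unoriented virtual link diagram. Each classical crossing has two smoothings. The $A$-smoothing joins the two regions (locally) swept out when the overcrossing line is rotated counterclockwise until it meets the undercrossing line; it gets vertex weight $A$. The other smoothing gets vertex weight $A^{-1}$. (Thus at a positive crossing the orientation-respecting smoothing has weight $A$, and at a negative crossing it has weight $A^{-1}$.) An unlabeled state is a choice of smoothing at every classical crossing; virtual crossings are left alone, so a state is a collection of closed loops possibly crossing virtually. A labeled state is a state with a label $0$ or $1$ assigned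 to each loop. It is properly labeled if at each smoothed crossing the two arcs of the smoothing carry distinct labels. For a properly labeled state $S$, $\{K|S\}$ is the product of its vertex weights, and $\{K\}=\sum_S\{K|S\}$, summed over all properly labeled states $S$ of $K$ (an empty sum is $0$). *)

theory Defs
  imports "HOL-Analysis.Analysis" "HOL-Library.Poly_Mapping" "HOL-Library.FuncSet"
    "HOL-Combinatorics.Permutations"
begin

section \<open>Virtual link diagrams\<close>

text \<open>
  A diagram is given by parametrised closed curves. Component \<open>i < comps D\<close> is a map of period 1
  on the reals, so a point of the source circles is a pair \<open>(i, s)\<close> with \<open>s\<close> read modulo 1.
  \<open>overs\<close> and \<open>unders\<close> contain the source points at which the curve runs through a classical
  crossing as the overcrossing, respectively undercrossing, strand. Double points whose preimages
  lie in neither set are the virtual crossings.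

  The direction of the parametrisation is the orientation. Unoriented diagrams are
  represented by diagrams with an arbitrary orientation, and the equivalence generated for them
  contains the orientation-reversing changes of parameter.
\<close>

type_synonym point = "nat \<times> real"

record vdiagram =
  comps :: nat
  curve :: "nat \<Rightarrow> real \<Rightarrow> complex"
  overs :: "point set"
  unders :: "point set"

definition params :: "vdiagram \<Rightarrow> point set" where
  "params D = {..<comps D} \<times> UNIV"

definition same_param :: "point \<Rightarrow> point \<Rightarrow> bool" where
  "same_param p q \<longleftrightarrow> fst p = fst q \<and> snd p - snd q \<in> \<int>"

definition pos :: "vdiagram \<Rightarrow> point \<Rightarrow> complex" where
  "pos D p = curve D (fst p) (snd p)"

definition vel :: "vdiagram \<Rightarrow> point \<Rightarrow> complex" where
  "vel D p = vector_derivative (curve D (fst p)) (at (snd p))"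

text \<open>The determinant of two plane vectors; positive iff \<open>v\<close> lies counterclockwise from \<open>u\<close>
  within an angle less than \<open>\<pi>\<close>.\<close>

definition cdet :: "complex \<Rightarrow> complex \<Rightarrow> real" where
  "cdet u v = Re u * Im v - Im u * Re v"

definition double :: "vdiagram \<Rightarrow> point \<Rightarrow> point \<Rightarrow> bool" where
  "double D p q \<longleftrightarrow> p \<in> params D \<and> q \<in> params D \<and> \<not> same_param p q \<and> pos D p = pos D q"

definition generic_immersion :: "vdiagram \<Rightarrow> bool" where
  "generic_immersion D \<longleftrightarrow>
     (\<forall>i<comps D. curve D i C1_differentiable_on UNIV \<and> (\<forall>s. curve D i (s + 1) = curve D i s)) \<and>
     (\<forall>p\<in>params D. vel D p \<noteq> 0) \<and>
     finite {z. \<exists>p q. double D p q \<and> pos D p = z} \<and>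
     (\<forall>p q r. double D p q \<and> double D p r \<longrightarrow> same_param q r) \<and>
     (\<forall>p q. double D p q \<longrightarrow> cdet (vel D p) (vel D q) \<noteq> 0)"

definition well_marked :: "vdiagram \<Rightarrow> bool" where
  "well_marked D \<longleftrightarrow>
     overs D \<subseteq> params D \<and> unders D \<subseteq> params D \<and> overs D \<inter> unders D = {} \<and>
     (\<forall>p q. same_param p q \<longrightarrow> (p \<in> overs D \<longleftrightarrow> q \<in> overs D) \<and> (p \<in> unders D \<longleftrightarrow> q \<in> unders D)) \<and>
     (\<forall>p\<in>overs D. \<exists>q\<in>unders D. double D p q) \<and>
     (\<forall>q\<in>unders D. \<exists>p\<in>overs D. double D p q)"

definition virtual_link_diagram :: "vdiagram \<Rightarrow> bool" where
  "virtual_link_diagram D \<longleftrightarrow> generic_immersion D \<and> well_marked D"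

text \<open>Crossings are identified with the corresponding points of the plane.\<close>

definition classical_crossings :: "vdiagram \<Rightarrow> complex set" where
  "classical_crossings D = pos D ` overs D"

definition passes :: "vdiagram \<Rightarrow> complex \<Rightarrow> point \<Rightarrow> point \<Rightarrow> bool" where
  "passes D z p q \<longleftrightarrow> p \<in> overs D \<and> q \<in> unders D \<and> pos D p = z \<and> pos D q = z"

definition crossing_sign :: "vdiagram \<Rightarrow> complex \<Rightarrow> int" where
  "crossing_sign D z =
     (if \<exists>p q. passes D z p q \<and> cdet (vel D p) (vel D q) > 0 then 1 else -1)"

definition writhe :: "vdiagram \<Rightarrow> int" where
  "writhe D = (\<Sum>z\<in>classical_crossings D. crossing_sign D z)"


section \<open>Equivalence of diagrams\<close>

text \<open>A change of parameter of a circle, preserving (\<open>e = 1\<close>) or reversing (\<open>e = -1\<close>)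
  orientation, lifted to the real line.\<close>

definition circle_diffeo :: "real \<Rightarrow> (real \<Rightarrow> real) \<Rightarrow> bool" where
  "circle_diffeo e f \<longleftrightarrow>
     f C1_differentiable_on UNIV \<and> (\<forall>s. f (s + 1) = f s + e) \<and> (\<forall>s. e * deriv f s > 0)"

definition reparametrized :: "real set \<Rightarrow> vdiagram \<Rightarrow> vdiagram \<Rightarrow> bool" where
  "reparametrized E D D' \<longleftrightarrow> comps D' = comps D \<and>
     (\<exists>\<pi> f. \<pi> permutes {..<comps D} \<and> (\<forall>i<comps D. \<exists>e\<in>E. circle_diffeo e (f i)) \<and>
       (\<forall>i<comps D. \<forall>s.
          curve D' i s = curve D (\<pi> i) (f i s) \<and>
          ((i, s) \<in> overs D' \<longleftrightarrow> (\<pi> i, f i s) \<in> overs D) \<and>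
          ((i, s) \<in> unders D' \<longleftrightarrow> (\<pi> i, f i s) \<in> unders D)))"

definition ambient_isotopy :: "(real \<Rightarrow> complex \<Rightarrow> complex) \<Rightarrow> bool" where
  "ambient_isotopy H \<longleftrightarrow> (\<forall>z. H 0 z = z) \<and> (\<forall>t\<in>{0..1}. bij (H t)) \<and>
     continuous_on ({0..1} \<times> UNIV) (\<lambda>(t, z). H t z) \<and>
     (\<exists>H' :: real \<Rightarrow> complex \<Rightarrow> complex \<Rightarrow>\<^sub>L complex.
        continuous_on ({0..1} \<times> UNIV) (\<lambda>(t, z). H' t z) \<and>
        (\<forall>t\<in>{0..1}. \<forall>z. (H t has_derivative blinfun_apply (H' t z)) (at z) \<and>
                        inj (blinfun_apply (H' t z))))"

definition planar_isotopic :: "vdiagram \<Rightarrow> vdiagram \<Rightarrow> bool" where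
  "planar_isotopic D D' \<longleftrightarrow> comps D' = comps D \<and> overs D' = overs D \<and> unders D' = unders D \<and>
     (\<exists>H. ambient_isotopy H \<and> (\<forall>i<comps D. \<forall>s. curve D' i s = H 1 (curve D i s)))"

text \<open>The arc is the image of \<open>{a..b}\<close> in component \<open>i\<close>. Since \<open>overs\<close> and \<open>unders\<close> are
  unchanged, all crossings on the new arc are virtual.\<close>

definition detour_move :: "vdiagram \<Rightarrow> vdiagram \<Rightarrow> bool" where
  "detour_move D D' \<longleftrightarrow> comps D' = comps D \<and> overs D' = overs D \<and> unders D' = unders D \<and>
     (\<exists>i a b. i < comps D \<and> a < b \<and> b < a + 1 \<and>
        {i} \<times> {a..b} \<inter> (overs D \<union> unders D) = {} \<and>
        (\<forall>j<comps D. \<forall>s. \<not> (\<exists>t\<in>{a..b}. same_param (j, s) (i, t)) \<longrightarrow>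
            curve D' j s = curve D j s))"

text \<open>
  The Reidemeister moves are stated for one fixed pair of pictures each, inside the box
  \<open>move_box\<close>; conjugating with planar isotopies gives the general local moves. A strand
  \<open>(i, c, r)\<close> is the parameter arc \<open>t \<mapsto> (i, c + r * t)\<close> for \<open>t\<close> in \<open>{-1..1}\<close>; the sign
  of \<open>r\<close> is arbitrary, so all orientations of the strands of a picture are covered.
\<close>

type_synonym strand = "nat \<times> real \<times> real"

fun strand_pt :: "strand \<Rightarrow> real \<Rightarrow> point" where
  "strand_pt (i, c, r) t = (i, c + r * t)"

definition on_strands :: "strand list \<Rightarrow> point \<Rightarrow> bool" where
  "on_strands S p \<longleftrightarrow> (\<exists>k<length S. \<exists>t\<in>{-1..1}. same_param p (strand_pt (S ! k) t))"

definition move_box :: "complex set" where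
  "move_box = {z. \<bar>Re z\<bar> \<le> 1 \<and> \<bar>Im z\<bar> \<le> 2}"

definition embedded_strands :: "vdiagram \<Rightarrow> strand list \<Rightarrow> bool" where
  "embedded_strands D S \<longleftrightarrow>
     (\<forall>k<length S. \<forall>t. strand_pt (S ! k) t \<in> params D) \<and>
     (\<forall>k<length S. \<forall>l<length S. \<forall>t\<in>{-1..1}. \<forall>u\<in>{-1..1}.
        same_param (strand_pt (S ! k) t) (strand_pt (S ! l) u) \<longrightarrow> k = l \<and> t = u)"

definition box_picture :: "vdiagram \<Rightarrow> strand list \<Rightarrow> (real \<Rightarrow> complex) list \<Rightarrow> bool" where
  "box_picture D S M \<longleftrightarrow> length S = length M \<and>
     (\<forall>k<length M. \<forall>t\<in>{-1..1}. pos D (strand_pt (S ! k) t) = (M ! k) t) \<and>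
     (\<forall>p\<in>params D. \<not> on_strands S p \<longrightarrow> pos D p \<notin> move_box)"

definition local_replacement ::
  "vdiagram \<Rightarrow> vdiagram \<Rightarrow> strand list \<Rightarrow> (real \<Rightarrow> complex) list \<Rightarrow> (real \<Rightarrow> complex) list \<Rightarrow> bool" where
  "local_replacement D D' S M M' \<longleftrightarrow> comps D' = comps D \<and> embedded_strands D S \<and>
     box_picture D S M \<and> box_picture D' S M' \<and>
     (\<forall>p\<in>params D. \<not> on_strands S p \<longrightarrow> pos D' p = pos D p \<and>
        (p \<in> overs D' \<longleftrightarrow> p \<in> overs D) \<and> (p \<in> unders D' \<longleftrightarrow> p \<in> unders D))"

text \<open>All crossings between different strands are classical, the higher strand being the
  overcrossing one.\<close>

definition layered ::
  "vdiagram \<Rightarrow> strand list \<Rightarrow> (real \<Rightarrow> complex) list \<Rightarrow> (nat \<Rightarrow> nat) \<Rightarrow> bool" where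
  "layered D S M h \<longleftrightarrow> inj_on h {..<length M} \<and>
     (\<forall>k<length M. \<forall>l<length M. \<forall>t\<in>{-1..1}. \<forall>u\<in>{-1..1}.
        (M ! k) t = (M ! l) u \<and> h l < h k \<longrightarrow>
          strand_pt (S ! k) t \<in> overs D \<and> strand_pt (S ! l) u \<in> unders D)"

definition level :: "real \<Rightarrow> real \<Rightarrow> complex" where
  "level y t = Complex t y"

text \<open>The function \<open>(1 - t\<^sup>2)\<^sup>2\<close> vanishes with its derivative at \<open>t = 1\<close> and \<open>t = -1\<close>, so the two
  pictures of each move have the same ends to first order.\<close>

definition bump :: "real \<Rightarrow> real" where
  "bump t = (1 - t\<^sup>2)\<^sup>2"

text \<open>A curve with the single double point \<open>kink t = kink (-t)\<close>, where \<open>bump t = 1/2\<close>.\<close>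

definition kink :: "real \<Rightarrow> complex" where
  "kink t = Complex (t * (1 - 2 * bump t)) (bump t)"

definition reidemeister1 :: "vdiagram \<Rightarrow> vdiagram \<Rightarrow> bool" where
  "reidemeister1 D D' \<longleftrightarrow> (\<exists>\<sigma>. local_replacement D D' [\<sigma>] [level 0] [kink] \<and>
     ((\<forall>t\<in>{-1..1}. \<forall>u\<in>{-1..1}. t < u \<and> kink t = kink u \<longrightarrow>
         strand_pt \<sigma> t \<in> overs D' \<and> strand_pt \<sigma> u \<in> unders D') \<or>
      (\<forall>t\<in>{-1..1}. \<forall>u\<in>{-1..1}. t < u \<and> kink t = kink u \<longrightarrow>
         strand_pt \<sigma> u \<in> overs D' \<and> strand_pt \<sigma> t \<in> unders D')))"

text \<open>The second strand is pulled down across the first one, creating a bigon.\<close>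

definition dip :: "real \<Rightarrow> complex" where
  "dip t = Complex t (1 - 2 * bump t)"

definition reidemeister2 :: "vdiagram \<Rightarrow> vdiagram \<Rightarrow> bool" where
  "reidemeister2 D D' \<longleftrightarrow> (\<exists>\<sigma> \<tau> h.
     local_replacement D D' [\<sigma>, \<tau>] [level 0, level 1] [level 0, dip] \<and>
     layered D' [\<sigma>, \<tau>] [level 0, dip] h)"

text \<open>The third strand passes above, respectively below, the crossing at the origin of the two
  diagonals.\<close>

definition diagonal :: "real \<Rightarrow> real \<Rightarrow> complex" where
  "diagonal m t = Complex t (m * t)"

definition arch :: "real \<Rightarrow> real \<Rightarrow> complex" where
  "arch m t = Complex t (m * bump t / 2)"

definition reidemeister3 :: "vdiagram \<Rightarrow> vdiagram \<Rightarrow> bool" where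
  "reidemeister3 D D' \<longleftrightarrow> (\<exists>\<sigma> \<tau> \<upsilon> h.
     local_replacement D D' [\<sigma>, \<tau>, \<upsilon>]
       [diagonal 1, diagonal (-1), arch 1] [diagonal 1, diagonal (-1), arch (-1)] \<and>
     layered D [\<sigma>, \<tau>, \<upsilon>] [diagonal 1, diagonal (-1), arch 1] h \<and>
     layered D' [\<sigma>, \<tau>, \<upsilon>] [diagonal 1, diagonal (-1), arch (-1)] h)"

text \<open>\<open>E = {1}\<close> for oriented diagrams and \<open>E = {1, -1}\<close> for unoriented ones.\<close>

definition regular_step :: "real set \<Rightarrow> vdiagram \<Rightarrow> vdiagram \<Rightarrow> bool" where
  "regular_step E D D' \<longleftrightarrow> virtual_link_diagram D \<and> virtual_link_diagram D' \<and>
     (reparametrized E D D' \<or> planar_isotopic D D' \<or> detour_move D D' \<or>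
      reidemeister2 D D' \<or> reidemeister3 D D')"

definition ambient_step :: "real set \<Rightarrow> vdiagram \<Rightarrow> vdiagram \<Rightarrow> bool" where
  "ambient_step E D D' \<longleftrightarrow> regular_step E D D' \<or>
     virtual_link_diagram D \<and> virtual_link_diagram D' \<and> reidemeister1 D D'"

definition regularly_isotopic_unoriented :: "vdiagram \<Rightarrow> vdiagram \<Rightarrow> bool" where
  "regularly_isotopic_unoriented = equivclp (regular_step {1, -1})"

definition virtually_equivalent_oriented :: "vdiagram \<Rightarrow> vdiagram \<Rightarrow> bool" where
  "virtually_equivalent_oriented = equivclp (ambient_step {1})"


section \<open>The binary bracket\<close>

text \<open>Laurent polynomials with integer coefficients, as the group ring of the integers.\<close>

type_synonym laurent = "int \<Rightarrow>\<^sub>0 int"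

definition A_power :: "int \<Rightarrow> laurent" where
  "A_power k = Poly_Mapping.single k 1"

datatype smoothing = A_smoothing | B_smoothing

fun vertex_weight :: "smoothing \<Rightarrow> laurent" where
  "vertex_weight A_smoothing = A_power 1"
| "vertex_weight B_smoothing = A_power (-1)"

definition unlabeled_states :: "vdiagram \<Rightarrow> (complex \<Rightarrow> smoothing) set" where
  "unlabeled_states D = classical_crossings D \<rightarrow>\<^sub>E UNIV"

definition regular_params :: "vdiagram \<Rightarrow> point set" where
  "regular_params D = params D - (overs D \<union> unders D)"

text \<open>\<open>x\<close> lies on the half branch leaving the crossing at \<open>p\<close> in direction \<open>e * vel D p\<close>
  (\<open>e = 1\<close> or \<open>e = -1\<close>), before the next classical crossing.\<close>

definition half_branch :: "vdiagram \<Rightarrow> point \<Rightarrow> real \<Rightarrow> point \<Rightarrow> bool" where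
  "half_branch D p e x \<longleftrightarrow>
     (\<exists>d>0. x = (fst p, snd p + e * d) \<and>
        (\<forall>d'\<in>{0<..d}. (fst p, snd p + e * d') \<in> regular_params D))"

text \<open>
  Rotating the overcrossing line counterclockwise sweeps out the two sectors running
  counterclockwise from an over half branch to an under half branch. Joining these two sectors
  leaves the arcs that cut off the other two sectors, so each over half branch (direction \<open>a\<close>) is
  connected to the under half branch (direction \<open>b\<close>) next to it clockwise: \<open>cdet b a > 0\<close>.
\<close>

definition connects :: "smoothing \<Rightarrow> complex \<Rightarrow> complex \<Rightarrow> bool" where
  "connects \<alpha> a b \<longleftrightarrow> (case \<alpha> of A_smoothing \<Rightarrow> cdet b a > 0 | B_smoothing \<Rightarrow> cdet a b > 0)"

text \<open>Two points of the diagram lie on the same loop of the state \<open>\<sigma>\<close>.\<close>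

inductive same_loop :: "vdiagram \<Rightarrow> (complex \<Rightarrow> smoothing) \<Rightarrow> point \<Rightarrow> point \<Rightarrow> bool"
  for D \<sigma> where
  refl: "x \<in> regular_params D \<Longrightarrow> same_loop D \<sigma> x x"
| sym: "same_loop D \<sigma> x y \<Longrightarrow> same_loop D \<sigma> y x"
| trans: "same_loop D \<sigma> x y \<Longrightarrow> same_loop D \<sigma> y z \<Longrightarrow> same_loop D \<sigma> x z"
| wrap: "x \<in> regular_params D \<Longrightarrow> y \<in> regular_params D \<Longrightarrow> same_param x y \<Longrightarrow> same_loop D \<sigma> x y"
| along: "s \<le> t \<Longrightarrow> {i} \<times> {s..t} \<subseteq> regular_params D \<Longrightarrow> same_loop D \<sigma> (i, s) (i, t)"
| smooth: "passes D z p q \<Longrightarrow> e \<in> {1, -1} \<Longrightarrow> e' \<in> {1, -1} \<Longrightarrow>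
    connects (\<sigma> z) (e *\<^sub>R vel D p) (e' *\<^sub>R vel D q) \<Longrightarrow>
    half_branch D p e x \<Longrightarrow> half_branch D q e' y \<Longrightarrow> same_loop D \<sigma> x y"

definition loop_of :: "vdiagram \<Rightarrow> (complex \<Rightarrow> smoothing) \<Rightarrow> point \<Rightarrow> point set" where
  "loop_of D \<sigma> x = {y. same_loop D \<sigma> x y}"

definition loops :: "vdiagram \<Rightarrow> (complex \<Rightarrow> smoothing) \<Rightarrow> point set set" where
  "loops D \<sigma> = loop_of D \<sigma> ` regular_params D"

type_synonym labeled_state = "(complex \<Rightarrow> smoothing) \<times> (point set \<Rightarrow> nat)"

definition labeled_states :: "vdiagram \<Rightarrow> labeled_state set" where
  "labeled_states D = (SIGMA \<sigma> : unlabeled_states D. loops D \<sigma> \<rightarrow>\<^sub>E {0, 1})"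

text \<open>Either smoothing connects each over half branch to an under half branch, so its two
  arcs are the ones that contain the two over half branches.\<close>

definition properly_labeled :: "vdiagram \<Rightarrow> labeled_state \<Rightarrow> bool" where
  "properly_labeled D = (\<lambda>(\<sigma>, lab).
     \<forall>p\<in>overs D. \<forall>x y. half_branch D p 1 x \<and> half_branch D p (-1) y \<longrightarrow>
       lab (loop_of D \<sigma> x) \<noteq> lab (loop_of D \<sigma> y))"

definition state_weight :: "vdiagram \<Rightarrow> labeled_state \<Rightarrow> laurent" where
  "state_weight D S = (\<Prod>z\<in>classical_crossings D. vertex_weight (fst S z))"

definition binary_bracket :: "vdiagram \<Rightarrow> laurent" where
  "binary_bracket D = (\<Sum>S | S \<in> labeled_states D \<and> properly_labeled D S. state_weight D S)"

definition Inv :: "vdiagram \<Rightarrow> laurent" where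
  "Inv D = A_power (- writhe D) * binary_bracket D"

end

theory Submission
  imports Defs "HOL-Library.Periodic_Fun"
begin

text \<open>
  A properly labeled state is the same as a coloring of the arcs between classical crossings with two
  colors that changes at every passage, over or under, through a classical crossing: the colors of the
  four half branches at a crossing determine its smoothing. If \<^verbatim>\<open>s\<close> is the sign of the crossing, its
  smoothing joins the outgoing over and under half branches, and has weight \<^verbatim>\<open>A^(-s)\<close>, if these have
  equal colors; it has weight \<^verbatim>\<open>A^s\<close> otherwise. Colorings depend only on the Gauss diagram, so the
  bracket is invariant under planar isotopies, changes of parameter and detour moves. The strands of a
  Reidemeister move carry an even number of passages before and after the move, so colorings
  correspond across it. A second move creates two crossings whose weights cancel. In a third move
  the colors of both strands change at each of the three crossings, which preserves the weights. A
  first move creates a crossing with distinct outgoing colors, hence of weight \<^verbatim>\<open>A^s\<close>, and this is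
  compensated by the writhe.
\<close>

section \<open>Crossings\<close>

text \<open>The loops of a state are global: \<open>same_loop\<close> follows arcs through the whole
  diagram and a move reconnects them, so comparing states directly would require distinguishing how
  the ends of the strands are joined outside the box. Colorings are constrained point by point, so
  they can be altered inside the box and left alone elsewhere. Labels can be traded for colors
  because either smoothing joins each under half branch to an over half branch: distinct labels on
  the two over half branches force distinct colors on the two under half branches, and conversely
  the colors single out the one smoothing that never joins different colors. The even number of
  passages makes the two ends of a strand equal in color, in the old and in the new picture; the
  color at the start of each strand is then all that the box and its outside share. In the third
  move both colors at a crossing change because each strand meets its two crossings in the reversed
  order.\<close>

definition marked :: "vdiagram \<Rightarrow> point set" where
  "marked D = overs D \<union> unders D"

lemma regular_params_eq: "regular_params D = params D - marked D"
  by (simp add: regular_params_def marked_def)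

lemma mem_params: "p \<in> params D \<longleftrightarrow> fst p < comps D"
  by (cases p) (simp add: params_def)

lemma same_param_refl [simp]: "same_param p p"
  by (simp add: same_param_def)

lemma same_param_sym: "same_param p q \<Longrightarrow> same_param q p"
  unfolding same_param_def by (metis Ints_minus minus_diff_eq)

lemma same_param_trans: "same_param p q \<Longrightarrow> same_param q r \<Longrightarrow> same_param p r"
  unfolding same_param_def by (metis Ints_add diff_add_cancel add_diff_eq)

lemma same_paramE:
  assumes "same_param p q" obtains n where "p = (fst q, snd q + of_int n)"
proof -
  obtain n where "snd p - snd q = of_int n" 
    using assms unfolding same_param_def by (auto elim: Ints_cases)
  then show ?thesis using assms that[of n] by (auto simp: same_param_def prod_eq_iff)
qed

lemma same_param_params: "same_param p q \<Longrightarrow> p \<in> params D \<longleftrightarrow> q \<in> params D"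
  by (simp add: same_param_def mem_params)

lemma cdet_scaleR [simp]: "cdet (a *\<^sub>R u) (b *\<^sub>R v) = a * b * cdet u v"
  by (simp add: cdet_def algebra_simps)

lemma cdet_swap: "cdet v u = - cdet u v"
  by (simp add: cdet_def)

lemma vel_eqI:
  "(curve D (fst p) has_vector_derivative v) (at (snd p)) \<Longrightarrow> vel D p = v"
  unfolding vel_def by (rule vector_derivative_at)

context
  fixes D assumes D: "virtual_link_diagram D"
begin

lemma marked_subset: "marked D \<subseteq> params D"
  using D by (auto simp: marked_def virtual_link_diagram_def well_marked_def)

lemma overs_params: "p \<in> overs D \<Longrightarrow> p \<in> params D"
  using marked_subset by (auto simp: marked_def)

lemma unders_same_param: "same_param p q \<Longrightarrow> p \<in> unders D \<longleftrightarrow> q \<in> unders D"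
  and marked_same_param: "same_param p q \<Longrightarrow> p \<in> marked D \<longleftrightarrow> q \<in> marked D"
  using D unfolding marked_def virtual_link_diagram_def well_marked_def by blast+

lemma curve_add_int: 
  assumes "i < comps D" shows "curve D i (s + of_int n) = curve D i s"
proof -
  interpret periodic_fun_simple "curve D i" 1
    using D assms by unfold_locales (simp add: virtual_link_diagram_def generic_immersion_def)
  show ?thesis using plus_of_int[of s n] by simp
qed

lemma pos_same_param: "same_param p q \<Longrightarrow> p \<in> params D \<Longrightarrow> pos D p = pos D q"
  by (elim same_paramE) (simp add: pos_def curve_add_int mem_params)

lemma has_vel:
  assumes "p \<in> params D" 
  shows "(curve D (fst p) has_vector_derivative vel D p) (at (snd p))"
  using D assms unfolding virtual_link_diagram_def generic_immersion_def mem_params vel_def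
  by (simp add: C1_differentiable_on_eq vector_derivative_works[symmetric])

lemma vel_same_param:
  assumes "same_param p q" "p \<in> params D" shows "vel D p = vel D q"
proof -
  obtain n where n: "p = (fst q, snd q + of_int n)" using assms(1) by (rule same_paramE)
  then have i: "fst q < comps D" using assms by (simp add: mem_params)
  have "((curve D (fst q) \<circ> (\<lambda>s. s - of_int n)) has_vector_derivative 1 *\<^sub>R vel D q) (at (snd p))"
    using i n by (intro vector_diff_chain_at) (auto intro!: derivative_eq_intros has_vel simp: mem_params)
  also have "curve D (fst q) \<circ> (\<lambda>s. s - of_int n) = curve D (fst p)"
    using n curve_add_int[OF i, of _ "-n"] by (auto simp: fun_eq_iff)
  finally show ?thesis by (intro vel_eqI) simp
qed

lemma double_unique: "double D p q \<Longrightarrow> double D p r \<Longrightarrow> same_param q r"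
  and double_transversal: "double D p q \<Longrightarrow> cdet (vel D p) (vel D q) \<noteq> 0"
  and finite_doubles: "finite {z. \<exists>p q. double D p q \<and> pos D p = z}"
  using D unfolding virtual_link_diagram_def generic_immersion_def by blast+

lemma over_double: "p \<in> overs D \<Longrightarrow> \<exists>q. passes D (pos D p) p q"
  and under_double: "q \<in> unders D \<Longrightarrow> \<exists>p. passes D (pos D q) p q"
  using D unfolding passes_def virtual_link_diagram_def well_marked_def double_def
  by fastforce+

lemma passes_double: 
  assumes "passes D z p q" shows "double D p q"
proof -
  have "\<not> same_param p q"
    using assms D unders_same_param[of p q]
    by (auto simp: passes_def virtual_link_diagram_def well_marked_def)
  then show ?thesis using assms marked_subset by (auto simp: passes_def double_def marked_def)
qed

lemma passes_transversal: "passes D z p q \<Longrightarrow> cdet (vel D p) (vel D q) \<noteq> 0"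
  using passes_double double_transversal by blast

lemma marked_double: "p \<in> marked D \<Longrightarrow> \<exists>q. double D p q"
proof -
  assume "p \<in> marked D"
  then consider q where "passes D (pos D p) p q" | q where "passes D (pos D p) q p"
    using over_double under_double unfolding marked_def by blast
  then show ?thesis
  proof cases
    case 2
    then have "double D q p" by (rule passes_double)
    then have "double D p q" by (auto simp: double_def dest: same_param_sym)
    then show ?thesis ..
  qed (use passes_double in blast)
qed

text \<open>A third preimage of a double point is excluded, so a second over point at
  \<open>z\<close> would be the under point modulo 1, and the two sets of marks are disjoint and
  periodic. Crossing data can thus be computed from any pair of representatives.\<close>

lemma passes_unique:
  assumes 1: "passes D z p q" and 2: "passes D z p' q'"
  shows "same_param p p'" "same_param q q'"
proof -
  have d: "double D p q" "double D p' q'" using passes_double 1 2 by blast+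
  have z: "pos D p = z" "pos D q = z" "pos D p' = z" "pos D q' = z"
    using 1 2 by (auto simp: passes_def)
  have disj: "overs D \<inter> unders D = {}" using D by (simp add: virtual_link_diagram_def well_marked_def)
  have o: "p \<in> overs D" "p' \<in> overs D" "q \<in> unders D" "q' \<in> unders D" using 1 2 by (auto simp: passes_def)
  show "same_param p p'"
  proof (rule ccontr)
    assume "\<not> same_param p p'"
    then have "double D p p'" using d z by (simp add: double_def)
    then have "same_param q p'" using d double_unique by blast
    then show False using o disj unders_same_param by blast
  qed
  show "same_param q q'"
  proof (rule ccontr)
    assume "\<not> same_param q q'"
    then have "double D q q'" "double D q p" using d z by (auto simp: double_def dest: same_param_sym)
    then have "same_param q' p" using double_unique by blast
    then show False using o disj unders_same_param by blast
  qed
qed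

lemma crossing_sign_eq:
  assumes "passes D z p q"
  shows "crossing_sign D z = (if cdet (vel D p) (vel D q) > 0 then 1 else -1)"
proof -
  have "cdet (vel D p') (vel D q') = cdet (vel D p) (vel D q)" if "passes D z p' q'" for p' q'
  proof -
    have "p \<in> params D" "q \<in> params D" using passes_double[OF assms] by (auto simp: double_def)
    then have "vel D p = vel D p'" "vel D q = vel D q'"
      using passes_unique[OF assms that] vel_same_param by blast+
    then show ?thesis by simp
  qed
  then have "(\<exists>p' q'. passes D z p' q' \<and> cdet (vel D p') (vel D q') > 0) \<longleftrightarrow> cdet (vel D p) (vel D q) > 0" 
    using assms by metis
  then show ?thesis unfolding crossing_sign_def by simp
qed

lemma crossing_passes: "z \<in> classical_crossings D \<longleftrightarrow> (\<exists>p q. passes D z p q)"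
proof
  show "\<exists>p q. passes D z p q" if "z \<in> classical_crossings D"
    using that over_double unfolding classical_crossings_def by blast
  show "z \<in> classical_crossings D" if "\<exists>p q. passes D z p q"
    using that unfolding classical_crossings_def passes_def by blast
qed

lemma finite_classical_crossings: "finite (classical_crossings D)"
proof (rule finite_subset[OF _ finite_doubles])
  show "classical_crossings D \<subseteq> {z. \<exists>p q. double D p q \<and> pos D p = z}"
    using passes_double by (auto simp: crossing_passes) (metis passes_def)
qed

text \<open>The marked points lie over the finitely many double points, and a half-open interval of
  length 1 contains each parameter class at most once, so each double point has at most two
  preimages in it.\<close>

lemma finite_marked_interval: 
  assumes "i < comps D" shows "finite {s. a \<le> s \<and> s < a + 1 \<and> (i, s) \<in> marked D}" (is "finite ?S")
proof -
  have eq: "s = t" if "a \<le> s" "s < a + 1" "a \<le> t" "t < a + 1" "same_param (i, s) (i, t)" for s t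
  proof -
    from that(5) obtain n where n: "s = t + of_int n" by (auto elim: same_paramE)
    then have "real_of_int n < 1" "real_of_int n > -1" using that by linarith+
    then have "n = 0" by linarith
    then show ?thesis using n by simp
  qed
  have fib: "finite {s \<in> ?S. curve D i s = z}" for z
  proof (cases "\<exists>s\<in>?S. curve D i s = z")
    case True
    then obtain s where s: "s \<in> ?S" "curve D i s = z" by blast
    let ?T = "{t \<in> ?S. curve D i t = z} - {s}"
    have "t = u" if "t \<in> ?T" "u \<in> ?T" for t u
    proof -
      have "double D (i, s) (i, v)" if "v \<in> ?T" for v
      proof -
        have "\<not> same_param (i, s) (i, v)" using that s eq[of s v] by auto
        then show ?thesis using that s assms by (simp add: double_def mem_params pos_def)
      qed
      then have "double D (i, s) (i, t)" "double D (i, s) (i, u)" using that by blast+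
      then have "same_param (i, t) (i, u)" using double_unique by blast
      moreover have "a \<le> t" "t < a + 1" "a \<le> u" "u < a + 1" using that by auto
      ultimately show ?thesis using eq by blast
    qed
    then have "\<exists>u. ?T \<subseteq> {u}" by blast
    then obtain u where "?T \<subseteq> {u}" ..
    then have "{t \<in> ?S. curve D i t = z} \<subseteq> {s, u}" by blast
    then show ?thesis by (rule finite_subset) (rule finite.insertI, rule finite.insertI, rule finite.emptyI)
  next
    case False
    then have *: "{s \<in> ?S. curve D i s = z} = {}" by blast
    show ?thesis unfolding * by (rule finite.emptyI)
  qed
  have "curve D i ` ?S \<subseteq> {z. \<exists>p q. double D p q \<and> pos D p = z}"
    using marked_double by (force simp: pos_def)
  then have "finite (curve D i ` ?S)" using finite_doubles finite_subset by blast
  then have "finite (\<Union>z\<in>curve D i ` ?S. {s \<in> ?S. curve D i s = z})"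
    by (rule finite_UN_I) (rule fib)
  then show ?thesis by (rule rev_finite_subset) blast
qed

text \<open>Needed for the existence of half branches. Only nearby marks matter, so an interval of
  length 1 around \<open>s\<close> is enough.\<close>

lemma marked_isolated:
  assumes "i < comps D"
  shows "\<exists>\<delta>>0. \<forall>u. u \<noteq> s \<and> \<bar>u - s\<bar> < \<delta> \<longrightarrow> (i, u) \<notin> marked D"
proof -
  let ?S = "{u. s - 1/2 \<le> u \<and> u < (s - 1/2) + 1 \<and> (i, u) \<in> marked D}"
  have "finite ?S" by (rule finite_marked_interval[OF assms])
  from finite_set_avoid[OF this, of s] obtain d where d: "d > 0" "\<forall>x\<in>?S. x \<noteq> s \<longrightarrow> d \<le> dist s x" by blast
  show ?thesis
  proof (intro exI[of _ "min d (1/2)"] conjI allI impI notI)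
    fix u assume u: "u \<noteq> s \<and> \<bar>u - s\<bar> < min d (1/2)" "(i, u) \<in> marked D"
    then have "u \<in> ?S" by (auto simp: abs_if split: if_splits)
    then show False using d u by (auto simp: dist_real_def abs_minus_commute)
  qed (use d in auto)
qed

end

section \<open>Colorings\<close>

text \<open>The direction \<open>e\<close> may be any nonzero real and not only a sign, so that the
  speed of a strand can be inserted directly; \<open>germ_sgn\<close> shows that only its sign
  matters.\<close>

definition germ :: "(point \<Rightarrow> bool) \<Rightarrow> point \<Rightarrow> real \<Rightarrow> bool \<Rightarrow> bool" where
  "germ c p e b \<longleftrightarrow> (\<forall>\<^sub>F d in at_right 0. c (fst p, snd p + e * d) = b)"

text \<open>The value defaults to false where \<open>c\<close> has no germ in this direction, a case
  that \<open>color_at\<close> excludes.\<close>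

definition branch_value :: "(point \<Rightarrow> bool) \<Rightarrow> point \<Rightarrow> real \<Rightarrow> bool" where
  "branch_value c p e \<longleftrightarrow> germ c p e True"

text \<open>At a crossing, where no color is defined, the value is fixed to be false.\<close>

definition color_at :: "point set \<Rightarrow> (point \<Rightarrow> bool) \<Rightarrow> point \<Rightarrow> bool" where
  "color_at X c p \<longleftrightarrow> (\<exists>b. germ c p 1 b \<and> germ c p (-1) (b \<noteq> (p \<in> X)) \<and> c p = (b \<and> p \<notin> X))"

text \<open>A coloring is false off \<open>regular_params\<close>: outside the diagram by the first
  clause, at crossings by \<open>color_at\<close>. It is thus fixed by the colors of its arcs, and
  equality of functions is equality of colorings.\<close>

definition colorings :: "vdiagram \<Rightarrow> (point \<Rightarrow> bool) set" where
  "colorings D = {c. (\<forall>p. p \<notin> params D \<longrightarrow> \<not> c p) \<and> 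
     (\<forall>p q. p \<in> params D \<and> same_param p q \<longrightarrow> c p = c q) \<and>
     (\<forall>p\<in>params D. color_at (marked D) c p)}"

lemma germ_iff: "germ c p e b \<longleftrightarrow> (\<exists>\<delta>>0. \<forall>d. 0 < d \<and> d < \<delta> \<longrightarrow> c (fst p, snd p + e * d) = b)"
  by (auto simp: germ_def eventually_at_right_field)

lemma germ_unique: 
  assumes "germ c p e b" "germ c p e b'" shows "b = b'"
proof -
  have "\<forall>\<^sub>F d in at_right (0::real). b = b'"
    using eventually_conj[OF assms[unfolded germ_def]] by eventually_elim blast
  then show ?thesis by simp
qed

lemma germ_scale:
  assumes "k > 0" shows "germ c p (e * k) b \<longleftrightarrow> germ c p e b"
proof -
  have "germ c p e b \<longleftrightarrow> (\<forall>\<^sub>F d in filtermap (times k) (at_right 0). c (fst p, snd p + e * d) = b)"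
    using assms by (simp add: filtermap_times_pos_at_right germ_def)
  then show ?thesis by (simp add: eventually_filtermap germ_def mult.assoc)
qed

lemma germ_sgn: "e \<noteq> 0 \<Longrightarrow> germ c p e b \<longleftrightarrow> germ c p (sgn e) b"
  using germ_scale[of "\<bar>e\<bar>" c p "sgn e" b] by (simp add: sgn_mult_abs)

lemma branch_value_sgn: "e \<noteq> 0 \<Longrightarrow> branch_value c p e = branch_value c p (sgn e)"
  unfolding branch_value_def by (rule germ_sgn)

lemma branch_value_eq: "germ c p e b \<Longrightarrow> branch_value c p e = b"
  unfolding branch_value_def using germ_unique[of c p e b True] by auto

lemma color_at_sgnD:
  assumes "color_at X c p" "e = 1 \<or> e = -1"
  shows "germ c p e (branch_value c p e)" 
    "branch_value c p (-e) = (branch_value c p e \<noteq> (p \<in> X))"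
    "c p = (branch_value c p e \<and> p \<notin> X)"
proof -
  obtain b where b: "germ c p 1 b" "germ c p (-1) (b \<noteq> (p \<in> X))" "c p = (b \<and> p \<notin> X)"
    using assms(1) unfolding color_at_def by blast
  note v = branch_value_eq[OF b(1)] branch_value_eq[OF b(2)]
  show "germ c p e (branch_value c p e)" "branch_value c p (-e) = (branch_value c p e \<noteq> (p \<in> X))"
    "c p = (branch_value c p e \<and> p \<notin> X)"
    using assms(2) b unfolding v by (auto simp: v)
qed

lemma color_atD:
  assumes "color_at X c p" "e \<noteq> 0"
  shows "germ c p e (branch_value c p e)" 
    "branch_value c p (-e) = (branch_value c p e \<noteq> (p \<in> X))"
    "c p = (branch_value c p e \<and> p \<notin> X)"
proof -
  have "sgn e = 1 \<or> sgn e = -1" using assms(2) by (auto simp: sgn_if)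
  note * = color_at_sgnD[OF assms(1) this]
  show "germ c p e (branch_value c p e)" "branch_value c p (-e) = (branch_value c p e \<noteq> (p \<in> X))"
    "c p = (branch_value c p e \<and> p \<notin> X)"
    using * assms(2) branch_value_sgn[of e c p] branch_value_sgn[of "-e" c p] germ_sgn[of e c p] 
    by (auto simp: sgn_minus)
qed

lemma color_atI:
  assumes "e \<noteq> 0" and "germ c p e b" and "germ c p (-e) (b \<noteq> (p \<in> X))" and "c p = (b \<and> p \<notin> X)"
  shows "color_at X c p"
proof (cases "e > 0")
  case True
  then have "germ c p 1 b" "germ c p (-1) (b \<noteq> (p \<in> X))" 
    using assms(2,3) germ_sgn[of e] germ_sgn[of "-e"] by (simp_all add: sgn_minus)
  then show ?thesis using assms(4) unfolding color_at_def by blast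
next
  case False
  then have "germ c p (-1) b" "germ c p 1 (b \<noteq> (p \<in> X))" 
    using assms germ_sgn[of e] germ_sgn[of "-e"] by (simp_all add: sgn_if)
  \<comment> \<open>For negative \<open>e\<close> the value \<open>b\<close> belongs to the backward
    branch, and the forward one carries the changed value.\<close>
  then show ?thesis using assms(4) unfolding color_at_def 
    by (intro exI[of _ "b \<noteq> (p \<in> X)"]) auto
qed

lemma germ_cong:
  assumes "\<delta> > 0" and "\<And>u. \<bar>u - snd p\<bar> < \<delta> \<Longrightarrow> c' (fst p, u) = c (fst p, u)"
  shows "germ c' p e b \<longleftrightarrow> germ c p e b"
proof -
  \<comment> \<open>The added 1 keeps the quotient meaningful for \<open>e = 0\<close>; for
    \<open>d < k\<close> the displacement \<open>e * d\<close> stays below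
    \<open>\<delta>\<close>.\<close>
  define k where "k = \<delta> / (\<bar>e\<bar> + 1)"
  have k: "k > 0" using assms(1) by (simp add: k_def add_nonneg_pos)
  have "\<forall>\<^sub>F d in at_right (0::real). d < k" using k by (auto simp: eventually_at_right_field)
  then have "\<forall>\<^sub>F d in at_right (0::real). c' (fst p, snd p + e * d) = c (fst p, snd p + e * d)"
    using eventually_at_right_less
  proof eventually_elim
    case (elim d)
    have "\<bar>e * d\<bar> \<le> (\<bar>e\<bar> + 1) * d" using elim by (simp add: abs_mult)
    also have "\<dots> < (\<bar>e\<bar> + 1) * k" using elim by (intro mult_strict_left_mono) auto
    also have "\<dots> = \<delta>" by (simp add: k_def add_nonneg_eq_0_iff)
    finally show ?case using assms(2) by simp
  qed
  then show ?thesis unfolding germ_def by (intro eventually_cong) (auto elim: eventually_mono)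
qed

lemma color_at_cong:
  assumes "\<delta> > 0" and "\<And>u. \<bar>u - snd p\<bar> < \<delta> \<Longrightarrow> c' (fst p, u) = c (fst p, u)" and "p \<in> X \<longleftrightarrow> p \<in> X'"
  shows "color_at X c p \<longleftrightarrow> color_at X' c' p"
proof -
  have "c' p = c p" using assms(2)[of "snd p"] assms(1) by simp
  then show ?thesis
    using germ_cong[of \<delta> p c' c, OF assms(1,2)] assms(3) unfolding color_at_def by auto
qed

lemma coloringsD:
  assumes "c \<in> colorings D"
  shows "c p \<Longrightarrow> p \<in> regular_params D"
    and "p \<in> params D \<Longrightarrow> same_param p q \<Longrightarrow> c p = c q"
    and "p \<in> params D \<Longrightarrow> color_at (marked D) c p"
proof -
  have *: "\<forall>p. p \<notin> params D \<longrightarrow> \<not> c p" "\<forall>p q. p \<in> params D \<and> same_param p q \<longrightarrow> c p = c q"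
    "\<forall>p\<in>params D. color_at (marked D) c p"
    using assms unfolding colorings_def by blast+
  show "p \<in> regular_params D" if "c p" using *(1,3) that unfolding color_at_def regular_params_eq by blast
  show "c p = c q" if "p \<in> params D" "same_param p q" using *(2) that by blast
  show "color_at (marked D) c p" if "p \<in> params D" using *(3) that by blast
qed

lemma branch_value_same_param:
  assumes "c \<in> colorings D" "p \<in> params D" "same_param p q"
  shows "branch_value c p e = branch_value c q e"
proof -
  obtain n where n: "p = (fst q, snd q + of_int n)" using assms(3) by (rule same_paramE)
  have "c (fst p, snd p + e * d) = c (fst q, snd q + e * d)" for d
    using assms n by (intro coloringsD(2)[OF assms(1)]) (auto simp: mem_params same_param_def)
  then show ?thesis by (simp add: branch_value_def germ_def)
qed

text \<open>At a regular point both germs equal the value of \<open>c\<close>, so \<open>c\<close>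
  is locally constant along the arc, and an interval is connected.\<close>

lemma coloring_along:
  assumes c: "c \<in> colorings D" and "s \<le> t" "{i} \<times> {s..t} \<subseteq> regular_params D"
  shows "c (i, s) = c (i, t)"
proof (rule connected_local_const[where A = "{s..t}" and f = "\<lambda>u. c (i, u)"])
  show "\<forall>u\<in>{s..t}. \<forall>\<^sub>F v in at u within {s..t}. c (i, u) = c (i, v)"
  proof
    fix u assume "u \<in> {s..t}"
    then have "(i, u) \<in> regular_params D" using assms(3) by auto
    then have r: "(i, u) \<in> params D" "(i, u) \<notin> marked D" by (auto simp: regular_params_eq)
    obtain b where b: "germ c (i, u) 1 b" "germ c (i, u) (-1) b" "c (i, u) = b"
      using coloringsD(3)[OF c r(1)] r(2) unfolding color_at_def by auto
    obtain \<delta> where \<delta>: "\<delta> > 0" "\<forall>d. 0 < d \<and> d < \<delta> \<longrightarrow> c (i, u + d) = b"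
      using b(1) by (auto simp: germ_iff)
    obtain \<delta>' where \<delta>': "\<delta>' > 0" "\<forall>d. 0 < d \<and> d < \<delta>' \<longrightarrow> c (i, u - d) = b"
      using b(2) by (auto simp: germ_iff)
    have "c (i, v) = b" if "dist v u < min \<delta> \<delta>'" for v
      using that \<delta>(2)[rule_format, of "v - u"] \<delta>'(2)[rule_format, of "u - v"] b(3)
      by (cases v u rule: linorder_cases) (auto simp: dist_real_def)
    then show "\<forall>\<^sub>F v in at u within {s..t}. c (i, u) = c (i, v)"
      using \<delta> \<delta>' b(3) unfolding eventually_at by (intro exI[of _ "min \<delta> \<delta>'"]) auto
  qed
qed (use assms in auto)

lemma half_branch_value:
  assumes c: "c \<in> colorings D" and p: "p \<in> params D" and e: "e = 1 \<or> e = -1" 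
    and h: "half_branch D p e x"
  shows "c x = branch_value c p e"
proof -
  obtain d where d: "d > 0" "x = (fst p, snd p + e * d)" 
    "\<forall>d'\<in>{0<..d}. (fst p, snd p + e * d') \<in> regular_params D"
    using h unfolding half_branch_def by blast
  have "germ c p e (branch_value c p e)" using color_at_sgnD[OF coloringsD(3)[OF c p] e] by blast
  then obtain \<delta> where \<delta>: "\<delta> > 0" "\<forall>d. 0 < d \<and> d < \<delta> \<longrightarrow> c (fst p, snd p + e * d) = branch_value c p e"
    unfolding germ_iff by blast
  \<comment> \<open>Close enough to \<open>p\<close> to show the germ, and not beyond
    \<open>x\<close>, so that the arc from there to \<open>x\<close> is regular.\<close>
  define d' where "d' = min d (\<delta> / 2)"
  have d': "0 < d'" "d' \<le> d" "d' < \<delta>" using d(1) \<delta>(1) by (auto simp: d'_def)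
  have "c (fst p, snd p + e * d') = c (fst p, snd p + e * d)"
  proof (cases "e = 1")
    case True
    show ?thesis unfolding True
    proof (rule coloring_along[OF c])
      show "{fst p} \<times> {snd p + 1 * d'..snd p + 1 * d} \<subseteq> regular_params D"
      proof clarsimp
        fix u assume "snd p + d' \<le> u" "u \<le> snd p + d"
        then show "(fst p, u) \<in> regular_params D" using d(3)[rule_format, of "u - snd p"] d' True by simp
      qed
    qed (use d' in auto)
  next
    case False
    then have e: "e = -1" using e by simp
    show ?thesis unfolding e
    proof (rule coloring_along[OF c, symmetric])
      show "{fst p} \<times> {snd p + -1 * d..snd p + -1 * d'} \<subseteq> regular_params D"
      proof clarsimp
        fix u assume "snd p - d \<le> u" "u \<le> snd p - d'"
        then show "(fst p, u) \<in> regular_params D" using d(3)[rule_format, of "snd p - u"] d' e by simp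
      qed
    qed (use d' in auto)
  qed
  then show ?thesis using d' d(2) \<delta>(2) by blast
qed

text \<open>Reversing one strand of a crossing negates both the crossing sign and the agreement, so their
  product, the exponent contributed by the crossing, does not depend on orientations.\<close>

definition agreement :: "vdiagram \<Rightarrow> (point \<Rightarrow> bool) \<Rightarrow> complex \<Rightarrow> int" where
  "agreement D c z = 
     (if \<exists>p q. passes D z p q \<and> branch_value c p 1 = branch_value c q 1 then -1 else 1)"

definition exponent :: "vdiagram \<Rightarrow> (point \<Rightarrow> bool) \<Rightarrow> int" where
  "exponent D c = (\<Sum>z\<in>classical_crossings D. crossing_sign D z * agreement D c z)"

context
  fixes D assumes D: "virtual_link_diagram D"
begin

lemma agreement_eq:
  assumes c: "c \<in> colorings D" and z: "passes D z p q"
  shows "agreement D c z = (if branch_value c p 1 = branch_value c q 1 then -1 else 1)"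
proof -
  have "(branch_value c p' 1 = branch_value c q' 1) \<longleftrightarrow> (branch_value c p 1 = branch_value c q 1)" 
    if "passes D z p' q'" for p' q'
  proof -
    have "p \<in> params D" "q \<in> params D" using passes_double[OF D z] by (auto simp: double_def)
    then have "branch_value c p 1 = branch_value c p' 1" "branch_value c q 1 = branch_value c q' 1"
      using passes_unique[OF D z that] branch_value_same_param[OF c] by blast+
    then show ?thesis by simp
  qed
  then have "(\<exists>p' q'. passes D z p' q' \<and> branch_value c p' 1 = branch_value c q' 1)
     \<longleftrightarrow> (branch_value c p 1 = branch_value c q 1)" 
    using z by metis
  then show ?thesis unfolding agreement_def by simp
qed

text \<open>At a marked point the two directions have opposite values, so reversing one of them
  toggles the equality and is compensated by its sign. This lets the agreement be read along the
  strands of a picture whatever their orientation.\<close>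

lemma agreement_direction:
  assumes c: "c \<in> colorings D" and z: "passes D z p q" and e: "e \<noteq> 0" "e' \<noteq> 0"
  shows "real_of_int (agreement D c z) = 
    sgn e * sgn e' * (if branch_value c p e = branch_value c q e' then -1 else 1)"
proof -
  have p: "p \<in> params D" "q \<in> params D" "p \<in> marked D" "q \<in> marked D" 
    using passes_double[OF D z] z by (auto simp: double_def passes_def marked_def)
  have *: "branch_value c x (-1) = (\<not> branch_value c x 1)" if "x \<in> params D" "x \<in> marked D" for x
    using color_atD(2)[OF coloringsD(3)[OF c that(1)], of 1] that by simp
  have "sgn e = 1 \<or> sgn e = -1" "sgn e' = 1 \<or> sgn e' = -1" using e by (auto simp: sgn_if)
  then show ?thesis
    unfolding agreement_eq[OF c z] branch_value_sgn[OF e(1)] branch_value_sgn[OF e(2)]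
    using *[OF p(1,3)] *[OF p(2,4)] by auto
qed

text \<open>Each scalar enters once through \<open>sgn\<close> and once through the determinant, so
  its signs square to 1.\<close>

lemma crossing_sign_direction:
  assumes z: "passes D z p q" and e: "e \<noteq> 0" "e' \<noteq> 0"
  shows "real_of_int (crossing_sign D z) = sgn e * sgn e' * sgn (cdet (e *\<^sub>R vel D p) (e' *\<^sub>R vel D q))"
proof -
  have "sgn e * sgn e * (sgn e' * sgn e') = 1" using e by (simp add: sgn_if)
  then have "sgn e * sgn e' * sgn (cdet (e *\<^sub>R vel D p) (e' *\<^sub>R vel D q)) = sgn (cdet (vel D p) (vel D q))"
    by (simp add: sgn_mult mult_ac)
  then show ?thesis using passes_transversal[OF D z] by (simp add: crossing_sign_eq[OF D z] sgn_if)
qed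

lemma half_branch_exists:
  assumes p: "p \<in> params D" and e: "e = 1 \<or> e = -1" shows "\<exists>x. half_branch D p e x"
proof -
  obtain \<delta> where \<delta>: "\<delta> > 0" "\<forall>u. u \<noteq> snd p \<and> \<bar>u - snd p\<bar> < \<delta> \<longrightarrow> (fst p, u) \<notin> marked D"
    using marked_isolated[OF D, of "fst p" "snd p"] p by (auto simp: mem_params)
  have "(fst p, snd p + e * d) \<in> regular_params D" if "d \<in> {0<..\<delta>/2}" for d
    using that e p \<delta>(2)[rule_format, of "snd p + e * d"] \<delta>(1) by (auto simp: regular_params_eq mem_params)
  then show ?thesis unfolding half_branch_def using \<delta>(1) by (intro exI exI[of _ "\<delta>/2"]) auto
qed

lemma half_branch_regular: "half_branch D p e x \<Longrightarrow> x \<in> regular_params D"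
  unfolding half_branch_def by force

end

section \<open>The bracket as a sum over colorings\<close>

lemma A_power_add: "A_power (a + b) = A_power a * A_power b"
  by (simp add: A_power_def mult_single)

lemma A_power_sum: "A_power (sum f S) = (\<Prod>x\<in>S. A_power (f x))"
  by (induction S rule: infinite_finite_induct) (simp_all add: A_power_add, simp_all add: A_power_def)

fun smoothing_sign :: "smoothing \<Rightarrow> int" where
  "smoothing_sign A_smoothing = 1"
| "smoothing_sign B_smoothing = -1"

lemma smoothing_sign_cases: "smoothing_sign \<alpha> = 1 \<or> smoothing_sign \<alpha> = -1"
  by (cases \<alpha>) auto

lemma smoothing_sign_inject: "smoothing_sign \<alpha> = smoothing_sign \<beta> \<Longrightarrow> \<alpha> = \<beta>"
  by (cases \<alpha>; cases \<beta>) auto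

lemma vertex_weight_eq: "vertex_weight \<alpha> = A_power (smoothing_sign \<alpha>)"
  by (cases \<alpha>) auto

lemma crossing_sign_cases: "crossing_sign D z = 1 \<or> crossing_sign D z = -1"
  by (simp add: crossing_sign_def)

lemma agreement_cases: "agreement D c z = 1 \<or> agreement D c z = -1"
  by (simp add: agreement_def)

definition state_coloring :: "vdiagram \<Rightarrow> labeled_state \<Rightarrow> point \<Rightarrow> bool" where
  "state_coloring D S x \<longleftrightarrow> x \<in> regular_params D \<and> snd S (loop_of D (fst S) x) = 1"

text \<open>The smoothing forced by the colors: it joins half branches of equal color only, as
  \<open>coloring_same_loop\<close> shows. The restriction makes it an element of the extensional
  function space of unlabeled states.\<close>

definition coloring_smoothing :: "vdiagram \<Rightarrow> (point \<Rightarrow> bool) \<Rightarrow> complex \<Rightarrow> smoothing" where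
  "coloring_smoothing D c = restrict (\<lambda>z. if crossing_sign D z * agreement D c z = 1 
     then A_smoothing else B_smoothing) (classical_crossings D)"

text \<open>The existential reads the common color of a loop, \<open>c\<close> being constant on it
  by \<open>coloring_same_loop\<close>.\<close>

definition coloring_state :: "vdiagram \<Rightarrow> (point \<Rightarrow> bool) \<Rightarrow> labeled_state" where
  "coloring_state D c = (coloring_smoothing D c, 
     restrict (\<lambda>L. of_bool (\<exists>x\<in>L. c x)) (loops D (coloring_smoothing D c)))"

lemma smoothing_sign_coloring_smoothing:
  "z \<in> classical_crossings D \<Longrightarrow> 
     smoothing_sign (coloring_smoothing D c z) = crossing_sign D z * agreement D c z"
  using crossing_sign_cases[of D z] agreement_cases[of D c z] by (auto simp: coloring_smoothing_def)

lemma loop_of_eq: "same_loop D \<sigma> x y \<Longrightarrow> loop_of D \<sigma> x = loop_of D \<sigma> y"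
  unfolding loop_of_def by (auto intro: same_loop.sym same_loop.trans)

lemma half_branch_same_loop:
  assumes "e = 1 \<or> e = -1" "half_branch D p e x" "half_branch D p e y"
  shows "same_loop D \<sigma> x y"
proof -
  have *: "same_loop D \<sigma> (fst p, snd p + e * d) (fst p, snd p + e * d')"
    if "0 < d" "d \<le> d'" "\<forall>u\<in>{0<..d'}. (fst p, snd p + e * u) \<in> regular_params D" for d d'
    using assms(1)
  proof
    assume e: "e = 1"
    show ?thesis
    proof (rule same_loop.along)
      show "{fst p} \<times> {snd p + e * d..snd p + e * d'} \<subseteq> regular_params D"
      proof clarsimp
        fix u assume "snd p + e * d \<le> u" "u \<le> snd p + e * d'"
        then show "(fst p, u) \<in> regular_params D" using that(3)[rule_format, of "u - snd p"] that(1) e by simp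
      qed
    qed (use that e in auto)
  next
    assume e: "e = -1"
    show ?thesis
    proof (rule same_loop.sym, rule same_loop.along)
      show "{fst p} \<times> {snd p + e * d'..snd p + e * d} \<subseteq> regular_params D"
      proof clarsimp
        fix u assume "snd p + e * d' \<le> u" "u \<le> snd p + e * d"
        then show "(fst p, u) \<in> regular_params D" using that(3)[rule_format, of "snd p - u"] that(1) e by simp
      qed
    qed (use that e in auto)
  qed
  obtain d where d: "d > 0" "x = (fst p, snd p + e * d)"
    "\<forall>u\<in>{0<..d}. (fst p, snd p + e * u) \<in> regular_params D"
    using assms(2) unfolding half_branch_def by blast
  obtain d' where d': "d' > 0" "y = (fst p, snd p + e * d')"
    "\<forall>u\<in>{0<..d'}. (fst p, snd p + e * u) \<in> regular_params D"
    using assms(3) unfolding half_branch_def by blast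
  show ?thesis
    using *[of d d'] *[of d' d] d d' by (cases "d \<le> d'") (auto intro: same_loop.sym)
qed

lemma half_branch_same_loop_regular:
  assumes "e = 1 \<or> e = -1" "half_branch D p e x" "p \<in> regular_params D"
  shows "same_loop D \<sigma> p x"
proof -
  obtain d where d: "d > 0" "x = (fst p, snd p + e * d)"
    "\<forall>u\<in>{0<..d}. (fst p, snd p + e * u) \<in> regular_params D"
    using assms(2) unfolding half_branch_def by blast
  have *: "(fst p, snd p + e * u) \<in> regular_params D" if "u \<in> {0..d}" for u
    using that d(3) assms(3) by (cases "u = 0") auto
  show ?thesis using assms(1)
  proof
    assume e: "e = 1"
    have "same_loop D \<sigma> (fst p, snd p) (fst p, snd p + d)"
    proof (rule same_loop.along)
      show "{fst p} \<times> {snd p..snd p + d} \<subseteq> regular_params D"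
      proof clarsimp
        fix u assume "snd p \<le> u" "u \<le> snd p + d"
        then show "(fst p, u) \<in> regular_params D" using *[of "u - snd p"] e by simp
      qed
    qed (use d in auto)
    then show ?thesis using d e by simp
  next
    assume e: "e = -1"
    have "same_loop D \<sigma> (fst p, snd p - d) (fst p, snd p)"
    proof (rule same_loop.along)
      show "{fst p} \<times> {snd p - d..snd p} \<subseteq> regular_params D"
      proof clarsimp
        fix u assume "snd p - d \<le> u" "u \<le> snd p"
        then show "(fst p, u) \<in> regular_params D" using *[of "snd p - u"] e by simp
      qed
    qed (use d in auto)
    then show ?thesis using d e by (auto intro: same_loop.sym)
  qed
qed

context
  fixes D assumes D: "virtual_link_diagram D"
begin

text \<open>All that is used of \<open>connects\<close>: since an A-smoothing joins an over
  direction to the under direction next to it clockwise, the signs of joined directions multiply to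
  minus the crossing sign, and a B-smoothing reverses this.\<close>

lemma connects_iff:
  assumes z: "passes D z p q" and e: "e = 1 \<or> e = -1" "e' = 1 \<or> e' = -1"
  shows "connects \<alpha> (e *\<^sub>R vel D p) (e' *\<^sub>R vel D q) 
    \<longleftrightarrow> e * e' = - real_of_int (crossing_sign D z * smoothing_sign \<alpha>)"
proof -
  have c: "cdet (vel D p) (vel D q) > 0 \<or> cdet (vel D p) (vel D q) < 0"
    using passes_transversal[OF D z] by linarith
  show ?thesis
    using c e unfolding crossing_sign_eq[OF D z]
    by (cases \<alpha>) (auto simp: connects_def cdet_swap[of "vel D q" "vel D p"])
qed

lemma state_coloring_germ:
  assumes p: "p \<in> params D" and e: "e = 1 \<or> e = -1" and x: "half_branch D p e x"
  shows "germ (state_coloring D S) p e (snd S (loop_of D (fst S) x) = 1)"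
proof -
  obtain d where d: "d > 0" "x = (fst p, snd p + e * d)"
    "\<forall>u\<in>{0<..d}. (fst p, snd p + e * u) \<in> regular_params D"
    using x unfolding half_branch_def by blast
  have "state_coloring D S (fst p, snd p + e * u) = (snd S (loop_of D (fst S) x) = 1)" 
    if u: "0 < u" "u < d" for u
  proof -
    have "half_branch D p e (fst p, snd p + e * u)" using d(3) u unfolding half_branch_def by auto
    from half_branch_same_loop[OF e this x, THEN loop_of_eq]
    have "loop_of D (fst S) (fst p, snd p + e * u) = loop_of D (fst S) x" .
    moreover have "(fst p, snd p + e * u) \<in> regular_params D" using d(3) u by simp
    ultimately show ?thesis unfolding state_coloring_def by simp
  qed
  then show ?thesis unfolding germ_iff using d(1) by blast
qed

lemma state_label:
  assumes "S \<in> labeled_states D" "x \<in> regular_params D"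
  shows "snd S (loop_of D (fst S) x) = 0 \<or> snd S (loop_of D (fst S) x) = 1"
  using assms by (auto simp: labeled_states_def loops_def dest!: PiE_mem)

text \<open>Proper labeling compares the over half branches only. At an under point the change is
  inherited: the smoothing joins its two half branches to the two over half branches of the same
  crossing.\<close>

lemma state_coloring_colorings:
  assumes S: "S \<in> labeled_states D" and proper: "properly_labeled D S"
  shows "state_coloring D S \<in> colorings D"
proof -
  obtain \<sigma> lab where S_eq: "S = (\<sigma>, lab)" by (cases S)
  let ?l = "\<lambda>x. lab (loop_of D \<sigma> x) = 1"
  have per: "state_coloring D S p = state_coloring D S q" if "p \<in> params D" "same_param p q" for p q
  proof -
    have "p \<in> regular_params D \<longleftrightarrow> q \<in> regular_params D"
      using marked_same_param[OF D that(2)] same_param_params[OF that(2)] by (auto simp: regular_params_eq)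
    then show ?thesis using loop_of_eq[OF same_loop.wrap[of p D q "fst S"]] that(2) unfolding state_coloring_def by auto
  qed
  have germ: "germ (state_coloring D S) p e (?l x)" 
    if "p \<in> params D" "e = 1 \<or> e = -1" "half_branch D p e x" for p e x
    using state_coloring_germ[OF that, of S] S_eq by simp
  have over: "?l x \<noteq> ?l y" if "p \<in> overs D" "half_branch D p 1 x" "half_branch D p (-1) y" for p x y
  proof -
    have "lab (loop_of D \<sigma> x) \<noteq> lab (loop_of D \<sigma> y)"
      using proper that unfolding properly_labeled_def S_eq by blast
    then show ?thesis 
      using state_label[OF S half_branch_regular[OF D that(2)]] 
        state_label[OF S half_branch_regular[OF D that(3)]] S_eq by auto
  qed
  have under: "?l x \<noteq> ?l y" if q: "q \<in> unders D" and x: "half_branch D q 1 x" and y: "half_branch D q (-1) y" for q x y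
  proof -
    obtain p where p: "passes D (pos D q) p q" using under_double[OF D q] by blast
    then have po: "p \<in> overs D" "p \<in> params D" using overs_params[OF D] by (auto simp: passes_def)
    \<comment> \<open>By \<open>connects_iff\<close>, the over direction whose half branch the
      smoothing joins to the outgoing under half branch; the incoming one is joined to direction
      \<open>-e\<close>.\<close>
    define e where "e = - real_of_int (crossing_sign D (pos D q) * smoothing_sign (\<sigma> (pos D q)))"
    have e: "e = 1 \<or> e = -1" 
      using crossing_sign_cases[of D "pos D q"] smoothing_sign_cases[of "\<sigma> (pos D q)"] by (auto simp: e_def)
    obtain x' y' where h: "half_branch D p e x'" "half_branch D p (-e) y'"
      using half_branch_exists[OF D po(2)] e by force
    have "same_loop D \<sigma> x' x" 
      by (rule same_loop.smooth[OF p _ _ _ h(1) x]) (use e connects_iff[OF p e, of 1] in \<open>auto simp: e_def\<close>)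
    moreover have "same_loop D \<sigma> y' y" 
      by (rule same_loop.smooth[OF p _ _ _ h(2) y]) (use e connects_iff[OF p, of "-e" "-1"] in \<open>auto simp: e_def\<close>)
    moreover have "?l x' \<noteq> ?l y'" using e h over[OF po(1), of x' y'] over[OF po(1), of y' x'] by auto
    ultimately show ?thesis using loop_of_eq[of D \<sigma> x' x] loop_of_eq[of D \<sigma> y' y] by simp
  qed
  have "color_at (marked D) (state_coloring D S) p" if p: "p \<in> params D" for p
  proof -
    obtain x y where xy: "half_branch D p 1 x" "half_branch D p (-1) y"
      using half_branch_exists[OF D p] by blast
    note g = germ[OF p _ xy(1)] germ[OF p _ xy(2)]
    show ?thesis
    proof (cases "p \<in> marked D")
      case True
      then have "?l x \<noteq> ?l y" using over[OF _ xy] under[OF _ xy] unfolding marked_def by blast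
      moreover have "\<not> state_coloring D S p" using True by (simp add: state_coloring_def regular_params_eq)
      ultimately show ?thesis using g True unfolding color_at_def by (intro exI[of _ "?l x"]) auto
    next
      case False
      then have r: "p \<in> regular_params D" using p by (simp add: regular_params_eq)
      have "loop_of D \<sigma> p = loop_of D \<sigma> x" "loop_of D \<sigma> p = loop_of D \<sigma> y"
        using half_branch_same_loop_regular[OF _ xy(1) r] half_branch_same_loop_regular[OF _ xy(2) r] 
          loop_of_eq by blast+
      then show ?thesis using g False r S_eq unfolding color_at_def 
        by (intro exI[of _ "?l p"]) (auto simp: state_coloring_def)
    qed
  qed
  moreover have "\<not> state_coloring D S p" if "p \<notin> params D" for p
    using that by (simp add: state_coloring_def regular_params_eq)
  ultimately show ?thesis using per unfolding colorings_def by blast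
qed

text \<open>Half branches that the smoothing joins have equal colors, which determines the
  agreement. So the smoothing is recovered from the colors, and the weight of a state is a function
  of its coloring.\<close>

lemma state_smoothing_sign:
  assumes S: "S \<in> labeled_states D" and proper: "properly_labeled D S" and "z \<in> classical_crossings D"
  shows "smoothing_sign (fst S z) = crossing_sign D z * agreement D (state_coloring D S) z"
proof -
  obtain p q where z: "passes D z p q" using assms(3) crossing_passes[OF D] by blast
  then have pq: "p \<in> params D" "q \<in> params D" using passes_double[OF D z] by (auto simp: double_def)
  define e where "e = - real_of_int (crossing_sign D z * smoothing_sign (fst S z))"
  have e: "e = 1 \<or> e = -1" 
    using crossing_sign_cases[of D z] smoothing_sign_cases[of "fst S z"] by (auto simp: e_def)
  obtain x where x: "half_branch D p e x" using half_branch_exists[OF D pq(1) e] ..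
  obtain y where y: "half_branch D q 1 y" using half_branch_exists[OF D pq(2), of 1] by auto
  note h = x y
  have "same_loop D (fst S) x y" 
    by (rule same_loop.smooth[OF z _ _ _ h]) (use e connects_iff[OF z e, of 1] in \<open>auto simp: e_def\<close>)
  then have "loop_of D (fst S) x = loop_of D (fst S) y" by (rule loop_of_eq)
  then have eq: "state_coloring D S x = state_coloring D S y"
    using h half_branch_regular[OF D] by (simp add: state_coloring_def)
  note c = state_coloring_colorings[OF S proper]
  have "branch_value (state_coloring D S) p e = branch_value (state_coloring D S) q 1"
    using eq half_branch_value[OF c pq(1) e h(1)] half_branch_value[OF c pq(2) _ h(2)] by simp
  then have "real_of_int (agreement D (state_coloring D S) z) = - sgn e"
    using agreement_direction[OF D c z, of e 1] e by (auto simp del: of_int_eq_iff)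
  also have "- sgn e = real_of_int (crossing_sign D z * smoothing_sign (fst S z))"
    using e by (auto simp: e_def)
  finally have "agreement D (state_coloring D S) z = crossing_sign D z * smoothing_sign (fst S z)"
    unfolding of_int_eq_iff .
  then show ?thesis using crossing_sign_cases[of D z] by auto
qed

text \<open>In the smoothing chosen from \<open>c\<close> the crossing sign enters twice and
  cancels: directions joined at \<open>z\<close> multiply to minus the agreement, which by
  \<open>agreement_direction\<close> means equal colors.\<close>

lemma coloring_same_loop:
  assumes c: "c \<in> colorings D" and "same_loop D (coloring_smoothing D c) x y"
  shows "c x = c y"
  using assms(2)
proof induction
  case (wrap x y)
  then show ?case using coloringsD(2)[OF c] by (auto simp: regular_params_eq)
next
  case (along s t i)
  then show ?case using coloring_along[OF c] by blast
next
  case (smooth z p q e e' x y)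
  have e: "e = 1 \<or> e = -1" "e' = 1 \<or> e' = -1" using smooth by auto
  have z: "z \<in> classical_crossings D" using smooth(1) crossing_passes[OF D] by blast
  have pq: "p \<in> params D" "q \<in> params D" using passes_double[OF D smooth(1)] by (auto simp: double_def)
  have s: "crossing_sign D z * (crossing_sign D z * agreement D c z) = agreement D c z"
    using crossing_sign_cases[of D z] by auto
  have "e * e' = - real_of_int (crossing_sign D z * (crossing_sign D z * agreement D c z))"
    using connects_iff[OF smooth(1) e] smooth(4) smoothing_sign_coloring_smoothing[OF z, of c] by metis
  then have "e * e' = - real_of_int (agreement D c z)" unfolding s .
  then have "branch_value c p e = branch_value c q e'"
    using agreement_direction[OF D c smooth(1), of e e'] e by (auto split: if_splits)
  then show ?case
    using half_branch_value[OF c pq(1) e(1) smooth(5)] half_branch_value[OF c pq(2) e(2) smooth(6)] by simp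
qed auto

lemma coloring_state_label:
  assumes c: "c \<in> colorings D" and x: "x \<in> regular_params D"
  shows "snd (coloring_state D c) (loop_of D (coloring_smoothing D c) x) = of_bool (c x)"
proof -
  have "x \<in> loop_of D (coloring_smoothing D c) x" using x by (simp add: loop_of_def same_loop.refl)
  moreover have "c y = c x" if "y \<in> loop_of D (coloring_smoothing D c) x" for y
    using that coloring_same_loop[OF c] unfolding loop_of_def by blast
  ultimately have "(\<exists>y\<in>loop_of D (coloring_smoothing D c) x. c y) = c x" by blast
  then show ?thesis using x by (simp add: coloring_state_def loops_def)
qed

lemma coloring_state_labeled: "coloring_state D c \<in> labeled_states D"
  unfolding coloring_state_def labeled_states_def unlabeled_states_def coloring_smoothing_def by auto

lemma coloring_state_proper: 
  assumes c: "c \<in> colorings D" shows "properly_labeled D (coloring_state D c)"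
proof -
  have "snd (coloring_state D c) (loop_of D (coloring_smoothing D c) x) 
     \<noteq> snd (coloring_state D c) (loop_of D (coloring_smoothing D c) y)"
    if p: "p \<in> overs D" and x: "half_branch D p 1 x" and y: "half_branch D p (-1) y" for p x y
  proof -
    have pp: "p \<in> params D" "p \<in> marked D" using p overs_params[OF D] by (auto simp: marked_def)
    have "c x \<noteq> c y" 
      using half_branch_value[OF c pp(1) _ x] half_branch_value[OF c pp(1) _ y] 
        color_atD(2)[OF coloringsD(3)[OF c pp(1)], of 1] pp(2) by simp
    then show ?thesis
      using coloring_state_label[OF c half_branch_regular[OF D x]] 
        coloring_state_label[OF c half_branch_regular[OF D y]] by simp
  qed
  then show ?thesis
    unfolding properly_labeled_def coloring_state_def by simp
qed

lemma state_coloring_coloring_state: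
  assumes c: "c \<in> colorings D" shows "state_coloring D (coloring_state D c) = c"
proof
  fix x show "state_coloring D (coloring_state D c) x = c x"
  proof (cases "x \<in> regular_params D")
    case True
    have "fst (coloring_state D c) = coloring_smoothing D c" by (simp add: coloring_state_def)
    then show ?thesis using coloring_state_label[OF c True] True by (simp add: state_coloring_def)
  qed (use coloringsD(1)[OF c, of x] in \<open>auto simp: state_coloring_def\<close>)
qed

text \<open>A coloring fixes the smoothing by \<open>state_smoothing_sign\<close>; then both states
  have the same loops, and the label of a loop can be read at any of its regular points.\<close>

lemma state_coloring_inj:
  "inj_on (state_coloring D) {S \<in> labeled_states D. properly_labeled D S}"
proof (rule inj_onI, clarify)
  fix \<sigma> \<sigma>' :: "complex \<Rightarrow> smoothing" and lab lab' :: "point set \<Rightarrow> nat"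
  let ?S = "(\<sigma>, lab)" and ?T = "(\<sigma>', lab')"
  assume S: "?S \<in> labeled_states D" "properly_labeled D ?S" 
    and T: "?T \<in> labeled_states D" "properly_labeled D ?T"
    and eq: "state_coloring D ?S = state_coloring D ?T"
  have "\<sigma> z = \<sigma>' z" if "z \<in> classical_crossings D" for z
    using state_smoothing_sign[OF S that] state_smoothing_sign[OF T that] eq smoothing_sign_inject by simp
  moreover have "\<sigma> \<in> unlabeled_states D" "\<sigma>' \<in> unlabeled_states D"
    using S T by (auto simp: labeled_states_def)
  ultimately have \<sigma>: "\<sigma> = \<sigma>'" unfolding unlabeled_states_def by (intro PiE_ext) auto
  have "lab (loop_of D \<sigma> x) = lab' (loop_of D \<sigma> x)" if "x \<in> regular_params D" for x
    using fun_cong[OF eq, of x] that state_label[OF S(1) that] state_label[OF T(1) that] \<sigma>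
    by (auto simp: state_coloring_def)
  then have "lab L = lab' L" if "L \<in> loops D \<sigma>" for L using that by (auto simp: loops_def)
  moreover have "lab \<in> loops D \<sigma> \<rightarrow>\<^sub>E {0, 1}" "lab' \<in> loops D \<sigma> \<rightarrow>\<^sub>E {0, 1}"
    using S T \<sigma> by (auto simp: labeled_states_def)
  ultimately have "lab = lab'" by (intro PiE_ext) auto
  with \<sigma> show "\<sigma> = \<sigma>' \<and> lab = lab'" ..
qed

text \<open>From here on states and loops no longer appear: a move is studied through its effect on
  colorings, signs and agreements.\<close>

theorem binary_bracket_eq: "binary_bracket D = (\<Sum>c\<in>colorings D. A_power (exponent D c))"
proof -
  let ?P = "{S. S \<in> labeled_states D \<and> properly_labeled D S}"
  have "bij_betw (state_coloring D) ?P (colorings D)"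
    unfolding bij_betw_def
  proof (intro conjI equalityI subsetI)
    show "c \<in> state_coloring D ` ?P" if "c \<in> colorings D" for c
      using that state_coloring_coloring_state coloring_state_labeled coloring_state_proper
      by (intro image_eqI[of _ _ "coloring_state D c"]) auto
  qed (use state_coloring_inj state_coloring_colorings in auto)
  then have "(\<Sum>c\<in>colorings D. A_power (exponent D c)) 
      = (\<Sum>S\<in>?P. A_power (exponent D (state_coloring D S)))"
    by (rule sum.reindex_bij_betw[symmetric])
  also have "\<dots> = (\<Sum>S\<in>?P. state_weight D S)"
  proof (rule sum.cong)
    fix S assume "S \<in> ?P"
    then have S: "S \<in> labeled_states D" "properly_labeled D S" by auto
    show "A_power (exponent D (state_coloring D S)) = state_weight D S"
      unfolding exponent_def state_weight_def A_power_sum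
      by (intro prod.cong) (auto simp: vertex_weight_eq state_smoothing_sign[OF S])
  qed simp
  finally show ?thesis by (simp add: binary_bracket_def)
qed

end

section \<open>Changes of parameter, planar isotopies and detour moves\<close>

text \<open>The shift \<open>k\<close> is the sign of the new crossing in a first move and 0 in all
  other moves.\<close>

lemma bracket_transfer:
  assumes D: "virtual_link_diagram D" and D': "virtual_link_diagram D'"
    and bij: "bij_betw \<phi> (colorings D) (colorings D')"
    and exponent: "\<And>c. c \<in> colorings D \<Longrightarrow> exponent D' (\<phi> c) = k + exponent D c"
  shows "binary_bracket D' = A_power k * binary_bracket D"
proof -
  have "binary_bracket D' = (\<Sum>c\<in>colorings D. A_power (exponent D' (\<phi> c)))"
    unfolding binary_bracket_eq[OF D'] by (rule sum.reindex_bij_betw[OF bij, symmetric])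
  also have "\<dots> = (\<Sum>c\<in>colorings D. A_power k * A_power (exponent D c))"
    using exponent by (simp add: A_power_add)
  finally show ?thesis by (simp add: binary_bracket_eq[OF D] sum_distrib_left)
qed

lemma A_power_0 [simp]: "A_power 0 = 1"
  by (simp add: A_power_def)

section \<open>Diagrams with the same marks\<close>

lemma colorings_cong:
  assumes "comps D' = comps D" "marked D' = marked D" shows "colorings D' = colorings D"
proof -
  have "params D' = params D" using assms by (simp add: params_def)
  then show ?thesis using assms by (simp add: colorings_def)
qed

text \<open>Colorings depend on the marks alone, so the identity is the bijection. \<open>G\<close>
  only renames the crossing points: it is the identity for a detour and the final map
  \<open>H 1\<close> for a planar isotopy.\<close>

lemma same_marks_transfer:
  assumes D: "virtual_link_diagram D" and D': "virtual_link_diagram D'"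
    and comps: "comps D' = comps D" and overs: "overs D' = overs D" and unders: "unders D' = unders D"
    and G: "inj G" "\<And>p. p \<in> marked D \<Longrightarrow> pos D' p = G (pos D p)"
    and sign: "\<And>z p q. passes D z p q \<Longrightarrow> 
      cdet (vel D' p) (vel D' q) > 0 \<longleftrightarrow> cdet (vel D p) (vel D q) > 0"
  shows "binary_bracket D' = binary_bracket D \<and> writhe D' = writhe D"
proof -
  have passes: "passes D' (G z) p q \<longleftrightarrow> passes D z p q" for z p q
  proof (cases "p \<in> overs D \<and> q \<in> unders D")
    case True
    then have "pos D' p = G (pos D p)" "pos D' q = G (pos D q)" by (simp_all add: G(2) marked_def)
    then show ?thesis using G(1) overs unders by (auto simp: passes_def inj_eq)
  qed (auto simp: passes_def overs unders)
  have cr: "classical_crossings D' = G ` classical_crossings D"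
    unfolding classical_crossings_def image_image overs
    by (rule image_cong) (auto simp: G(2) marked_def)
  have crossing: "crossing_sign D' (G z) = crossing_sign D z" if cc: "z \<in> classical_crossings D" for z
  proof -
    obtain p q where z: "passes D z p q" using cc crossing_passes[OF D] by blast
    then show ?thesis
      using crossing_sign_eq[OF D z] crossing_sign_eq[OF D', of "G z" p q] passes sign[OF z] by simp
  qed
  have sum: "(\<Sum>z\<in>classical_crossings D'. h z) = (\<Sum>z\<in>classical_crossings D. h (G z))" for h :: "complex \<Rightarrow> int"
    unfolding cr using G(1) by (intro sum.reindex_cong[where l = G]) (auto intro: inj_on_subset)
  have agreement: "agreement D' c (G z) = agreement D c z" for c z
    by (simp add: agreement_def passes)
  have w: "writhe D' = writhe D"
    unfolding writhe_def sum by (rule sum.cong) (auto simp: crossing)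
  have "exponent D' c = exponent D c" for c
    unfolding exponent_def sum by (rule sum.cong) (auto simp: crossing agreement)
  moreover have "bij_betw id (colorings D) (colorings D')"
    using colorings_cong[OF comps] overs unders by (simp add: marked_def bij_betw_def)
  ultimately have "binary_bracket D' = A_power 0 * binary_bracket D"
    by (intro bracket_transfer[OF D D', of id]) auto
  with w show ?thesis by simp
qed

lemma vel_cong_open:
  assumes D: "virtual_link_diagram D" and "p \<in> params D" and "open U" "snd p \<in> U"
    and "\<And>u. u \<in> U \<Longrightarrow> curve D' (fst p) u = curve D (fst p) u"
  shows "vel D' p = vel D p"
proof (rule vel_eqI)
  show "(curve D' (fst p) has_vector_derivative vel D p) (at (snd p))"
    by (rule has_vector_derivative_transform_within_open[OF has_vel[OF D assms(2)] assms(3,4)])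
      (simp add: assms(5))
qed

text \<open>A sum of the closed set of integers and a compact set. It gives a parameter off an arc,
  read modulo 1, a whole neighbourhood off that arc.\<close>

lemma closed_mod_int:
  fixes T :: "real set"
  assumes "compact T" shows "closed {s. \<exists>t\<in>T. s - t \<in> \<int>}"
proof -
  have eq: "{s. \<exists>t\<in>T. s - t \<in> \<int>} = (\<Union>x\<in>\<int>. \<Union>y\<in>T. {x + y})"
  proof (intro equalityI subsetI)
    fix s assume "s \<in> {s. \<exists>t\<in>T. s - t \<in> \<int>}"
    then obtain t where "t \<in> T" "s - t \<in> \<int>" by blast
    then show "s \<in> (\<Union>x\<in>\<int>. \<Union>y\<in>T. {x + y})" by (intro UN_I[of "s - t"] UN_I[of t]) auto
  next
    fix s assume "s \<in> (\<Union>x\<in>\<int>. \<Union>y\<in>T. {x + y})"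
    then obtain x t where "x \<in> \<int>" "t \<in> T" "s = x + t" by blast
    then have "t \<in> T" "s - t \<in> \<int>" by simp_all
    then show "s \<in> {s. \<exists>t\<in>T. s - t \<in> \<int>}" by blast
  qed
  show ?thesis unfolding eq by (rule closed_compact_sums[OF closed_Ints assms])
qed

lemma detour_move_invariant:
  assumes D: "virtual_link_diagram D" and D': "virtual_link_diagram D'" and move: "detour_move D D'"
  shows "binary_bracket D' = binary_bracket D \<and> writhe D' = writhe D"
proof -
  have same: "comps D' = comps D" "overs D' = overs D" "unders D' = unders D"
    using move unfolding detour_move_def by blast+
  obtain i a b where arc: "{i} \<times> {a..b} \<inter> marked D = {}"
    and "\<forall>j<comps D. \<forall>s. \<not> (\<exists>t\<in>{a..b}. same_param (j, s) (i, t)) \<longrightarrow> curve D' j s = curve D j s"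
    using move unfolding detour_move_def marked_def[symmetric] by (elim conjE exE) (rule that)
  then have curve: "curve D' j s = curve D j s" 
    if "j < comps D" "\<not> (\<exists>t\<in>{a..b}. same_param (j, s) (i, t))" for j s
    using that by blast
  have near: "pos D' p = pos D p \<and> vel D' p = vel D p" if p: "p \<in> marked D" for p
  proof -
    have pp: "p \<in> params D" using p marked_subset[OF D] by blast
    \<comment> \<open>The parameters on the component of \<open>p\<close> that avoid the moved arc;
      on a component other than \<open>i\<close> these are all.\<close>
    define U where "U = (if fst p = i then - {s. \<exists>t\<in>{a..b}. s - t \<in> \<int>} else UNIV)"
    have U: "open U" unfolding U_def using closed_mod_int[OF compact_Icc, of a b] by (simp add: open_Compl)
    have "\<not> (\<exists>t\<in>{a..b}. same_param p (i, t))"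
    proof
      assume "\<exists>t\<in>{a..b}. same_param p (i, t)"
      then obtain t where "t \<in> {a..b}" "(i, t) \<in> marked D" using marked_same_param[OF D] p by blast
      then show False using arc by blast
    qed
    then have pU: "snd p \<in> U" by (auto simp: U_def same_param_def)
    have eq: "curve D' (fst p) u = curve D (fst p) u" if "u \<in> U" for u
    proof (rule curve)
      show "fst p < comps D" using pp by (simp add: mem_params)
      show "\<not> (\<exists>t\<in>{a..b}. same_param (fst p, u) (i, t))"
        using that by (cases "fst p = i") (simp_all add: U_def same_param_def)
    qed
    show ?thesis using vel_cong_open[OF D pp U pU eq] eq[OF pU] by (simp add: pos_def)
  qed
  show ?thesis
  proof (rule same_marks_transfer[OF D D' same, of id])
    fix z p q assume "passes D z p q"
    then have "p \<in> marked D" "q \<in> marked D" by (auto simp: passes_def marked_def)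
    then show "cdet (vel D' p) (vel D' q) > 0 \<longleftrightarrow> cdet (vel D p) (vel D q) > 0" by (simp add: near)
  qed (simp_all add: near)
qed

text \<open>\<open>cdet (L 1) (L \<i>)\<close> is the determinant of \<open>L\<close>, the factor by
  which oriented areas change.\<close>

lemma cdet_linear:
  assumes "linear L" shows "cdet (L u) (L v) = cdet (L 1) (L \<i>) * cdet u v"
proof -
  have *: "L w = Re w *\<^sub>R L 1 + Im w *\<^sub>R L \<i>" for w
  proof -
    have "w = Re w *\<^sub>R 1 + Im w *\<^sub>R \<i>" by (simp add: complex_eq_iff)
    then have "L w = L (Re w *\<^sub>R 1 + Im w *\<^sub>R \<i>)" by simp
    then show ?thesis using assms by (simp only: linear_add linear_scale)
  qed
  show ?thesis unfolding *[of u] *[of v] by (simp add: cdet_def algebra_simps)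
qed

lemma cdet_inj_nonzero:
  assumes L: "linear L" "inj L" shows "cdet (L 1) (L \<i>) \<noteq> 0"
proof
  assume 0: "cdet (L 1) (L \<i>) = 0"
  have comb: "L (Complex x y) = x *\<^sub>R L 1 + y *\<^sub>R L \<i>" for x y
  proof -
    have "Complex x y = x *\<^sub>R 1 + y *\<^sub>R \<i>" by (simp add: complex_eq_iff)
    then show ?thesis using L(1) by (simp only: linear_add linear_scale)
  qed
  have ker: "w = 0" if "L w = 0" for w using injD[OF L(2), of w 0] linear_0[OF L(1)] that by simp
  \<comment> \<open>The rows of the matrix of \<open>L\<close>, turned by a right angle: each is
    orthogonal to its own row, and to the other row because the determinant vanishes.\<close>
  have "L (Complex (Re (L \<i>)) (- Re (L 1))) = 0" "L (Complex (Im (L \<i>)) (- Im (L 1))) = 0"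
    using 0 unfolding comb by (auto simp: complex_eq_iff cdet_def algebra_simps)
  then have "Complex (Re (L \<i>)) (- Re (L 1)) = 0" "Complex (Im (L \<i>)) (- Im (L 1)) = 0"
    by (auto intro: ker)
  then have "L 1 = 0" by (simp add: complex_eq_iff)
  then show False using ker[of 1] by simp
qed

text \<open>Only the final map acts on the diagram, but the path to it controls orientations: the
  determinant of the derivative starts at 1 and has no zero along the isotopy, so it ends
  positive.\<close>

lemma planar_isotopic_invariant:
  assumes D: "virtual_link_diagram D" and D': "virtual_link_diagram D'" and move: "planar_isotopic D D'"
  shows "binary_bracket D' = binary_bracket D \<and> writhe D' = writhe D"
proof -
  obtain H where same: "comps D' = comps D" "overs D' = overs D" "unders D' = unders D"
    and H: "ambient_isotopy H" and curve: "\<And>i s. i < comps D \<Longrightarrow> curve D' i s = H 1 (curve D i s)"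
    using move unfolding planar_isotopic_def by blast
  have H0: "\<And>z. H 0 z = z" and bij: "bij (H 1)" using H unfolding ambient_isotopy_def by auto
  obtain H' :: "real \<Rightarrow> complex \<Rightarrow> complex \<Rightarrow>\<^sub>L complex" where cont: "continuous_on ({0..1} \<times> UNIV) (\<lambda>(t, z). H' t z)"
    and deriv: "\<And>t z. t \<in> {0..1} \<Longrightarrow> (H t has_derivative blinfun_apply (H' t z)) (at z)"
    and inj: "\<And>t z. t \<in> {0..1} \<Longrightarrow> inj (blinfun_apply (H' t z))"
    using H unfolding ambient_isotopy_def by blast
  have lin: "linear (blinfun_apply (H' t z))" for t z
    by (simp add: blinfun.bounded_linear_right bounded_linear.linear)
  have pos_det: "cdet (H' 1 z 1) (H' 1 z \<i>) > 0" for z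
  proof (rule ccontr)
    assume neg: "\<not> cdet (H' 1 z 1) (H' 1 z \<i>) > 0"
    let ?d = "\<lambda>t. cdet (H' t z 1) (H' t z \<i>)"
    have "(H 0 has_derivative (\<lambda>w. w)) (at z)" using H0 by (simp add: ext[of "H 0" "\<lambda>z. z"])
    moreover have "(H 0 has_derivative blinfun_apply (H' 0 z)) (at z)" using deriv[of 0 z] by simp
    ultimately have "blinfun_apply (H' 0 z) = (\<lambda>w. w)" using has_derivative_unique by blast
    then have d0: "?d 0 = 1" by (simp add: cdet_def)
    have "continuous_on {0..1} (\<lambda>t. (\<lambda>(t, z). H' t z) (t, z))"
      by (rule continuous_on_compose2[OF cont]) (auto intro!: continuous_intros)
    then have "continuous_on {0..1} (\<lambda>t. H' t z)" by simp
    then have "continuous_on {0..1} ?d" unfolding cdet_def by (intro continuous_intros)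
    then have "\<exists>t. 0 \<le> t \<and> t \<le> 1 \<and> ?d t = 0"
      using d0 neg by (intro IVT2') simp_all
    then obtain t where "t \<in> {0..1}" "?d t = 0" by auto
    then show False using cdet_inj_nonzero[OF lin inj] by blast
  qed
  have vel: "vel D' p = H' 1 (pos D p) (vel D p)" if p: "p \<in> params D" for p
  proof (rule vel_eqI)
    have "(H 1 \<circ> curve D (fst p) has_vector_derivative H' 1 (pos D p) (vel D p)) (at (snd p))"
      by (rule vector_derivative_diff_chain_within[OF has_vel[OF D p]])
        (use deriv[of 1 "pos D p"] in \<open>simp add: pos_def has_derivative_at_withinI\<close>)
    also have "H 1 \<circ> curve D (fst p) = curve D' (fst p)" using curve p by (auto simp: mem_params)
    finally show "(curve D' (fst p) has_vector_derivative H' 1 (pos D p) (vel D p)) (at (snd p))" .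
  qed
  show ?thesis
  proof (rule same_marks_transfer[OF D D' same, of "H 1"])
    fix z p q assume z: "passes D z p q"
    then have "p \<in> params D" "q \<in> params D" "pos D p = z" "pos D q = z" 
      using passes_double[OF D z] by (simp_all add: double_def passes_def)
    then show "cdet (vel D' p) (vel D' q) > 0 \<longleftrightarrow> cdet (vel D p) (vel D q) > 0"
      using pos_det[of z] by (simp add: vel cdet_linear[OF lin, of _ _ "vel D p"] zero_less_mult_iff)
  next
    fix p assume "p \<in> marked D"
    then have "p \<in> params D" using marked_subset[OF D] by blast
    then show "pos D' p = H 1 (pos D p)" by (simp add: pos_def mem_params curve)
  qed (rule bij_is_inj[OF bij])
qed

section \<open>Changes of parameter of one circle\<close>

context
  fixes e :: real and f :: "real \<Rightarrow> real"
  assumes diffeo: "circle_diffeo e f" and e: "e = 1 \<or> e = -1"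
begin

lemma circle_diffeo_deriv: "(f has_real_derivative deriv f s) (at s)" "e * deriv f s > 0"
  using diffeo unfolding circle_diffeo_def
  by (simp_all add: C1_differentiable_on_eq DERIV_deriv_iff_real_differentiable)

lemma circle_diffeo_mono:
  assumes "s < t" shows "e * f s < e * f t"
proof (rule DERIV_pos_imp_increasing[OF assms])
  fix x show "\<exists>y. ((\<lambda>x. e * f x) has_real_derivative y) (at x) \<and> 0 < y"
    using circle_diffeo_deriv[of x] DERIV_cmult by blast
qed

lemma circle_diffeo_less_iff: "e * f s < e * f t \<longleftrightarrow> s < t"
  using circle_diffeo_mono[of s t] circle_diffeo_mono[of t s] by (cases s t rule: linorder_cases) auto

lemma circle_diffeo_eq_iff: "f s = f t \<longleftrightarrow> s = t"
  using circle_diffeo_mono[of s t] circle_diffeo_mono[of t s] by (cases s t rule: linorder_cases) auto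

lemma circle_diffeo_add_int: "f (s + of_int n) = f s + e * of_int n"
proof -
  \<comment> \<open>Subtracting the linear part turns the quasi-periodic \<open>f\<close> into a
    function of period 1.\<close>
  interpret periodic_fun_simple "\<lambda>s. f s - e * s" 1
    using diffeo by unfold_locales (simp add: circle_diffeo_def algebra_simps)
  show ?thesis using plus_of_int[of s n] by (simp add: algebra_simps)
qed

lemma circle_diffeo_Ints: "f s - f t \<in> \<int> \<longleftrightarrow> s - t \<in> \<int>"
proof
  assume "s - t \<in> \<int>"
  then obtain n where "s - t = of_int n" by (auto elim: Ints_cases)
  then have "f s = f t + e * of_int n" using circle_diffeo_add_int[of t n] by (simp add: algebra_simps)
  then show "f s - f t \<in> \<int>" using e by auto
next
  assume "f s - f t \<in> \<int>"
  then obtain n where n: "f s - f t = of_int n" by (auto elim: Ints_cases)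
  from e show "s - t \<in> \<int>"
  proof
    assume "e = 1"
    then have "f s = f (t + of_int n)" using n circle_diffeo_add_int[of t n] by simp
    then show ?thesis by (simp add: circle_diffeo_eq_iff)
  next
    assume "e = -1"
    then have "f s = f (t + of_int (-n))" using n circle_diffeo_add_int[of t "-n"] by simp
    then show ?thesis by (simp add: circle_diffeo_eq_iff)
  qed
qed

text \<open>The range is connected and contains all integer translates of
  \<open>f 0\<close>.\<close>

lemma circle_diffeo_surj: "\<exists>s. f s = y"
proof -
  have "continuous_on UNIV f"
    using circle_diffeo_deriv(1) DERIV_continuous by (simp add: continuous_on_eq_continuous_within) blast
  then have "connected (range f)" by (rule connected_continuous_image) simp
  moreover have "f (of_int n) = f 0 + e * of_int n" for n
    using circle_diffeo_add_int[of 0 n] by simp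
  then have "f 0 + of_int n \<in> range f" for n
    using e by (metis minus_mult_minus mult_1 of_int_minus rangeI)
  ultimately have "{f 0 + of_int \<lfloor>y - f 0\<rfloor>..f 0 + of_int (\<lfloor>y - f 0\<rfloor> + 1)} \<subseteq> range f"
    by (intro connected_contains_Icc)
  moreover have "y \<in> {f 0 + of_int \<lfloor>y - f 0\<rfloor>..f 0 + of_int (\<lfloor>y - f 0\<rfloor> + 1)}"
    by simp linarith
  ultimately have "y \<in> range f" by blast
  then show ?thesis by auto
qed

text \<open>The factor \<open>e\<close> turns the direction round when \<open>f\<close> decreases.
  One implication needs that \<open>f\<close> maps nearby points to nearby points on the correct
  side, the other that every nearby point is reached.\<close>

lemma germ_circle_diffeo:
  assumes \<delta>: "\<delta> = 1 \<or> \<delta> = -1" and c': "\<And>u. c' (i, u) = c (j, f u)"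
  shows "germ c' (i, s) \<delta> b \<longleftrightarrow> germ c (j, f s) (e * \<delta>) b"
proof
  assume "germ c (j, f s) (e * \<delta>) b"
  then have ev: "\<forall>\<^sub>F d in at_right 0. c (j, f s + e * \<delta> * d) = b" by (simp add: germ_def)
  \<comment> \<open>The distance travelled by \<open>f\<close> is positive for positive
    \<open>d\<close> and tends to 0, so a germ in the image pulls back.\<close>
  have lim: "filterlim (\<lambda>d. e * \<delta> * (f (s + \<delta> * d) - f s)) (at_right 0) (at_right 0)"
    unfolding filterlim_at
  proof (intro conjI)
    have "isCont f s" using circle_diffeo_deriv(1) by (rule DERIV_isCont)
    moreover have "((\<lambda>d. s + \<delta> * d) \<longlongrightarrow> s + \<delta> * 0) (at_right 0)" by (intro tendsto_intros)
    ultimately have "((\<lambda>d. f (s + \<delta> * d)) \<longlongrightarrow> f s) (at_right 0)"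
      using isCont_tendsto_compose[of s f] by simp
    then have "((\<lambda>d. e * \<delta> * (f (s + \<delta> * d) - f s)) \<longlongrightarrow> e * \<delta> * (f s - f s)) (at_right 0)"
      by (intro tendsto_intros)
    then show "((\<lambda>d. e * \<delta> * (f (s + \<delta> * d) - f s)) \<longlongrightarrow> 0) (at_right 0)" by simp
    have "e * \<delta> * (f (s + \<delta> * d) - f s) > 0" if "d > 0" for d
      using \<delta> circle_diffeo_mono[of s "s + \<delta> * d"] circle_diffeo_mono[of "s + \<delta> * d" s] that
      by (auto simp: algebra_simps)
    then show "\<forall>\<^sub>F d in at_right 0. e * \<delta> * (f (s + \<delta> * d) - f s) \<in> {0<..} \<and> e * \<delta> * (f (s + \<delta> * d) - f s) \<noteq> 0"
      by (intro eventually_mono[OF eventually_at_right_less[of 0]]) force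
  qed
  have "e * e = 1" "\<delta> * \<delta> = 1" using e \<delta> by auto
  then have "f s + e * \<delta> * (e * \<delta> * (f (s + \<delta> * d) - f s)) = f (s + \<delta> * d)" for d
    by (metis (no_types, opaque_lifting) add.commute diff_add_cancel mult.assoc mult.commute mult.left_neutral)
  then show "germ c' (i, s) \<delta> b"
    using filterlim_iff[THEN iffD1, OF lim, rule_format, OF ev] by (simp add: germ_def c')
next
  assume "germ c' (i, s) \<delta> b"
  then obtain \<epsilon> where \<epsilon>: "\<epsilon> > 0" "\<And>d. 0 < d \<Longrightarrow> d < \<epsilon> \<Longrightarrow> c (j, f (s + \<delta> * d)) = b"
    by (auto simp: germ_iff c')
  \<comment> \<open>The distance travelled by \<open>f\<close> while the parameter moves by
    \<open>\<epsilon>\<close>; by monotonicity each shorter distance is reached earlier.\<close>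
  define \<epsilon>' where "\<epsilon>' = e * \<delta> * (f (s + \<delta> * \<epsilon>) - f s)"
  have "\<epsilon>' > 0"
    using \<delta> circle_diffeo_mono[of s "s + \<delta> * \<epsilon>"] circle_diffeo_mono[of "s + \<delta> * \<epsilon>" s] \<epsilon>(1)
    by (auto simp: algebra_simps \<epsilon>'_def)
  moreover have "c (j, f s + e * \<delta> * d) = b" if d: "0 < d" "d < \<epsilon>'" for d
  proof -
    obtain u where u: "f u = f s + e * \<delta> * d" using circle_diffeo_surj by blast
    have "e * f u = e * f s + \<delta> * d" using e unfolding u by (auto simp: algebra_simps)
    moreover have "e * f (s + \<delta> * \<epsilon>) = e * f s + \<delta> * \<epsilon>'" using e \<delta> by (auto simp: \<epsilon>'_def algebra_simps)
    ultimately have "\<delta> * (u - s) > 0" "\<delta> * (u - s) < \<epsilon>"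
      using \<delta> d circle_diffeo_less_iff[of s u] circle_diffeo_less_iff[of u s] 
        circle_diffeo_less_iff[of "s + \<delta> * \<epsilon>" u] circle_diffeo_less_iff[of u "s + \<delta> * \<epsilon>"] by auto
    then have "c (j, f (s + \<delta> * (\<delta> * (u - s)))) = b" by (rule \<epsilon>(2))
    moreover have "s + \<delta> * (\<delta> * (u - s)) = u" using \<delta> by auto
    ultimately show ?thesis by (simp add: u[symmetric])
  qed
  ultimately show "germ c (j, f s) (e * \<delta>) b" unfolding germ_iff fst_conv snd_conv by blast
qed

end

section \<open>Pullback along a change of parameter of the whole diagram\<close>

context
  fixes D D' :: vdiagram and \<pi> :: "nat \<Rightarrow> nat" and f :: "nat \<Rightarrow> real \<Rightarrow> real" and e :: "nat \<Rightarrow> real"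
  assumes D: "virtual_link_diagram D" and D': "virtual_link_diagram D'"
    and comps: "comps D' = comps D" and perm: "\<pi> permutes {..<comps D}"
    and e: "\<And>i. i < comps D \<Longrightarrow> e i = 1 \<or> e i = -1"
    and diffeo: "\<And>i. i < comps D \<Longrightarrow> circle_diffeo (e i) (f i)"
    and curve: "\<And>i s. i < comps D \<Longrightarrow> curve D' i s = curve D (\<pi> i) (f i s)"
    and over: "\<And>i s. i < comps D \<Longrightarrow> (i, s) \<in> overs D' \<longleftrightarrow> (\<pi> i, f i s) \<in> overs D"
    and under: "\<And>i s. i < comps D \<Longrightarrow> (i, s) \<in> unders D' \<longleftrightarrow> (\<pi> i, f i s) \<in> unders D"
begin

abbreviation "\<Phi> \<equiv> \<lambda>p. (\<pi> (fst p), f (fst p) (snd p))"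

lemma comps_params: "params D' = params D"
  using comps by (simp add: params_def)

lemma perm_less: "i < comps D \<Longrightarrow> \<pi> i < comps D"
  using permutes_in_image[OF perm, of i] by simp

lemma change_params: "p \<in> params D \<Longrightarrow> \<Phi> p \<in> params D"
  by (simp add: mem_params perm_less)

lemma change_surj: 
  assumes "q \<in> params D" shows "\<exists>p\<in>params D. \<Phi> p = q"
proof -
  obtain i where i: "i < comps D" "\<pi> i = fst q" 
    using assms permutes_image[OF perm] unfolding mem_params by (metis imageE lessThan_iff)
  obtain s where "f i s = snd q" using circle_diffeo_surj[OF diffeo[OF i(1)] e[OF i(1)]] by blast
  then show ?thesis using i by (intro bexI[of _ "(i, s)"]) (auto simp: mem_params)
qed

lemma change_inj: "p \<in> params D \<Longrightarrow> q \<in> params D \<Longrightarrow> \<Phi> p = \<Phi> q \<longleftrightarrow> p = q"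
  using permutes_inj[OF perm] circle_diffeo_eq_iff[OF diffeo e]
  by (auto simp: mem_params prod_eq_iff inj_eq)

lemma change_same_param: 
  "p \<in> params D \<Longrightarrow> q \<in> params D \<Longrightarrow> same_param (\<Phi> p) (\<Phi> q) \<longleftrightarrow> same_param p q"
  using permutes_inj[OF perm] circle_diffeo_Ints[OF diffeo e]
  by (auto simp: mem_params same_param_def inj_eq)

lemma change_marked: 
  assumes "p \<in> params D"
  shows "p \<in> overs D' \<longleftrightarrow> \<Phi> p \<in> overs D" "p \<in> unders D' \<longleftrightarrow> \<Phi> p \<in> unders D" 
    "p \<in> marked D' \<longleftrightarrow> \<Phi> p \<in> marked D"
  using assms over[of "fst p" "snd p"] under[of "fst p" "snd p"] by (auto simp: marked_def mem_params)

lemma change_passes: 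
  assumes "p \<in> params D" "q \<in> params D"
  shows "passes D' z p q \<longleftrightarrow> passes D z (\<Phi> p) (\<Phi> q)"
proof -
  have "pos D' x = pos D (\<Phi> x)" if "x \<in> params D" for x
    using that by (simp add: pos_def curve mem_params)
  then show ?thesis using assms by (simp add: passes_def change_marked)
qed

lemma change_passes_obtain:
  assumes "z \<in> classical_crossings D" 
  obtains p q where "p \<in> params D" "q \<in> params D" "passes D' z p q" "passes D z (\<Phi> p) (\<Phi> q)"
proof -
  obtain p' q' where z: "passes D z p' q'" using assms unfolding crossing_passes[OF D] by blast
  then have "p' \<in> params D" "q' \<in> params D" using passes_double[OF D z] by (simp_all add: double_def)
  then obtain p q where "p \<in> params D" "q \<in> params D" "\<Phi> p = p'" "\<Phi> q = q'" using change_surj by meson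
  then show ?thesis using that[of p q] z change_passes[of p q z] by simp
qed

lemma change_crossings: "classical_crossings D' = classical_crossings D"
proof (rule set_eqI, rule iffI)
  fix z assume "z \<in> classical_crossings D'"
  then obtain p q where z: "passes D' z p q" unfolding crossing_passes[OF D'] by blast
  then have "p \<in> params D" "q \<in> params D" 
    using passes_double[OF D' z] by (simp_all add: double_def comps_params)
  from change_passes[OF this, THEN iffD1, OF z]
  show "z \<in> classical_crossings D" unfolding crossing_passes[OF D] by blast
next
  fix z assume "z \<in> classical_crossings D"
  then show "z \<in> classical_crossings D'"
    by (rule change_passes_obtain) (unfold crossing_passes[OF D'], blast)
qed

lemma change_vel: 
  assumes "p \<in> params D" 
  shows "vel D' p = deriv (f (fst p)) (snd p) *\<^sub>R vel D (\<Phi> p)"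
proof (rule vel_eqI)
  have i: "fst p < comps D" using assms by (simp add: mem_params)
  have "(curve D (\<pi> (fst p)) \<circ> f (fst p) has_vector_derivative deriv (f (fst p)) (snd p) *\<^sub>R vel D (\<Phi> p)) (at (snd p))"
    using has_vel[OF D change_params[OF assms]] circle_diffeo_deriv(1)[OF diffeo e, OF i i]
    by (intro vector_diff_chain_at) (simp_all add: has_real_derivative_iff_has_vector_derivative)
  also have "curve D (\<pi> (fst p)) \<circ> f (fst p) = curve D' (fst p)" using curve[OF i] by auto
  finally show "(curve D' (fst p) has_vector_derivative deriv (f (fst p)) (snd p) *\<^sub>R vel D (\<Phi> p)) (at (snd p))" .
qed

definition change_coloring :: "(point \<Rightarrow> bool) \<Rightarrow> point \<Rightarrow> bool" where
  "change_coloring c p \<longleftrightarrow> p \<in> params D \<and> c (\<Phi> p)"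

lemma change_germ:
  assumes "p \<in> params D" "\<delta> = 1 \<or> \<delta> = -1"
  shows "germ (change_coloring c) p \<delta> b \<longleftrightarrow> germ c (\<Phi> p) (e (fst p) * \<delta>) b"
proof -
  have i: "fst p < comps D" using assms by (simp add: mem_params)
  show ?thesis
    using germ_circle_diffeo[OF diffeo[OF i] e[OF i] assms(2), 
        of "change_coloring c" "fst p" c "\<pi> (fst p)" "snd p" b] i
    by (simp add: change_coloring_def mem_params)
qed

text \<open>If \<open>e\<close> is -1 on the component, the forward and backward half branches
  change places; the condition survives because a change of color is symmetric.\<close>

lemma change_color_at:
  assumes p: "p \<in> params D"
  shows "color_at (marked D') (change_coloring c) p \<longleftrightarrow> color_at (marked D) c (\<Phi> p)"
proof -
  have ep: "e (fst p) = 1 \<or> e (fst p) = -1" using e p by (simp add: mem_params)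
  have cp: "change_coloring c p = c (\<Phi> p)" using p by (simp add: change_coloring_def)
  show ?thesis
  proof
    assume "color_at (marked D) c (\<Phi> p)"
    note * = color_at_sgnD[OF this ep]
    have "germ c (\<Phi> p) (- e (fst p)) (branch_value c (\<Phi> p) (- e (fst p)))"
      using color_at_sgnD[OF \<open>color_at (marked D) c (\<Phi> p)\<close>, of "- e (fst p)"] ep by auto
    then show "color_at (marked D') (change_coloring c) p"
      using * change_germ[OF p, of 1] change_germ[OF p, of "-1"] change_marked(3)[OF p] cp
      unfolding color_at_def by (intro exI[of _ "branch_value c (\<Phi> p) (e (fst p))"]) simp
  next
    assume "color_at (marked D') (change_coloring c) p"
    then obtain b where "germ (change_coloring c) p 1 b" "germ (change_coloring c) p (-1) (b \<noteq> (p \<in> marked D'))"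
      "change_coloring c p = (b \<and> p \<notin> marked D')" unfolding color_at_def by blast
    then show "color_at (marked D) c (\<Phi> p)"
      using ep change_germ[OF p, of 1] change_germ[OF p, of "-1"] change_marked(3)[OF p] cp
      by (intro color_atI[of "e (fst p)" c "\<Phi> p" b]) auto
  qed
qed

text \<open>An equivalence rather than an implication, so that it also yields surjectivity of the
  pullback.\<close>

lemma change_coloring_iff:
  assumes "\<And>q. q \<notin> params D \<Longrightarrow> \<not> c q"
  shows "change_coloring c \<in> colorings D' \<longleftrightarrow> c \<in> colorings D"
proof -
  have 1: "(\<forall>p\<in>params D. color_at (marked D') (change_coloring c) p) \<longleftrightarrow> (\<forall>q\<in>params D. color_at (marked D) c q)"
    using change_color_at change_surj change_params by metis
  have "(\<forall>p q. p \<in> params D \<and> same_param p q \<longrightarrow> change_coloring c p = change_coloring c q)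
    \<longleftrightarrow> (\<forall>p\<in>params D. \<forall>q\<in>params D. same_param p q \<longrightarrow> c (\<Phi> p) = c (\<Phi> q))"
    using same_param_params[of _ _ D] unfolding change_coloring_def by blast
  also have "\<dots> \<longleftrightarrow> (\<forall>p\<in>params D. \<forall>q\<in>params D. same_param (\<Phi> p) (\<Phi> q) \<longrightarrow> c (\<Phi> p) = c (\<Phi> q))"
    using change_same_param by blast
  also have "\<dots> \<longleftrightarrow> (\<forall>p\<in>params D. \<forall>q\<in>params D. same_param p q \<longrightarrow> c p = c q)"
    using change_surj change_params by metis
  also have "\<dots> \<longleftrightarrow> (\<forall>p q. p \<in> params D \<and> same_param p q \<longrightarrow> c p = c q)"
    using same_param_params[of _ _ D] by blast
  finally have 2: "(\<forall>p q. p \<in> params D \<and> same_param p q \<longrightarrow> change_coloring c p = change_coloring c q)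
    \<longleftrightarrow> (\<forall>p q. p \<in> params D \<and> same_param p q \<longrightarrow> c p = c q)" .
  show ?thesis
    unfolding colorings_def mem_Collect_eq comps_params 1 2 using assms by (simp add: change_coloring_def)
qed

lemma change_coloring_bij: "bij_betw change_coloring (colorings D) (colorings D')"
proof -
  have out: "\<not> c q" if "c \<in> colorings D" "q \<notin> params D" for c q
    using coloringsD(1)[OF that(1), of q] that(2) by (simp add: regular_params_eq) blast
  show ?thesis
    unfolding bij_betw_def
  proof (intro conjI inj_onI set_eqI iffI)
    fix c d assume c: "c \<in> colorings D" and d: "d \<in> colorings D" and eq: "change_coloring c = change_coloring d"
    show "c = d"
    proof
      fix q show "c q = d q"
      proof (cases "q \<in> params D")
        case True
        then obtain p where "p \<in> params D" "\<Phi> p = q" using change_surj by blast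
        then show ?thesis using fun_cong[OF eq, of p] by (simp add: change_coloring_def)
      qed (use out[OF c, of q] out[OF d, of q] in simp)
    qed
  next
    fix c' assume "c' \<in> change_coloring ` colorings D"
    then show "c' \<in> colorings D'" using change_coloring_iff out by blast
  next
    fix c' assume c': "c' \<in> colorings D'"
    \<comment> \<open>The candidate preimage; \<open>\<Phi>\<close> is injective on
      \<open>params D\<close>, so at most one \<open>p\<close> contributes.\<close>
    define c where "c q = (\<exists>p\<in>params D. \<Phi> p = q \<and> c' p)" for q
    have "change_coloring c = c'"
    proof
      fix p show "change_coloring c p = c' p"
        using coloringsD(1)[OF c', of p] change_inj[of _ p] 
        unfolding change_coloring_def c_def regular_params_eq comps_params by blast
    qed
    moreover have "\<not> c q" if "q \<notin> params D" for q
      using that change_params unfolding c_def by blast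
    ultimately show "c' \<in> change_coloring ` colorings D" using change_coloring_iff c' by (intro image_eqI) auto
  qed
qed

lemma change_sign:
  assumes "passes D' z p q" "p \<in> params D" "q \<in> params D"
  shows "sgn (cdet (vel D' p) (vel D' q)) 
    = sgn (cdet (e (fst p) *\<^sub>R vel D (\<Phi> p)) (e (fst q) *\<^sub>R vel D (\<Phi> q)))"
proof -
  have "sgn (deriv (f (fst x)) (snd x)) = e (fst x)" if "x \<in> params D" for x
    using circle_diffeo_deriv(2)[OF diffeo e, of "fst x" "snd x"] e[of "fst x"] that 
    by (auto simp: mem_params)
  moreover have "sgn (e (fst x)) = e (fst x)" if "x \<in> params D" for x
    using e[of "fst x"] that by (auto simp: mem_params)
  ultimately show ?thesis
    using assms(2,3) by (simp only: change_vel cdet_scaleR sgn_mult)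
qed

text \<open>Reversing a component changes the sign and the agreement of a crossing by the same
  factors, so their product is unaffected even if orientations change.\<close>

lemma change_exponent:
  assumes c: "c \<in> colorings D"
  shows "exponent D' (change_coloring c) = exponent D c"
  unfolding exponent_def change_crossings
proof (rule sum.cong)
  fix z assume "z \<in> classical_crossings D"
  then obtain p q where p: "p \<in> params D" and q: "q \<in> params D" 
    and z': "passes D' z p q" and z: "passes D z (\<Phi> p) (\<Phi> q)" by (rule change_passes_obtain)
  have c': "change_coloring c \<in> colorings D'" using change_coloring_bij c by (auto simp: bij_betw_def)
  have e0: "e (fst p) \<noteq> 0" "e (fst q) \<noteq> 0" using e p q by (fastforce simp: mem_params)+
  have sq: "sgn (e (fst p)) * sgn (e (fst p)) = 1" "sgn (e (fst q)) * sgn (e (fst q)) = 1"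
    using e0 by (auto simp: sgn_if)
  have bv: "branch_value (change_coloring c) x 1 = branch_value c (\<Phi> x) (e (fst x))" if "x \<in> params D" for x
    using change_germ[OF that, of 1] by (simp add: branch_value_def)
  have "real_of_int (crossing_sign D' z * agreement D' (change_coloring c) z) 
    = sgn (cdet (vel D' p) (vel D' q)) * (if branch_value (change_coloring c) p 1 = branch_value (change_coloring c) q 1 then -1 else 1)"
    using crossing_sign_direction[OF D' z', of 1 1] agreement_direction[OF D' c' z', of 1 1] by simp
  \<comment> \<open>The squares equal 1 and are inserted to be shared out between sign and
    agreement.\<close>
  also have "\<dots> = (sgn (e (fst p)) * sgn (e (fst p))) * (sgn (e (fst q)) * sgn (e (fst q))) * 
      sgn (cdet (e (fst p) *\<^sub>R vel D (\<Phi> p)) (e (fst q) *\<^sub>R vel D (\<Phi> q))) 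
    * (if branch_value c (\<Phi> p) (e (fst p)) = branch_value c (\<Phi> q) (e (fst q)) then -1 else 1)"
    unfolding sq change_sign[OF z' p q] by (simp only: bv p q mult_1)
  also have "\<dots> = real_of_int (crossing_sign D z * agreement D c z)"
    unfolding of_int_mult crossing_sign_direction[OF D z e0] agreement_direction[OF D c z e0]
    by (simp only: mult_ac)
  finally show "crossing_sign D' z * agreement D' (change_coloring c) z = crossing_sign D z * agreement D c z"
    by (simp only: of_int_eq_iff)
qed simp

lemma change_bracket: "binary_bracket D' = binary_bracket D"
  using bracket_transfer[OF D D' change_coloring_bij, of 0] by (simp add: change_exponent)

text \<open>Reversing one of two crossing components negates the signs of their crossings, hence the
  restriction to orientation-preserving changes.\<close>

lemma change_writhe:
  assumes "\<And>i. i < comps D \<Longrightarrow> e i = 1" shows "writhe D' = writhe D"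
  unfolding writhe_def change_crossings
proof (rule sum.cong)
  fix z assume "z \<in> classical_crossings D"
  then obtain p q where p: "p \<in> params D" and q: "q \<in> params D" 
    and z': "passes D' z p q" and z: "passes D z (\<Phi> p) (\<Phi> q)" by (rule change_passes_obtain)
  have "real_of_int (crossing_sign D' z) = real_of_int (crossing_sign D z)"
    using crossing_sign_direction[OF D' z', of 1 1] crossing_sign_direction[OF D z, of 1 1] 
      change_sign[OF z' p q] assms p q by (simp add: mem_params)
  then show "crossing_sign D' z = crossing_sign D z" by (simp only: of_int_eq_iff)
qed simp

end

lemma reparametrized_invariant:
  assumes D: "virtual_link_diagram D" and D': "virtual_link_diagram D'" 
    and E: "E \<subseteq> {1, -1}" and move: "reparametrized E D D'"
  shows "binary_bracket D' = binary_bracket D \<and> (E = {1} \<longrightarrow> writhe D' = writhe D)"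
proof -
  obtain \<pi> f where comps: "comps D' = comps D" and perm: "\<pi> permutes {..<comps D}" 
    and "\<forall>i<comps D. \<exists>e\<in>E. circle_diffeo e (f i)"
    and *: "\<forall>i<comps D. \<forall>s. curve D' i s = curve D (\<pi> i) (f i s) \<and>
          ((i, s) \<in> overs D' \<longleftrightarrow> (\<pi> i, f i s) \<in> overs D) \<and>
          ((i, s) \<in> unders D' \<longleftrightarrow> (\<pi> i, f i s) \<in> unders D)"
    using move unfolding reparametrized_def by (elim conjE exE) (rule that)
  then have "\<forall>i. \<exists>e. i < comps D \<longrightarrow> e \<in> E \<and> circle_diffeo e (f i)" by blast
  then obtain e where e: "\<forall>i. i < comps D \<longrightarrow> e i \<in> E \<and> circle_diffeo (e i) (f i)" by (rule choice[THEN exE])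
  have e1: "e i = 1 \<or> e i = -1" if "i < comps D" for i using e E that by blast
  have 1: "circle_diffeo (e i) (f i)" if "i < comps D" for i using e that by blast
  have 2: "curve D' i s = curve D (\<pi> i) (f i s)" "(i, s) \<in> overs D' \<longleftrightarrow> (\<pi> i, f i s) \<in> overs D"
    "(i, s) \<in> unders D' \<longleftrightarrow> (\<pi> i, f i s) \<in> unders D" if "i < comps D" for i s
    using * that by blast+
  note facts = D D' comps perm e1 1 2
  show ?thesis
  proof (intro conjI impI)
    show "binary_bracket D' = binary_bracket D" by (rule change_bracket[OF facts])
    assume "E = {1}"
    then have "e i = 1" if "i < comps D" for i using e that by blast
    then show "writhe D' = writhe D" by (intro change_writhe[OF facts])
  qed
qed

section \<open>Replacing strands\<close>

text \<open>The changes of color accumulated on arrival at \<open>t\<close>; a change at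
  \<open>t\<close> itself is not counted and enters separately.\<close>

definition parity :: "real set \<Rightarrow> real \<Rightarrow> bool" where
  "parity M t \<longleftrightarrow> odd (card {m \<in> M. m < t})"

lemma parity_near:
  assumes "finite M"
  obtains \<delta> where "\<delta> > 0" 
    and "\<And>d. 0 < d \<Longrightarrow> d < \<delta> \<Longrightarrow> t + d \<notin> M \<and> t - d \<notin> M \<and> 
      parity M (t + d) = (parity M t \<noteq> (t \<in> M)) \<and> parity M (t - d) = parity M t"
proof -
  obtain \<delta> where \<delta>: "\<delta> > 0" "\<forall>x\<in>M. x \<noteq> t \<longrightarrow> \<delta> \<le> dist t x" using finite_set_avoid[OF assms, of t] by blast
  have away: "m \<le> t - \<delta> \<or> t + \<delta> \<le> m" if "m \<in> M" "m \<noteq> t" for m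
    using \<delta>(2) that by (auto simp: dist_real_def abs_if split: if_splits)
  have "t + d \<notin> M \<and> t - d \<notin> M \<and> 
      parity M (t + d) = (parity M t \<noteq> (t \<in> M)) \<and> parity M (t - d) = parity M t" if d: "0 < d" "d < \<delta>" for d
  proof (intro conjI)
    show "t + d \<notin> M" "t - d \<notin> M" using away[of "t + d"] away[of "t - d"] d by auto
    have "{m \<in> M. m < t - d} = {m \<in> M. m < t}" using away d by force
    then show "parity M (t - d) = parity M t" by (simp add: parity_def)
    show "parity M (t + d) = (parity M t \<noteq> (t \<in> M))"
    proof (cases "t \<in> M")
      case True
      have "m < t + d \<longleftrightarrow> m = t \<or> m < t" if "m \<in> M" for m using away[OF that] d by linarith
      then have "{m \<in> M. m < t + d} = insert t {m \<in> M. m < t}" using True by blast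
      moreover have "finite {m \<in> M. m < t}" using assms by simp
      ultimately show ?thesis using True by (simp add: parity_def)
    next
      case False
      have "m < t + d \<longleftrightarrow> m < t" if "m \<in> M" for m using away[OF that] d False that by (cases "m = t") auto
      then have "{m \<in> M. m < t + d} = {m \<in> M. m < t}" by blast
      then show ?thesis using False by (simp add: parity_def)
    qed
  qed
  then show ?thesis using \<delta>(1) that by blast
qed

text \<open>Left of all marks none has been passed, and right of them an even number, so no net
  change remains at either end.\<close>

lemma parity_outside:
  assumes "even (card M)" "M \<subseteq> {-a..a}" "a < \<bar>t\<bar>" shows "\<not> parity M t"
proof (cases "t > 0")
  case True
  then have "{m \<in> M. m < t} = M" using assms(2,3) by force
  then show ?thesis using assms(1) by (simp add: parity_def)
next
  case False
  then have "m \<ge> t" if "m \<in> M" for m using assms(2,3) that by force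
  then have none: "{m \<in> M. m < t} = {}" by force
  show ?thesis unfolding parity_def none by simp
qed

lemma parity_pair: 
  assumes "x < y" shows "parity {x, y} t \<longleftrightarrow> x < t \<and> t \<le> y"
proof -
  have "{m \<in> {x, y}. m < t} = (if y < t then {x, y} else if x < t then {x} else {})"
    using assms by auto
  then show ?thesis using assms by (simp add: parity_def)
qed

text \<open>The incoming color corrected by the number of changes so far is locally constant, hence
  constant on the interval.\<close>

lemma flipping_parity:
  fixes \<gamma> :: "real \<Rightarrow> bool"
  assumes M: "finite M" "-1 \<notin> M" "\<not> parity M (-1)"
    and local: "\<And>t. t \<in> {-1..1} \<Longrightarrow> \<exists>b. \<exists>\<delta>>0. \<gamma> t = (b \<and> t \<notin> M) \<and> 
      (\<forall>d. 0 < d \<and> d < \<delta> \<longrightarrow> \<gamma> (t + d) = b \<and> \<gamma> (t - d) = (b \<noteq> (t \<in> M)))"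
    and t: "t \<in> {-1..1}"
  shows "\<gamma> t \<longleftrightarrow> (\<gamma> (-1) \<noteq> parity M t) \<and> t \<notin> M"
proof -
  obtain b where b: "\<And>t. t \<in> {-1..1} \<Longrightarrow> \<gamma> t = (b t \<and> t \<notin> M) \<and> (\<exists>\<delta>>0. 
      (\<forall>d. 0 < d \<and> d < \<delta> \<longrightarrow> \<gamma> (t + d) = b t \<and> \<gamma> (t - d) = (b t \<noteq> (t \<in> M))))"
    using local by metis
  \<comment> \<open>\<open>b t\<close> is the color just after \<open>t\<close>, so
    \<open>b t \<noteq> (t \<in> M)\<close> is the color just before it.\<close>
  define g where "g t = ((b t \<noteq> (t \<in> M)) \<noteq> parity M t)" for t
  have "g t = g (-1)"
  proof (rule connected_local_const[where A = "{-1..1::real}"])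
    show "\<forall>u\<in>{-1..1}. \<forall>\<^sub>F v in at u within {-1..1}. g u = g v"
    proof
      fix u :: real assume u: "u \<in> {-1..1}"
      obtain \<delta> where \<delta>: "\<delta> > 0" "\<And>d. 0 < d \<Longrightarrow> d < \<delta> \<Longrightarrow> \<gamma> (u + d) = b u \<and> \<gamma> (u - d) = (b u \<noteq> (u \<in> M))"
        using b[OF u] by blast
      obtain \<delta>' where \<delta>': "\<delta>' > 0" "\<And>d. 0 < d \<Longrightarrow> d < \<delta>' \<Longrightarrow> u + d \<notin> M \<and> u - d \<notin> M \<and> 
          parity M (u + d) = (parity M u \<noteq> (u \<in> M)) \<and> parity M (u - d) = parity M u"
        using parity_near[OF M(1)] by blast
      have "g u = g v" if v: "v \<in> {-1..1}" "v \<noteq> u" "dist v u < min \<delta> \<delta>'" for v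
      proof (cases "v < u")
        case True
        then have d: "0 < u - v" "u - v < \<delta>" "u - v < \<delta>'" using v(3) by (auto simp: dist_real_def)
        show ?thesis using \<delta>(2)[OF d(1,2)] \<delta>'(2)[OF d(1,3)] b[OF v(1)] unfolding g_def by simp
      next
        case False
        then have d: "0 < v - u" "v - u < \<delta>" "v - u < \<delta>'" using v(2,3) by (auto simp: dist_real_def)
        show ?thesis using \<delta>(2)[OF d(1,2)] \<delta>'(2)[OF d(1,3)] b[OF v(1)] unfolding g_def by auto
      qed
      then show "\<forall>\<^sub>F v in at u within {-1..1}. g u = g v"
        using \<delta>(1) \<delta>'(1) unfolding eventually_at by (intro exI[of _ "min \<delta> \<delta>'"]) auto
    qed
  qed (use t in auto)
  moreover have "g (-1) = \<gamma> (-1)" using b[of "-1"] M unfolding g_def by simp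
  ultimately show ?thesis using b[OF t] unfolding g_def by auto
qed

section \<open>Strands and crossings inside the box\<close>

definition pic_double :: "(real \<Rightarrow> complex) list \<Rightarrow> nat \<Rightarrow> real \<Rightarrow> nat \<Rightarrow> real \<Rightarrow> bool" where
  "pic_double P k t l u \<longleftrightarrow> k < length P \<and> l < length P \<and> t \<in> {-1..1} \<and> u \<in> {-1..1} \<and>
     (k, t) \<noteq> (l, u) \<and> (P ! k) t = (P ! l) u"

text \<open>In the pictures to be considered all double points are classical, so the passages of a
  strand can be read off the picture alone.\<close>

definition strand_marks :: "(real \<Rightarrow> complex) list \<Rightarrow> nat \<Rightarrow> real set" where
  "strand_marks P k = {t. \<exists>l u. pic_double P k t l u}"

definition box_crossings :: "(real \<Rightarrow> complex) list \<Rightarrow> complex set" where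
  "box_crossings P = {z. \<exists>k t l u. pic_double P k t l u \<and> z = (P ! k) t}"

definition outer_crossings :: "vdiagram \<Rightarrow> strand list \<Rightarrow> complex set" where
  "outer_crossings D S = pos D ` {p \<in> overs D. \<not> on_strands S p}"

definition strand_speed :: "strand list \<Rightarrow> nat \<Rightarrow> real" where
  "strand_speed S k = snd (snd (S ! k))"

text \<open>Used with \<open>a < 1\<close> such that this part of the strands contains all passages.
  It leaves margins at the ends, on which old and new colorings agree and can be glued.\<close>

definition inner_strands :: "real \<Rightarrow> strand list \<Rightarrow> point \<Rightarrow> bool" where
  "inner_strands a S p \<longleftrightarrow> (\<exists>k<length S. \<exists>t\<in>{-a..a}. same_param p (strand_pt (S ! k) t))"

lemma on_strands_inner: "on_strands S p \<longleftrightarrow> inner_strands 1 S p"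
  by (simp add: on_strands_def inner_strands_def)

lemma strand_pt_eq: "strand_pt (S ! k) t = (fst (S ! k), fst (snd (S ! k)) + strand_speed S k * t)"
  by (cases "S ! k") (simp add: strand_speed_def)

lemma strand_pt_add: 
  "same_param p (strand_pt (S ! k) t) \<Longrightarrow> 
     same_param (fst p, snd p + strand_speed S k * d) (strand_pt (S ! k) (t + d))"
  by (simp add: strand_pt_eq same_param_def algebra_simps)

lemma not_inner_strands_near:
  assumes "\<not> inner_strands a S p"
  shows "\<exists>\<delta>>0. \<forall>u. \<bar>u - snd p\<bar> < \<delta> \<longrightarrow> \<not> inner_strands a S (fst p, u)"
proof -
  define T where "T k = (\<lambda>t. fst (snd (S ! k)) + strand_speed S k * t) ` {-a..a}" for k
  define N where "N = (\<Union>k\<in>{k. k < length S \<and> fst p = fst (S ! k)}. {s. \<exists>t\<in>T k. s - t \<in> \<int>})"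
  have "compact (T k)" for k
    unfolding T_def by (intro compact_continuous_image continuous_intros compact_Icc)
  then have "closed {s. \<exists>t\<in>T k. s - t \<in> \<int>}" for k by (rule closed_mod_int)
  then have "closed N" unfolding N_def by (intro closed_UN) auto
  then have "open (- N)" by (rule open_Compl)
  have iff: "inner_strands a S (fst p, u) \<longleftrightarrow> u \<in> N" for u
    unfolding inner_strands_def N_def same_param_def strand_pt_eq T_def by auto
  have "snd p \<in> - N" using assms iff[of "snd p"] by simp
  then obtain \<delta> where "\<delta> > 0" "\<forall>u. dist u (snd p) < \<delta> \<longrightarrow> u \<in> - N"
    using \<open>open (- N)\<close>[unfolded open_dist] by blast
  then show ?thesis using iff by (intro exI[of _ \<delta>]) (simp add: dist_real_def)
qed

text \<open>The clause on double points leaves open which strand lies above, so it covers layered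
  pictures as well as both kinks. Evenness gives a strand equal colors at its ends, and
  \<open>a\<close> keeps the passages away from them.\<close>

locale strand_picture =
  fixes D :: vdiagram and S :: "strand list" and P :: "(real \<Rightarrow> complex) list" and a :: real
  assumes D: "virtual_link_diagram D" and embedded: "embedded_strands D S" 
    and picture: "box_picture D S P"
    and box: "\<And>k t. k < length P \<Longrightarrow> t \<in> {-1..1} \<Longrightarrow> (P ! k) t \<in> move_box"
    and classical: "\<And>k t l u. pic_double P k t l u \<Longrightarrow> 
      strand_pt (S ! k) t \<in> overs D \<and> strand_pt (S ! l) u \<in> unders D \<or>
      strand_pt (S ! k) t \<in> unders D \<and> strand_pt (S ! l) u \<in> overs D"
    and a: "0 \<le> a" "a < 1" 
    and marks: "\<And>k. k < length P \<Longrightarrow> strand_marks P k \<subseteq> {-a..a}" 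
      "\<And>k. k < length P \<Longrightarrow> finite (strand_marks P k)" 
      "\<And>k. k < length P \<Longrightarrow> even (card (strand_marks P k))"
begin

lemma len: "length S = length P"
  using picture by (simp add: box_picture_def)

lemma strand_params: "k < length P \<Longrightarrow> strand_pt (S ! k) t \<in> params D"
  using embedded len unfolding embedded_strands_def by metis

lemma strand_pos: "k < length P \<Longrightarrow> t \<in> {-1..1} \<Longrightarrow> pos D (strand_pt (S ! k) t) = (P ! k) t"
  using picture unfolding box_picture_def by blast

lemma strand_unique:
  assumes "k < length P" "l < length P" "t \<in> {-1..1}" "u \<in> {-1..1}" 
    "same_param (strand_pt (S ! k) t) (strand_pt (S ! l) u)"
  shows "k = l" "t = u"
  using embedded assms len unfolding embedded_strands_def by metis+

text \<open>With speed 0 the strand parameters 0 and 1 would name the same point.\<close>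

lemma strand_speed_nonzero: "k < length P \<Longrightarrow> strand_speed S k \<noteq> 0"
  using strand_unique(2)[of k k 0 1] by (auto simp: strand_pt_eq)

lemma inside_iff: 
  assumes "p \<in> params D" shows "on_strands S p \<longleftrightarrow> pos D p \<in> move_box"
proof
  assume "on_strands S p"
  then obtain k t where "k < length P" "t \<in> {-1..1}" "same_param p (strand_pt (S ! k) t)"
    unfolding on_strands_def len by blast
  then show "pos D p \<in> move_box" using pos_same_param[OF D _ assms] strand_pos box by simp
qed (use picture assms in \<open>auto simp: box_picture_def\<close>)

text \<open>The partner of a marked point has the same position, hence lies in the box and on a
  strand; so every passage on a strand comes from a double point of the picture.\<close>

lemma strand_marked_iff:
  assumes "k < length P" "t \<in> {-1..1}"
  shows "strand_pt (S ! k) t \<in> marked D \<longleftrightarrow> t \<in> strand_marks P k"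
proof
  assume "t \<in> strand_marks P k"
  then show "strand_pt (S ! k) t \<in> marked D" using classical unfolding strand_marks_def marked_def by blast
next
  let ?p = "strand_pt (S ! k) t"
  assume "?p \<in> marked D"
  then obtain q where q: "double D ?p q" using marked_double[OF D] by blast
  then have "pos D q = (P ! k) t" "q \<in> params D" using strand_pos[OF assms] by (simp_all add: double_def)
  then have "on_strands S q" using inside_iff box[OF assms] by simp
  then obtain l u where l: "l < length P" "u \<in> {-1..1}" "same_param q (strand_pt (S ! l) u)"
    unfolding on_strands_def len by blast
  then have "(P ! l) u = (P ! k) t" 
    using pos_same_param[OF D l(3) \<open>q \<in> params D\<close>] strand_pos[OF l(1,2)] \<open>pos D q = (P ! k) t\<close> by simp
  moreover have "(k, t) \<noteq> (l, u)" using l(3) q same_param_sym unfolding double_def by blast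
  ultimately have "pic_double P k t l u" using assms l by (simp add: pic_double_def)
  then show "t \<in> strand_marks P k" unfolding strand_marks_def by blast
qed

lemma ends_unmarked: 
  assumes "k < length P" "a < \<bar>t\<bar>" 
  shows "t \<notin> strand_marks P k" "\<not> parity (strand_marks P k) t"
  using marks[OF assms(1)] assms(2) parity_outside by force+

lemma coloring_strand:
  assumes c: "c \<in> colorings D" and k: "k < length P" and t: "t \<in> {-1..1}"
  shows "c (strand_pt (S ! k) t) \<longleftrightarrow> 
    (c (strand_pt (S ! k) (-1)) \<noteq> parity (strand_marks P k) t) \<and> t \<notin> strand_marks P k"
proof (rule flipping_parity[where \<gamma> = "\<lambda>t. c (strand_pt (S ! k) t)", OF marks(2)[OF k] _ _ _ t])
  show "-1 \<notin> strand_marks P k" "\<not> parity (strand_marks P k) (-1)" using ends_unmarked[OF k, of "-1"] a by auto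
  fix t :: real assume t: "t \<in> {-1..1}"
  let ?p = "strand_pt (S ! k) t" and ?r = "strand_speed S k"
  note r = strand_speed_nonzero[OF k]
  have at: "color_at (marked D) c ?p" using coloringsD(3)[OF c strand_params[OF k]] .
  note p = color_atD[OF at r]
  have "germ c ?p (- ?r) (branch_value c ?p (- ?r))" using color_atD(1)[OF at, of "- ?r"] r by simp
  then obtain \<delta>' where \<delta>': "\<delta>' > 0" "\<forall>d. 0 < d \<and> d < \<delta>' \<longrightarrow> c (fst ?p, snd ?p + - ?r * d) = branch_value c ?p (- ?r)"
    unfolding germ_iff by blast
  obtain \<delta> where \<delta>: "\<delta> > 0" "\<forall>d. 0 < d \<and> d < \<delta> \<longrightarrow> c (fst ?p, snd ?p + ?r * d) = branch_value c ?p ?r"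
    using p(1) unfolding germ_iff by blast
  have pts: "(fst ?p, snd ?p + ?r * d) = strand_pt (S ! k) (t + d)" 
    "(fst ?p, snd ?p + - ?r * d) = strand_pt (S ! k) (t - d)" for d
    by (simp_all add: strand_pt_eq algebra_simps)
  show "\<exists>b. \<exists>\<delta>>0. c ?p = (b \<and> t \<notin> strand_marks P k) \<and> (\<forall>d. 0 < d \<and> d < \<delta> \<longrightarrow> 
      c (strand_pt (S ! k) (t + d)) = b \<and> c (strand_pt (S ! k) (t - d)) = (b \<noteq> (t \<in> strand_marks P k)))"
    using \<delta> \<delta>' p(2,3) strand_marked_iff[OF k t] unfolding pts
    by (intro exI[of _ "branch_value c ?p ?r"] exI[of _ "min \<delta> \<delta>'"]) simp
qed

lemma branch_value_strand:
  assumes c: "c \<in> colorings D" and k: "k < length P" and t: "-1 < t" "t < 1"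
  shows "branch_value c (strand_pt (S ! k) t) (strand_speed S k) \<longleftrightarrow> 
    (c (strand_pt (S ! k) (-1)) \<noteq> (parity (strand_marks P k) t \<noteq> (t \<in> strand_marks P k)))" (is "?l \<longleftrightarrow> ?b")
proof (rule branch_value_eq)
  let ?M = "strand_marks P k"
  obtain \<delta> where \<delta>: "\<delta> > 0" "\<And>d. 0 < d \<Longrightarrow> d < \<delta> \<Longrightarrow> t + d \<notin> ?M \<and> t - d \<notin> ?M \<and> 
      parity ?M (t + d) = (parity ?M t \<noteq> (t \<in> ?M)) \<and> parity ?M (t - d) = parity ?M t"
    using parity_near[OF marks(2)[OF k]] by blast
  have "c (strand_pt (S ! k) (t + d)) = ?b" if "0 < d" "d < min \<delta> (1 - t)" for d
    using coloring_strand[OF c k, of "t + d"] \<delta>(2)[of d] that t by auto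
  moreover have "(fst (strand_pt (S ! k) t), snd (strand_pt (S ! k) t) + strand_speed S k * d) 
      = strand_pt (S ! k) (t + d)" for d
    by (simp add: strand_pt_eq algebra_simps)
  ultimately show "germ c (strand_pt (S ! k) t) (strand_speed S k) ?b"
    unfolding germ_iff using \<delta>(1) t by (intro exI[of _ "min \<delta> (1 - t)"]) simp
qed

text \<open>Restricted to interior parameters, where the strand follows the picture on a whole
  neighbourhood.\<close>

lemma strand_vel:
  assumes k: "k < length P" and t: "-1 < t" "t < 1" and v: "((P ! k) has_vector_derivative v) (at t)"
  shows "strand_speed S k *\<^sub>R vel D (strand_pt (S ! k) t) = v"
proof -
  let ?p = "strand_pt (S ! k) t" and ?r = "strand_speed S k"
  define g where "g u = fst (snd (S ! k)) + ?r * u" for u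
  have h: "(curve D (fst ?p) \<circ> g has_vector_derivative ?r *\<^sub>R vel D ?p) (at t)"
    using has_vel[OF D strand_params[OF k, of t]]
    by (intro vector_diff_chain_at) 
      (auto simp: g_def[abs_def] strand_pt_eq has_real_derivative_iff_has_vector_derivative[symmetric] 
        intro!: derivative_eq_intros)
  have eq: "(curve D (fst ?p) \<circ> g) u = (P ! k) u" if "u \<in> {-1<..<1}" for u
    using strand_pos[OF k, of u] that by (simp add: g_def pos_def strand_pt_eq)
  have "t \<in> {-1<..<1}" using t by simp
  from has_vector_derivative_transform_within_open[OF h open_greaterThanLessThan this eq]
  have *: "((P ! k) has_vector_derivative ?r *\<^sub>R vel D ?p) (at t)" .
  show ?thesis using vector_derivative_unique_at[OF * v] .
qed

text \<open>Position decides: strands lie in the box and everything else outside, so no crossing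
  involves one point of each kind.\<close>

lemma classical_crossings_split:
  "classical_crossings D = box_crossings P \<union> outer_crossings D S"
  "box_crossings P \<inter> outer_crossings D S = {}"
proof -
  have box_over: "\<exists>p\<in>overs D. on_strands S p \<and> pos D p = z" if z: "z \<in> box_crossings P" for z
  proof -
    from z obtain k t l u where d: "pic_double P k t l u" "z = (P ! k) t" unfolding box_crossings_def by blast
    then have kt: "k < length P" "t \<in> {-1..1}" "l < length P" "u \<in> {-1..1}" "z = (P ! l) u" 
      by (auto simp: pic_double_def)
    have "on_strands S (strand_pt (S ! k) t)" "on_strands S (strand_pt (S ! l) u)"
      using kt same_param_refl unfolding on_strands_def len by blast+
    moreover have "pos D (strand_pt (S ! k) t) = z" "pos D (strand_pt (S ! l) u) = z"
      using strand_pos[OF kt(1,2)] strand_pos[OF kt(3,4)] d(2) kt(5) by simp_all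
    ultimately show ?thesis using classical[OF d(1)] by blast
  qed
  have over_box: "pos D p \<in> box_crossings P" if p: "p \<in> overs D" "on_strands S p" for p
  proof -
    obtain k t where kt: "k < length P" "t \<in> {-1..1}" "same_param p (strand_pt (S ! k) t)"
      using p(2) unfolding on_strands_def len by blast
    then have "strand_pt (S ! k) t \<in> marked D" 
      using marked_same_param[OF D kt(3)] p(1) by (simp add: marked_def)
    then obtain l u where "pic_double P k t l u" 
      using strand_marked_iff[OF kt(1,2)] unfolding strand_marks_def by blast
    moreover have "pos D p = (P ! k) t" 
      using pos_same_param[OF D kt(3) overs_params[OF D p(1)]] strand_pos[OF kt(1,2)] by simp
    ultimately show ?thesis unfolding box_crossings_def by blast
  qed
  show "classical_crossings D = box_crossings P \<union> outer_crossings D S"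
    using box_over over_box unfolding classical_crossings_def outer_crossings_def by blast
  have False if z: "z \<in> box_crossings P" "z \<in> outer_crossings D S" for z
  proof -
    obtain p where p: "p \<in> overs D" "on_strands S p" "pos D p = z" using box_over[OF z(1)] by blast
    obtain q where q: "q \<in> overs D" "\<not> on_strands S q" "pos D q = z" 
      using z(2) unfolding outer_crossings_def by blast
    show False using inside_iff[of p] inside_iff[of q] overs_params[OF D] p q by simp
  qed
  then show "box_crossings P \<inter> outer_crossings D S = {}" by blast
qed

lemma crossing_sum_split:
  fixes h :: "complex \<Rightarrow> int"
  shows "(\<Sum>z\<in>classical_crossings D. h z) = (\<Sum>z\<in>box_crossings P. h z) + (\<Sum>z\<in>outer_crossings D S. h z)"
  using finite_classical_crossings[OF D] classical_crossings_split 
  by (simp add: sum.union_disjoint)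

end

text \<open>The part of a crossing sign that a move preserves: the orientations of the two strands
  and their order by height. The remaining factor is the sign of the determinant of the tangents in
  the picture.\<close>

definition crossing_factor :: "strand list \<Rightarrow> (nat \<Rightarrow> nat) \<Rightarrow> nat \<Rightarrow> nat \<Rightarrow> real" where
  "crossing_factor S h k l = 
     sgn (strand_speed S k) * sgn (strand_speed S l) * (if h l < h k then 1 else -1)"

text \<open>The change of color from the start of the strand to just after \<open>t\<close>.\<close>

definition strand_flip :: "(real \<Rightarrow> complex) list \<Rightarrow> nat \<Rightarrow> real \<Rightarrow> bool" where
  "strand_flip P k t \<longleftrightarrow> (parity (strand_marks P k) t \<noteq> (t \<in> strand_marks P k))"

context strand_picture
begin

lemma strand_passes_sign:
  assumes z: "passes D z (strand_pt (S ! k) t) (strand_pt (S ! l) u)" 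
    and k: "k < length P" "-1 < t" "t < 1" "((P ! k) has_vector_derivative v) (at t)"
    and l: "l < length P" "-1 < u" "u < 1" "((P ! l) has_vector_derivative w) (at u)"
  shows "real_of_int (crossing_sign D z) = 
    sgn (strand_speed S k) * sgn (strand_speed S l) * sgn (cdet v w)"
  using crossing_sign_direction[OF D z strand_speed_nonzero[OF k(1)] strand_speed_nonzero[OF l(1)]]
  unfolding strand_vel[OF k] strand_vel[OF l] .

lemma strand_passes_agreement:
  assumes c: "c \<in> colorings D" and z: "passes D z (strand_pt (S ! k) t) (strand_pt (S ! l) u)" 
    and k: "k < length P" "-1 < t" "t < 1" and l: "l < length P" "-1 < u" "u < 1" 
  shows "real_of_int (agreement D c z) = sgn (strand_speed S k) * sgn (strand_speed S l) *
    (if (c (strand_pt (S ! k) (-1)) \<noteq> strand_flip P k t) = (c (strand_pt (S ! l) (-1)) \<noteq> strand_flip P l u) 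
     then -1 else 1)"
  using agreement_direction[OF D c z strand_speed_nonzero[OF k(1)] strand_speed_nonzero[OF l(1)]]
  unfolding branch_value_strand[OF c k] branch_value_strand[OF c l] strand_flip_def .

text \<open>Exchanging the strands negates both the height factor and the determinant, so the
  formula holds whichever strand lies above.\<close>

lemma layered_crossing:
  assumes layered: "layered D S P h" and kl: "k \<noteq> l" 
    and z: "(P ! k) t = z" "(P ! l) u = z"
    and k: "k < length P" "-1 < t" "t < 1" and l: "l < length P" "-1 < u" "u < 1" 
  shows "((P ! k) has_vector_derivative v) (at t) \<Longrightarrow> ((P ! l) has_vector_derivative w) (at u) \<Longrightarrow>
      real_of_int (crossing_sign D z) = crossing_factor S h k l * sgn (cdet v w)"
    and "c \<in> colorings D \<Longrightarrow> real_of_int (agreement D c z) = sgn (strand_speed S k) * sgn (strand_speed S l) *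
      (if (c (strand_pt (S ! k) (-1)) \<noteq> strand_flip P k t) = (c (strand_pt (S ! l) (-1)) \<noteq> strand_flip P l u) 
       then -1 else 1)"
proof -
  let ?p = "strand_pt (S ! k) t" and ?q = "strand_pt (S ! l) u"
  have tu: "t \<in> {-1..1}" "u \<in> {-1..1}" using k l by auto
  have pos: "pos D ?p = z" "pos D ?q = z" using strand_pos[OF k(1) tu(1)] strand_pos[OF l(1) tu(2)] z by simp_all
  have lay: "strand_pt (S ! k) t \<in> overs D \<and> strand_pt (S ! l) u \<in> unders D" 
    if "k < length P" "l < length P" "t \<in> {-1..1}" "u \<in> {-1..1}" "(P ! k) t = (P ! l) u" "h l < h k" for k l t u
    using layered that unfolding layered_def by blast
  have inj: "inj_on h {..<length P}" using layered unfolding layered_def by blast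
  have "h k \<noteq> h l" using inj_onD[OF inj, of k l] k(1) l(1) kl by auto
  then consider (over) "h l < h k" "passes D z ?p ?q" | (under) "h k < h l" "passes D z ?q ?p"
    using lay[OF k(1) l(1) tu] lay[OF l(1) k(1) tu(2,1)] z pos unfolding passes_def by (metis linorder_neq_iff)
  note cases = this
  show "real_of_int (crossing_sign D z) = crossing_factor S h k l * sgn (cdet v w)"
    if v: "((P ! k) has_vector_derivative v) (at t)" and w: "((P ! l) has_vector_derivative w) (at u)"
    using cases
  proof cases
    case over
    then show ?thesis using strand_passes_sign[OF over(2) k v l w] by (simp add: crossing_factor_def)
  next
    case under
    then show ?thesis using strand_passes_sign[OF under(2) l w k v] cdet_swap[of w v]
      by (simp add: crossing_factor_def sgn_minus)
  qed
  show "real_of_int (agreement D c z) = sgn (strand_speed S k) * sgn (strand_speed S l) *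
      (if (c (strand_pt (S ! k) (-1)) \<noteq> strand_flip P k t) = (c (strand_pt (S ! l) (-1)) \<noteq> strand_flip P l u) 
       then -1 else 1)" if c: "c \<in> colorings D"
    using cases
  proof cases
    case over
    then show ?thesis using strand_passes_agreement[OF c over(2) k l] by simp
  next
    case under
    then show ?thesis using strand_passes_agreement[OF c under(2) l k] by (auto simp: mult.commute)
  qed
qed

end

text \<open>On the strands the old colors are discarded except at the start, from which the marks of
  the new picture dictate the rest.\<close>

definition transport :: "strand list \<Rightarrow> (real \<Rightarrow> complex) list \<Rightarrow> (point \<Rightarrow> bool) \<Rightarrow> point \<Rightarrow> bool" where
  "transport S P c p \<longleftrightarrow> (if on_strands S p then 
     \<exists>k<length S. \<exists>t\<in>{-1..1}. same_param p (strand_pt (S ! k) t) \<and> 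
       (c (strand_pt (S ! k) (-1)) \<noteq> parity (strand_marks P k) t) \<and> t \<notin> strand_marks P k 
     else c p)"

lemma transport_outside: "\<not> on_strands S p \<Longrightarrow> transport S P c p = c p"
  by (simp add: transport_def)

lemma (in strand_picture) transport_strand:
  assumes "k < length P" "t \<in> {-1..1}" "same_param p (strand_pt (S ! k) t)"
  shows "transport S P c p \<longleftrightarrow> (c (strand_pt (S ! k) (-1)) \<noteq> parity (strand_marks P k) t) \<and> t \<notin> strand_marks P k"
proof -
  have "k' = k \<and> t' = t" if "k' < length S" "t' \<in> {-1..1}" "same_param p (strand_pt (S ! k') t')" for k' t'
    using strand_unique[of k' k t' t] that assms len same_param_trans[OF same_param_sym[OF that(3)] assms(3)] by simp
  moreover have "on_strands S p" using assms unfolding on_strands_def len by blast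
  ultimately show ?thesis using assms unfolding transport_def len by metis
qed

locale strand_replacement = 
  old: strand_picture D S P a + new: strand_picture D' S P' a for D D' S P P' a +
  assumes replacement: "local_replacement D D' S P P'"
begin

lemma comps: "comps D' = comps D" and params: "params D' = params D"
  using replacement by (simp_all add: local_replacement_def params_def)

lemma lengths: "length P' = length P"
  using old.len new.len by simp

lemma outside: 
  assumes "p \<in> params D" "\<not> on_strands S p" 
  shows "pos D' p = pos D p" "p \<in> overs D' \<longleftrightarrow> p \<in> overs D" "p \<in> unders D' \<longleftrightarrow> p \<in> unders D" 
    "p \<in> marked D' \<longleftrightarrow> p \<in> marked D"
  using replacement assms unfolding local_replacement_def marked_def by auto

text \<open>On the inner part of a strand the rule follows from parities. Everywhere else, including
  the ends of the strands, the transported coloring equals \<open>c\<close> on a neighbourhood, so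
  the rule is inherited.\<close>

lemma transport_colorings:
  assumes c: "c \<in> colorings D" shows "transport S P' c \<in> colorings D'"
proof -
  let ?c = "transport S P' c"
  have on_iff: "on_strands S p \<longleftrightarrow> on_strands S q" if "same_param p q" for p q
    using that same_param_sym same_param_trans unfolding on_strands_def by blast
  \<comment> \<open>Beyond the marks both colors equal the color at the start of the strand, because
    each picture has an even number of marks on it.\<close>
  have outer: "?c p = c p \<and> (p \<in> marked D \<longleftrightarrow> p \<in> marked D')" 
    if p: "p \<in> params D" "\<not> inner_strands a S p" for p
  proof (cases "on_strands S p")
    case True
    then obtain k t where k: "k < length P" and t: "t \<in> {-1..1}" and kt: "same_param p (strand_pt (S ! k) t)"
      unfolding on_strands_def old.len by blast
    have "t \<notin> {-a..a}" using p(2) k kt unfolding inner_strands_def old.len by blast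
    then have at: "a < \<bar>t\<bar>" by auto
    have k': "k < length P'" using k lengths by simp
    have "c p = c (strand_pt (S ! k) t)" using coloringsD(2)[OF c p(1) kt] .
    then have "c p = c (strand_pt (S ! k) (-1))"
      using old.coloring_strand[OF c k t] old.ends_unmarked[OF k at] by simp
    moreover have "?c p = c (strand_pt (S ! k) (-1))"
      using new.transport_strand[OF k' t kt] new.ends_unmarked[OF k' at] by simp
    moreover have "p \<notin> marked D" "p \<notin> marked D'"
      using old.strand_marked_iff[OF k t] old.ends_unmarked[OF k at] marked_same_param[OF old.D kt]
        new.strand_marked_iff[OF k' t] new.ends_unmarked[OF k' at] marked_same_param[OF new.D kt] by simp_all
    ultimately show ?thesis by simp
  next
    case False
    then show ?thesis using transport_outside outside(4)[OF p(1)] by simp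
  qed
  have "color_at (marked D') ?c p" if p: "p \<in> params D" for p
  proof (cases "inner_strands a S p")
    case True
    then obtain k t where k: "k < length P" and ta: "t \<in> {-a..a}" and kt: "same_param p (strand_pt (S ! k) t)"
      unfolding inner_strands_def old.len by blast
    have k': "k < length P'" using k lengths by simp
    have t: "-1 < t" "t < 1" using ta old.a by auto
    let ?M = "strand_marks P' k" and ?r = "strand_speed S k" and ?\<beta> = "c (strand_pt (S ! k) (-1))"
    obtain \<delta> where \<delta>: "\<delta> > 0" "\<And>d. 0 < d \<Longrightarrow> d < \<delta> \<Longrightarrow> t + d \<notin> ?M \<and> t - d \<notin> ?M \<and> 
        parity ?M (t + d) = (parity ?M t \<noteq> (t \<in> ?M)) \<and> parity ?M (t - d) = parity ?M t"
      using parity_near[OF new.marks(2)[OF k']] by blast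
    \<comment> \<open>The last two bounds keep \<open>t + d\<close> and \<open>t - d\<close> on the
      strand.\<close>
    define \<epsilon> where "\<epsilon> = min \<delta> (min (1 - t) (t + 1))"
    have \<epsilon>: "\<epsilon> > 0" using \<delta>(1) t by (simp add: \<epsilon>_def)
    have marked: "p \<in> marked D' \<longleftrightarrow> t \<in> ?M" 
      using new.strand_marked_iff[OF k', of t] marked_same_param[OF new.D kt] t by simp
    have near: "?c (fst p, snd p + ?r * d) = ((?\<beta> \<noteq> parity ?M (t + d)) \<and> t + d \<notin> ?M)" 
      if "t + d \<in> {-1..1}" for d
      by (rule new.transport_strand[OF k' that strand_pt_add[OF kt]])
    define b where "b = (?\<beta> \<noteq> (parity ?M t \<noteq> (t \<in> ?M)))"
    show ?thesis
    proof (rule color_atI[OF old.strand_speed_nonzero[OF k]])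
      have "?c (fst p, snd p + ?r * d) = b" if d: "0 < d" "d < \<epsilon>" for d
        using near[of d] \<delta>(2)[of d] d t by (auto simp: b_def \<epsilon>_def)
      then show "germ ?c p ?r b" unfolding germ_iff using \<epsilon> by blast
      have "?c (fst p, snd p + - ?r * d) = (b \<noteq> (p \<in> marked D'))" if d: "0 < d" "d < \<epsilon>" for d
        using near[of "-d"] \<delta>(2)[of d] d t unfolding marked by (auto simp: b_def \<epsilon>_def)
      then show "germ ?c p (- ?r) (b \<noteq> (p \<in> marked D'))" unfolding germ_iff using \<epsilon> by blast
      show "?c p = (b \<and> p \<notin> marked D')" using near[of 0] t unfolding marked by (auto simp: b_def)
    qed
  next
    case False
    obtain \<delta> where \<delta>: "\<delta> > 0" "\<forall>u. \<bar>u - snd p\<bar> < \<delta> \<longrightarrow> \<not> inner_strands a S (fst p, u)"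
      using not_inner_strands_near[OF False] by blast
    have "?c (fst p, u) = c (fst p, u)" if "\<bar>u - snd p\<bar> < \<delta>" for u
      using outer[of "(fst p, u)"] \<delta>(2) that p by (simp add: mem_params)
    from color_at_cong[of \<delta> p ?c c "marked D" "marked D'", OF \<delta>(1) this] show ?thesis
      using coloringsD(3)[OF c p] outer[OF p False] by blast
  qed
  moreover have "\<not> ?c p" if p: "p \<notin> params D" for p
  proof -
    have "\<not> on_strands S p" 
      using p old.strand_params same_param_params unfolding on_strands_def old.len by blast
    then show ?thesis using coloringsD(1)[OF c, of p] p by (auto simp: transport_outside regular_params_eq)
  qed
  moreover have "?c p = ?c q" if pq: "p \<in> params D" "same_param p q" for p q
  proof (cases "on_strands S p")
    case True
    then obtain k t where kt: "k < length P'" "t \<in> {-1..1}" "same_param p (strand_pt (S ! k) t)"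
      unfolding on_strands_def new.len by blast
    have q: "same_param q (strand_pt (S ! k) t)" using kt(3) pq(2) same_param_sym same_param_trans by blast
    show ?thesis using new.transport_strand[OF kt] new.transport_strand[OF kt(1,2) q] by simp
  next
    case False
    then show ?thesis using on_iff[OF pq(2)] coloringsD(2)[OF c pq] by (simp add: transport_outside)
  qed
  ultimately show ?thesis unfolding colorings_def params by blast
qed

lemma transport_base: 
  assumes "k < length P" shows "transport S P' c (strand_pt (S ! k) (-1)) = c (strand_pt (S ! k) (-1))"
  using new.transport_strand[of k "-1"] new.ends_unmarked[of k "-1"] new.a assms lengths by simp

text \<open>Both transports keep the color at the start of each strand, and this color determines a
  coloring of \<open>D\<close> on the strand.\<close>

lemma transport_inverse:
  assumes c: "c \<in> colorings D" shows "transport S P (transport S P' c) = c"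
proof
  fix p show "transport S P (transport S P' c) p = c p"
  proof (cases "on_strands S p")
    case True
    then obtain k t where kt: "k < length P" "t \<in> {-1..1}" "same_param p (strand_pt (S ! k) t)"
      unfolding on_strands_def old.len by blast
    have "p \<in> params D" using old.strand_params[OF kt(1)] same_param_params[OF kt(3)] by blast
    then have "c p = c (strand_pt (S ! k) t)" using coloringsD(2)[OF c _ kt(3)] by blast
    then show ?thesis
      using old.transport_strand[OF kt] transport_base[OF kt(1)] old.coloring_strand[OF c kt(1,2)] by simp
  qed (simp add: transport_outside)
qed

text \<open>The partner of an outside crossing point has the same position, so it is outside too;
  velocities and half branch values depend only on a neighbourhood that avoids the strands.\<close>

lemma outer_crossing:
  assumes z: "z \<in> outer_crossings D S"
  shows "z \<in> outer_crossings D' S" "crossing_sign D' z = crossing_sign D z"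
    "c \<in> colorings D \<Longrightarrow> agreement D' (transport S P' c) z = agreement D c z"
proof -
  obtain p where p: "p \<in> overs D" "\<not> on_strands S p" "pos D p = z" using z unfolding outer_crossings_def by blast
  then obtain q where pq: "passes D z p q" using over_double[OF old.D] by blast
  have pp: "p \<in> params D" "q \<in> params D" using passes_double[OF old.D pq] by (simp_all add: double_def)
  have q: "\<not> on_strands S q" "pos D q = z" using old.inside_iff[OF pp(1)] old.inside_iff[OF pp(2)] p pq 
    by (simp_all add: passes_def)
  have pq': "passes D' z p q" using pq outside[OF pp(1) p(2)] outside[OF pp(2) q(1)] by (simp add: passes_def)
  show "z \<in> outer_crossings D' S" using pq' p(2) unfolding outer_crossings_def passes_def by blast
  have near: "vel D' x = vel D x \<and> branch_value (transport S P' c) x 1 = branch_value c x 1" 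
    if x: "x \<in> params D" "\<not> on_strands S x" for x
  proof -
    obtain \<delta> where \<delta>: "\<delta> > 0" "\<forall>u. \<bar>u - snd x\<bar> < \<delta> \<longrightarrow> \<not> on_strands S (fst x, u)"
      using not_inner_strands_near[of 1 S x] x(2) unfolding on_strands_inner by blast
    have "vel D' x = vel D x"
    proof (rule vel_cong_open[OF old.D x(1) open_ball[of "snd x" \<delta>]])
      show "snd x \<in> ball (snd x) \<delta>" using \<delta>(1) by simp
      show "curve D' (fst x) u = curve D (fst x) u" if "u \<in> ball (snd x) \<delta>" for u
        using outside(1)[of "(fst x, u)"] \<delta>(2) x(1) that 
        by (simp add: pos_def mem_params dist_real_def abs_minus_commute)
    qed
    moreover have "germ (transport S P' c) x 1 True \<longleftrightarrow> germ c x 1 True"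
      by (rule germ_cong[OF \<delta>(1)]) (use \<delta>(2) in \<open>simp add: transport_outside\<close>)
    ultimately show ?thesis by (simp add: branch_value_def)
  qed
  show "crossing_sign D' z = crossing_sign D z"
    unfolding crossing_sign_eq[OF old.D pq] crossing_sign_eq[OF new.D pq'] 
    using near[OF pp(1) p(2)] near[OF pp(2) q(1)] by simp
  show "agreement D' (transport S P' c) z = agreement D c z" if c: "c \<in> colorings D"
    unfolding agreement_eq[OF old.D c pq] agreement_eq[OF new.D transport_colorings[OF c] pq'] 
    using near[OF pp(1) p(2)] near[OF pp(2) q(1)] by simp
qed

end

text \<open>Replacements can be undone; this turns the inclusions proved so far into a bijection of
  colorings and an equality of outer crossings.\<close>

lemma (in strand_replacement) swapped: "strand_replacement D' D S P' P a"
proof (intro strand_replacement.intro strand_replacement_axioms.intro)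
  show "local_replacement D' D S P' P"
    using replacement new.embedded params unfolding local_replacement_def by auto
qed (rule new.strand_picture_axioms old.strand_picture_axioms)+

context strand_replacement
begin

lemma transport_bij: "bij_betw (transport S P') (colorings D) (colorings D')"
proof -
  interpret swapped: strand_replacement D' D S P' P a by (rule swapped)
  show ?thesis
    by (rule bij_betw_byWitness[where f' = "transport S P"])
      (use transport_inverse transport_colorings swapped.transport_inverse swapped.transport_colorings in auto)
qed

lemma outer_crossings_eq: "outer_crossings D' S = outer_crossings D S"
proof -
  interpret swapped: strand_replacement D' D S P' P a by (rule swapped)
  show ?thesis using outer_crossing(1) swapped.outer_crossing(1) by blast
qed

text \<open>Contributions from outside the box cancel, so only the box sums of the two pictures
  remain to be compared.\<close>

lemma writhe_difference:
  "writhe D' - (\<Sum>z\<in>box_crossings P'. crossing_sign D' z) = writhe D - (\<Sum>z\<in>box_crossings P. crossing_sign D z)"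
proof -
  have "(\<Sum>z\<in>outer_crossings D' S. crossing_sign D' z) = (\<Sum>z\<in>outer_crossings D S. crossing_sign D z)"
    unfolding outer_crossings_eq by (rule sum.cong) (auto simp: outer_crossing(2))
  then show ?thesis 
    unfolding writhe_def old.crossing_sum_split new.crossing_sum_split by simp
qed

lemma exponent_difference:
  assumes c: "c \<in> colorings D"
  shows "exponent D' (transport S P' c) 
      - (\<Sum>z\<in>box_crossings P'. crossing_sign D' z * agreement D' (transport S P' c) z) 
    = exponent D c - (\<Sum>z\<in>box_crossings P. crossing_sign D z * agreement D c z)"
proof -
  have "(\<Sum>z\<in>outer_crossings D' S. crossing_sign D' z * agreement D' (transport S P' c) z) 
      = (\<Sum>z\<in>outer_crossings D S. crossing_sign D z * agreement D c z)"
    unfolding outer_crossings_eq by (rule sum.cong) (auto simp: outer_crossing(2) outer_crossing(3)[OF _ c])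
  then show ?thesis 
    unfolding exponent_def old.crossing_sum_split new.crossing_sum_split by simp
qed

end

section \<open>The Reidemeister moves\<close>

lemma bump_bounds: "t \<in> {-1..1} \<Longrightarrow> 0 \<le> bump t" "t \<in> {-1..1} \<Longrightarrow> bump t \<le> 1"
proof -
  assume t: "t \<in> {-1..1}"
  then have "t\<^sup>2 \<le> 1" by (auto simp: abs_square_le_1)
  then show "0 \<le> bump t" "bump t \<le> 1" by (auto simp: bump_def abs_square_le_1)
qed

lemma bump_minus [simp]: "bump (- t) = bump t"
  by (simp add: bump_def)

lemma bump_mono:
  assumes "0 \<le> x" "x < y" "y \<le> 1" shows "bump y < bump x"
proof -
  have "x\<^sup>2 < y\<^sup>2" "y\<^sup>2 \<le> 1" using assms by (auto simp: power2_strict_mono power_le_one intro: power_strict_mono)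
  then show ?thesis unfolding bump_def by (intro power_strict_mono) auto
qed

text \<open>\<open>bump\<close> is even and strictly decreasing in the absolute value.\<close>

lemma bump_eq_iff:
  assumes "t \<in> {-1..1}" "u \<in> {-1..1}" shows "bump t = bump u \<longleftrightarrow> \<bar>t\<bar> = \<bar>u\<bar>"
proof -
  have "bump \<bar>x\<bar> = bump x" for x by (simp add: abs_if)
  moreover have "bump \<bar>t\<bar> \<noteq> bump \<bar>u\<bar>" if "\<bar>t\<bar> \<noteq> \<bar>u\<bar>"
    using bump_mono[of "\<bar>t\<bar>" "\<bar>u\<bar>"] bump_mono[of "\<bar>u\<bar>" "\<bar>t\<bar>"] assms that
    by (cases "\<bar>t\<bar>" "\<bar>u\<bar>" rule: linorder_cases) (auto simp: abs_le_iff)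
  ultimately show ?thesis by metis
qed

lemma bump_deriv: "(bump has_real_derivative - 4 * t * (1 - t\<^sup>2)) (at t)"
  unfolding bump_def[abs_def] by (auto intro!: derivative_eq_intros simp: field_simps)

lemma bump_continuous: "continuous_on A bump"
  unfolding bump_def[abs_def] by (intro continuous_intros)

text \<open>The intermediate value theorem gives the root, and \<open>bump_eq_iff\<close> its
  uniqueness up to sign. It is the crossing parameter of both \<open>kink\<close> and
  \<open>dip\<close>.\<close>

lemma bump_half:
  obtains s where "0 < s" "s < 1" "\<And>t. t \<in> {-1..1} \<Longrightarrow> bump t = 1/2 \<longleftrightarrow> t = s \<or> t = -s"
proof -
  have "\<exists>s. 0 \<le> s \<and> s \<le> 1 \<and> bump s = 1/2"
    by (rule IVT2') (auto simp: bump_continuous, auto simp: bump_def)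
  then obtain s where s: "0 \<le> s" "s \<le> 1" "bump s = 1/2" by blast
  have "s \<noteq> 0" "s \<noteq> 1" using s(3) by (auto simp: bump_def)
  moreover have "bump t = 1/2 \<longleftrightarrow> t = s \<or> t = -s" if "t \<in> {-1..1}" for t
    using bump_eq_iff[OF that, of s] s by auto
  ultimately show ?thesis using s that[of s] by auto
qed

text \<open>For \<open>t \<ge> 0\<close> the left side decreases while the right side increases, and
  for negative \<open>t\<close> the left side is not negative. The root locates the crossings of an
  arch with the diagonals.\<close>

lemma bump_fixed:
  obtains s where "0 < s" "s < 1" "\<And>t. t \<in> {-1..1} \<Longrightarrow> bump t / 2 = t \<longleftrightarrow> t = s"
proof -
  have "\<exists>s. 0 \<le> s \<and> s \<le> 1 \<and> bump s / 2 - s = 0"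
    by (rule IVT2') (auto intro!: continuous_intros bump_continuous, auto simp: bump_def)
  then obtain s where s: "0 \<le> s" "s \<le> 1" "bump s / 2 = s" by auto
  have "s \<noteq> 0" "s \<noteq> 1" using s(3) by (auto simp: bump_def)
  moreover have "t = s" if t: "t \<in> {-1..1}" and eq: "bump t / 2 = t" for t
  proof -
    have "0 \<le> t" using bump_bounds(1)[OF t] eq by linarith
    then show ?thesis using bump_mono[of t s] bump_mono[of s t] s t eq 
      by (cases t s rule: linorder_cases) auto
  qed
  ultimately show ?thesis using s that[of s] by auto
qed

lemma graph_deriv:
  "(g has_real_derivative m) (at t) \<Longrightarrow> ((\<lambda>t. Complex t (g t)) has_vector_derivative Complex 1 m) (at t)"
  by (simp add: has_vector_derivative_complex_iff)

lemma cdet_graph [simp]: "cdet (Complex 1 x) (Complex 1 y) = y - x"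
  by (simp add: cdet_def)

lemma picture_derivs:
  "(level y has_vector_derivative Complex 1 0) (at t)"
  "(dip has_vector_derivative Complex 1 (8 * t * (1 - t\<^sup>2))) (at t)"
  "(diagonal m has_vector_derivative Complex 1 m) (at t)"
  "(arch m has_vector_derivative Complex 1 (- 2 * m * t * (1 - t\<^sup>2))) (at t)"
  unfolding level_def[abs_def] dip_def[abs_def] diagonal_def[abs_def] arch_def[abs_def]
  by (rule graph_deriv, auto intro!: derivative_eq_intros bump_deriv simp: field_simps)+

text \<open>Every picture of a move with more than one strand consists of graphs over the horizontal
  axis, so crossings occur at equal parameters and tangents are compared by slope. The bound 2 comes
  from \<open>move_box\<close>.\<close>

definition graph_picture :: "(real \<Rightarrow> complex) list \<Rightarrow> bool" where
  "graph_picture P \<longleftrightarrow> (\<forall>k<length P. \<forall>t\<in>{-1..1}. Re ((P ! k) t) = t \<and> \<bar>Im ((P ! k) t)\<bar> \<le> 2)"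

lemma pic_double_graph:
  assumes "graph_picture P"
  shows "pic_double P k t l u \<longleftrightarrow> k < length P \<and> l < length P \<and> k \<noteq> l \<and> t \<in> {-1..1} \<and> u = t \<and>
    Im ((P ! k) t) = Im ((P ! l) t)"
proof
  assume d: "pic_double P k t l u"
  then have "Re ((P ! k) t) = t" "Re ((P ! l) u) = u" 
    using assms unfolding graph_picture_def pic_double_def by blast+
  then show "k < length P \<and> l < length P \<and> k \<noteq> l \<and> t \<in> {-1..1} \<and> u = t \<and> Im ((P ! k) t) = Im ((P ! l) t)"
    using d unfolding pic_double_def by auto
next
  assume r: "k < length P \<and> l < length P \<and> k \<noteq> l \<and> t \<in> {-1..1} \<and> u = t \<and> Im ((P ! k) t) = Im ((P ! l) t)"
  then have "Re ((P ! k) t) = Re ((P ! l) t)" using assms unfolding graph_picture_def by simp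
  then show "pic_double P k t l u" using r unfolding pic_double_def by (auto simp: complex_eq_iff)
qed

lemma layered_classical:
  assumes "layered D S P h" "pic_double P k t l u" "k \<noteq> l"
  shows "strand_pt (S ! k) t \<in> overs D \<and> strand_pt (S ! l) u \<in> unders D \<or>
      strand_pt (S ! k) t \<in> unders D \<and> strand_pt (S ! l) u \<in> overs D"
proof -
  have d: "k < length P" "l < length P" "t \<in> {-1..1}" "u \<in> {-1..1}" "(P ! k) t = (P ! l) u"
    using assms(2) unfolding pic_double_def by auto
  have "inj_on h {..<length P}" using assms(1) unfolding layered_def by blast
  then have "h k \<noteq> h l" using d assms(3) inj_onD[of h "{..<length P}" k l] by auto
  moreover have "strand_pt (S ! k) t \<in> overs D \<and> strand_pt (S ! l) u \<in> unders D" 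
    if "k < length P" "l < length P" "t \<in> {-1..1}" "u \<in> {-1..1}" "(P ! k) t = (P ! l) u" "h l < h k" for k l t u
    using assms(1) that unfolding layered_def by blast
  from this[OF d] this[OF d(2,1,4,3) d(5)[symmetric]]
  have "h l < h k \<Longrightarrow> ?thesis" "h k < h l \<Longrightarrow> ?thesis" by blast+
  ultimately show ?thesis by linarith
qed

lemma local_replacementD:
  assumes "local_replacement D D' S P P'"
  shows "embedded_strands D S" "embedded_strands D' S" "box_picture D S P" "box_picture D' S P'"
proof -
  have "params D' = params D" using assms by (simp add: local_replacement_def params_def)
  then show "embedded_strands D S" "embedded_strands D' S" "box_picture D S P" "box_picture D' S P'"
    using assms unfolding local_replacement_def embedded_strands_def by auto
qed

text \<open>The alternative to \<open>layered\<close> serves the picture of two parallel strands,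
  which has no crossings and for which the second move prescribes no heights.\<close>

lemma strand_picture_graph:
  assumes "virtual_link_diagram D" "embedded_strands D S" "box_picture D S P" "graph_picture P"
    and "layered D S P h \<or> (\<forall>k<length P. strand_marks P k = {})"
    and "0 \<le> a" "a < 1"
    and marks: "\<And>k. k < length P \<Longrightarrow> strand_marks P k = {} \<or> 
      (\<exists>x y. strand_marks P k = {x, y} \<and> x \<noteq> y \<and> {x, y} \<subseteq> {-a..a})"
  shows "strand_picture D S P a"
proof
  show "(P ! k) t \<in> move_box" if "k < length P" "t \<in> {-1..1}" for k t
    using that assms(4) unfolding graph_picture_def move_box_def by auto
  show "strand_pt (S ! k) t \<in> overs D \<and> strand_pt (S ! l) u \<in> unders D \<or>
      strand_pt (S ! k) t \<in> unders D \<and> strand_pt (S ! l) u \<in> overs D" if d: "pic_double P k t l u" for k t l u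
    using assms(5)
  proof
    assume "layered D S P h"
    moreover have "k \<noteq> l" using d pic_double_graph[OF assms(4)] by blast
    ultimately show ?thesis using layered_classical d by blast
  next
    assume "\<forall>k<length P. strand_marks P k = {}"
    then show ?thesis using d unfolding strand_marks_def pic_double_def by blast
  qed
  fix k assume "k < length P"
  from marks[OF this] show "strand_marks P k \<subseteq> {-a..a}" "finite (strand_marks P k)" "even (card (strand_marks P k))"
    by auto
qed (use assms in auto)

lemma less_2_iff: "k < 2 \<longleftrightarrow> k = 0 \<or> k = (1::nat)" 
  and less_3_iff: "k < 3 \<longleftrightarrow> k = 0 \<or> k = 1 \<or> k = (2::nat)"
  by auto

section \<open>The second move\<close>

lemma levels_picture:
  shows "graph_picture [level 0, level 1]" "strand_marks [level 0, level 1] k = {}" 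
    "box_crossings [level 0, level 1] = {}"
proof -
  show g: "graph_picture [level 0, level 1]" by (auto simp: graph_picture_def level_def less_Suc_eq)
  have "\<not> pic_double [level 0, level 1] k t l u" for k t l u
    unfolding pic_double_graph[OF g] by (cases k; cases l) (auto simp: level_def less_Suc_eq)
  then show "strand_marks [level 0, level 1] k = {}" "box_crossings [level 0, level 1] = {}"
    by (auto simp: strand_marks_def box_crossings_def)
qed

context
  fixes s :: real
  assumes s: "0 < s" "s < 1" and half: "\<And>t. t \<in> {-1..1} \<Longrightarrow> bump t = 1/2 \<longleftrightarrow> t = s \<or> t = -s"
begin

lemma bump_at_half: "bump s = 1/2"
  using half[of s] s by simp

lemma dip_picture:
  shows "graph_picture [level 0, dip]" "k < 2 \<Longrightarrow> strand_marks [level 0, dip] k = {-s, s}" 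
    "box_crossings [level 0, dip] = {Complex (-s) 0, Complex s 0}"
proof -
  show g: "graph_picture [level 0, dip]" 
    using bump_bounds by (force simp: graph_picture_def level_def dip_def less_2_iff less_Suc_eq)
  have d: "pic_double [level 0, dip] k t l u \<longleftrightarrow> (k = 0 \<and> l = 1 \<or> k = 1 \<and> l = 0) \<and> u = t \<and> (t = s \<or> t = -s)" 
    for k t l u
    using half[of t] s unfolding pic_double_graph[OF g] by (auto simp: level_def dip_def less_Suc_eq)
  show "strand_marks [level 0, dip] k = {-s, s}" if "k < 2"
    using that unfolding strand_marks_def d by (auto simp: less_2_iff)
  show "box_crossings [level 0, dip] = {Complex (-s) 0, Complex s 0}"
    unfolding box_crossings_def d by (auto simp: level_def dip_def bump_at_half)
qed

text \<open>At each crossing both strands have made equally many changes, so the agreements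
  coincide, while the dip crosses downwards at one and upwards at the other, so the signs are
  opposite. The two contributions cancel.\<close>

lemma reidemeister2_invariant_aux:
  assumes D: "virtual_link_diagram D" and D': "virtual_link_diagram D'" 
    and replacement: "local_replacement D D' S [level 0, level 1] [level 0, dip]"
    and layered: "layered D' S [level 0, dip] h"
  shows "binary_bracket D' = binary_bracket D \<and> writhe D' = writhe D"
proof -
  let ?P = "[level 0, level 1]" and ?P' = "[level 0, dip]"
  note rep = local_replacementD[OF replacement]
  have "strand_marks ?P' k = {} \<or> (\<exists>x y. strand_marks ?P' k = {x, y} \<and> x \<noteq> y \<and> {x, y} \<subseteq> {-s..s})" 
    if "k < length ?P'" for k using that dip_picture(2)[of k] s by (intro disjI2 exI[of _ "-s"] exI[of _ s]) auto
  then have "strand_picture D' S ?P' s"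
    using s by (intro strand_picture_graph[OF D' rep(2,4) dip_picture(1) disjI1[OF layered]]) auto
  moreover have "strand_picture D S ?P s"
    using s levels_picture(2) by (intro strand_picture_graph[OF D rep(1,3) levels_picture(1)]) auto
  ultimately interpret strand_replacement D D' S ?P ?P' s
    by (intro strand_replacement.intro strand_replacement_axioms.intro replacement)
  have deriv: "((?P' ! 0) has_vector_derivative Complex 1 0) (at t)"
    "((?P' ! 1) has_vector_derivative Complex 1 (8 * t * (1 - t\<^sup>2))) (at t)" for t
    using picture_derivs by simp_all
  have val: "(?P' ! 0) t = Complex t 0" "(?P' ! 1) t = Complex t 0" if "t = s \<or> t = -s" for t
    using that bump_at_half by (auto simp: level_def dip_def)
  \<comment> \<open>Just after \<open>-s\<close> one change has occurred on either strand, just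
    after \<open>s\<close> two.\<close>
  have flip: "strand_flip ?P' k (-s)" "\<not> strand_flip ?P' k s" if "k = 0 \<or> k = 1" for k
    using that s dip_picture(2)[of k] by (auto simp: strand_flip_def parity_pair)
  have sgn: "real_of_int (crossing_sign D' (Complex t 0)) = crossing_factor S h 0 1 * sgn t"
    if t: "t = s \<or> t = -s" for t
  proof -
    have "real_of_int (crossing_sign D' (Complex t 0)) 
        = crossing_factor S h 0 1 * sgn (cdet (Complex 1 0) (Complex 1 (8 * t * (1 - t\<^sup>2))))"
      by (rule new.layered_crossing(1)[OF layered _ val(1)[OF t] val(2)[OF t] _ _ _ _ _ _ deriv]) (use t s in auto)
    moreover have "1 - t\<^sup>2 > 0" using t s by (auto simp: abs_square_less_1)
    ultimately show ?thesis by (simp add: sgn_mult)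
  qed
  have agr: "real_of_int (agreement D' c (Complex t 0)) = sgn (strand_speed S 0) * sgn (strand_speed S 1) *
      (if c (strand_pt (S ! 0) (-1)) = c (strand_pt (S ! 1) (-1)) then -1 else 1)"
    if c: "c \<in> colorings D'" and t: "t = s \<or> t = -s" for c t
  proof -
    have "real_of_int (agreement D' c (Complex t 0)) = sgn (strand_speed S 0) * sgn (strand_speed S 1) *
      (if (c (strand_pt (S ! 0) (-1)) \<noteq> strand_flip ?P' 0 t) = (c (strand_pt (S ! 1) (-1)) \<noteq> strand_flip ?P' 1 t) 
       then -1 else 1)"
      by (rule new.layered_crossing(2)[OF layered _ val(1)[OF t] val(2)[OF t] _ _ _ _ _ _ c]) (use t s in auto)
    then show ?thesis using t flip[of 0] flip[of 1] by auto
  qed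
  have "real_of_int (crossing_sign D' (Complex (-s) 0)) = real_of_int (- crossing_sign D' (Complex s 0))"
    unfolding of_int_minus sgn[of s, simplified] sgn[of "-s", simplified] by (simp add: sgn_minus)
  then have opposite: "crossing_sign D' (Complex (-s) 0) = - crossing_sign D' (Complex s 0)"
    by (simp only: of_int_eq_iff)
  have distinct: "Complex (-s) 0 \<noteq> Complex s 0" using s by simp
  have "writhe D' = writhe D"
    using writhe_difference distinct unfolding levels_picture dip_picture by (simp add: opposite)
  moreover have "exponent D' (transport S ?P' c) = exponent D c" if c: "c \<in> colorings D" for c
  proof -
    let ?c = "transport S ?P' c"
    note c' = transport_colorings[OF c]
    have "real_of_int (agreement D' ?c (Complex (-s) 0)) = real_of_int (agreement D' ?c (Complex s 0))"
      unfolding agr[OF c', of s, simplified] agr[OF c', of "-s", simplified] ..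
    then have "agreement D' ?c (Complex (-s) 0) = agreement D' ?c (Complex s 0)"
      by (simp only: of_int_eq_iff)
    then show ?thesis
      using exponent_difference[OF c] distinct unfolding levels_picture dip_picture by (simp add: opposite)
  qed
  then have "binary_bracket D' = A_power 0 * binary_bracket D"
    by (intro bracket_transfer[OF D D' transport_bij]) simp
  ultimately show ?thesis by simp
qed

end

lemma reidemeister2_invariant:
  assumes "virtual_link_diagram D" "virtual_link_diagram D'" "reidemeister2 D D'"
  shows "binary_bracket D' = binary_bracket D \<and> writhe D' = writhe D"
proof -
  obtain s where "0 < s" "s < 1" "\<And>t. t \<in> {-1..1} \<Longrightarrow> bump t = 1/2 \<longleftrightarrow> t = s \<or> t = -s"
    using bump_half by blast
  from reidemeister2_invariant_aux[OF this assms(1,2)] assms(3) show ?thesis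
    unfolding reidemeister2_def by blast
qed

section \<open>The third move\<close>

abbreviation triangle :: "real \<Rightarrow> (real \<Rightarrow> complex) list" where
  "triangle m \<equiv> [diagonal 1, diagonal (-1), arch m]"

context
  fixes s :: real
  assumes s: "0 < s" "s < 1" and meets: "\<And>t. t \<in> {-1..1} \<Longrightarrow> bump t / 2 = t \<longleftrightarrow> t = s"
begin

text \<open>Reflection reduces both equations to the one defining \<open>s\<close>: the arch meets
  the rising diagonal at \<open>m * s\<close> and the falling one at \<open>- m * s\<close>.\<close>

lemma arch_meets:
  assumes m: "m = 1 \<or> m = -1" and t: "t \<in> {-1..1}"
  shows "m * bump t / 2 = t \<longleftrightarrow> t = m * s" "m * bump t / 2 = - t \<longleftrightarrow> t = - m * s"
  using m meets[OF t] meets[of "-t"] t by auto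

lemma triangle_picture:
  assumes m: "m = 1 \<or> m = -1"
  shows "graph_picture (triangle m)" 
    and "strand_marks (triangle m) 0 = {0, m * s}" 
    and "strand_marks (triangle m) 1 = {0, - m * s}" 
    and "strand_marks (triangle m) 2 = {- s, s}" 
    and "box_crossings (triangle m) = {Complex 0 0, Complex (m * s) (m * s), Complex (- m * s) (m * s)}"
proof -
  show g: "graph_picture (triangle m)" 
    using m bump_bounds by (force simp: graph_picture_def diagonal_def arch_def less_Suc_eq)
  have bound: "m * s \<in> {-1..1}" "- m * s \<in> {-1..1}" using m s by auto
  have d: "pic_double (triangle m) k t l u \<longleftrightarrow> u = t \<and> 
      ((k = 0 \<and> l = 1 \<or> k = 1 \<and> l = 0) \<and> t = 0 \<or> (k = 0 \<and> l = 2 \<or> k = 2 \<and> l = 0) \<and> t = m * s \<or>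
       (k = 1 \<and> l = 2 \<or> k = 2 \<and> l = 1) \<and> t = - m * s)" for k t l u
  proof (cases "t \<in> {-1..1}")
    case True
    define v where "v = m * bump t / 2"
    have Im: "Im (diagonal 1 t) = t" "Im (diagonal (-1) t) = - t" "Im (arch m t) = v"
      by (simp_all add: diagonal_def arch_def v_def)
    have v: "v = t \<longleftrightarrow> t = m * s" "v = - t \<longleftrightarrow> t = - m * s" "t = v \<longleftrightarrow> t = m * s" "- t = v \<longleftrightarrow> t = - m * s" 
      using arch_meets[OF m True] unfolding v_def by auto
    \<comment> \<open>The claim for one pair of strands, so that the nine index pairs can be settled
      one at a time.\<close>
    define G where "G k l \<longleftrightarrow> (k < length (triangle m) \<and> l < length (triangle m) \<and> k \<noteq> l \<and> t \<in> {-1..1} \<and> u = t \<and>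
        Im ((triangle m ! k) t) = Im ((triangle m ! l) t) \<longleftrightarrow> u = t \<and> 
      ((k = 0 \<and> l = 1 \<or> k = 1 \<and> l = 0) \<and> t = 0 \<or> (k = 0 \<and> l = 2 \<or> k = 2 \<and> l = 0) \<and> t = m * s \<or>
       (k = 1 \<and> l = 2 \<or> k = 2 \<and> l = 1) \<and> t = - m * s))" for k l
    have "G 0 0" "G 1 1" "G 2 2" unfolding G_def by simp_all
    moreover have "G 0 1" unfolding G_def using True by (simp add: Im)
    moreover have "G 1 0" unfolding G_def using True by (simp add: Im)
    moreover have "G 0 2" unfolding G_def using True by (simp add: Im v)
    moreover have "G 1 2" unfolding G_def using True by (simp add: Im v)
    moreover have "G 2 0" unfolding G_def using True by (simp add: Im v)
    moreover have "G 2 1" unfolding G_def using True by (simp add: Im v)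
    ultimately have "G k l" if "k < 3" "l < 3" using that unfolding less_3_iff by blast
    moreover have "G k l" if big: "\<not> (k < 3 \<and> l < 3)"
    proof -
      have len: "length (triangle m) = 3" by simp
      show ?thesis using big unfolding G_def len less_3_iff by blast
    qed
    ultimately show ?thesis unfolding pic_double_graph[OF g] G_def by blast
  next
    case False
    then show ?thesis using bound unfolding pic_double_graph[OF g] by auto
  qed
  show "strand_marks (triangle m) 0 = {0, m * s}" "strand_marks (triangle m) 1 = {0, - m * s}"
    "strand_marks (triangle m) 2 = {- s, s}"
    unfolding strand_marks_def d using m by auto
  have "box_crossings (triangle m) = {(triangle m ! 0) 0, (triangle m ! 1) 0, (triangle m ! 0) (m * s), 
      (triangle m ! 2) (m * s), (triangle m ! 1) (- m * s), (triangle m ! 2) (- m * s)}"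
    unfolding box_crossings_def d by blast
  also have "\<dots> = {Complex 0 0, Complex (m * s) (m * s), Complex (- m * s) (m * s)}"
    using arch_meets[OF m bound(1)] arch_meets[OF m bound(2)] by (auto simp: diagonal_def arch_def)
  finally show "box_crossings (triangle m) = {Complex 0 0, Complex (m * s) (m * s), Complex (- m * s) (m * s)}" .
qed

lemma strand_picture_triangle:
  assumes "m = 1 \<or> m = -1" "virtual_link_diagram D" "embedded_strands D S" "box_picture D S (triangle m)" 
    "layered D S (triangle m) h"
  shows "strand_picture D S (triangle m) s"
proof (rule strand_picture_graph[OF assms(2-4) triangle_picture(1)[OF assms(1)] disjI1[OF assms(5)]])
  fix k assume "k < length (triangle m)"
  then consider "k = 0" | "k = 1" | "k = 2" by fastforce
  then have "\<exists>x y. strand_marks (triangle m) k = {x, y} \<and> x \<noteq> y \<and> {x, y} \<subseteq> {-s..s}"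
  proof cases
    case 1
    then show ?thesis using assms(1) s triangle_picture(2)[OF assms(1)]
      by (intro exI[of _ 0] exI[of _ "m * s"]) auto
  next
    case 2
    then show ?thesis using assms(1) s triangle_picture(3)[OF assms(1)]
      by (intro exI[of _ 0] exI[of _ "- m * s"]) auto
  next
    case 3
    then show ?thesis using s triangle_picture(4)[OF assms(1)]
      by (intro exI[of _ "-s"] exI[of _ s]) auto
  qed
  then show "strand_marks (triangle m) k = {} \<or> 
      (\<exists>x y. strand_marks (triangle m) k = {x, y} \<and> x \<noteq> y \<and> {x, y} \<subseteq> {-s..s})" ..
qed (use s in auto)

text \<open>Each strand has two crossings, and the sign of \<open>m\<close> decides which comes
  first; just after the first the color is changed, after the second it is not.\<close>

lemma triangle_flips:
  assumes m: "m = 1 \<or> m = -1"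
  shows "strand_flip (triangle m) 0 0 \<longleftrightarrow> m = 1" "strand_flip (triangle m) 1 0 \<longleftrightarrow> m = -1"
    "strand_flip (triangle m) 0 (m * s) \<longleftrightarrow> m = -1" "strand_flip (triangle m) 2 (m * s) \<longleftrightarrow> m = -1"
    "strand_flip (triangle m) 1 (- m * s) \<longleftrightarrow> m = 1" "strand_flip (triangle m) 2 (- m * s) \<longleftrightarrow> m = 1"
proof -
  have "{0, s} = {s, 0}" "{0, -s} = {-s, 0}" by auto
  then show "strand_flip (triangle m) 0 0 \<longleftrightarrow> m = 1" "strand_flip (triangle m) 1 0 \<longleftrightarrow> m = -1"
    "strand_flip (triangle m) 0 (m * s) \<longleftrightarrow> m = -1" "strand_flip (triangle m) 2 (m * s) \<longleftrightarrow> m = -1"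
    "strand_flip (triangle m) 1 (- m * s) \<longleftrightarrow> m = 1" "strand_flip (triangle m) 2 (- m * s) \<longleftrightarrow> m = 1"
    using m s parity_pair[of 0 s] parity_pair[of "-s" 0] parity_pair[of "-s" s]
    unfolding strand_flip_def triangle_picture(2-4)[OF m] by auto
qed

text \<open>\<open>same\<close> records whether the two strands have made the same change of color
  at their crossing. In the triangles this does not depend on \<open>m\<close>, since both changes
  are toggled together.\<close>

definition agreement_at :: "strand list \<Rightarrow> (point \<Rightarrow> bool) \<Rightarrow> nat \<Rightarrow> nat \<Rightarrow> bool \<Rightarrow> real" where
  "agreement_at S c k l same = sgn (strand_speed S k) * sgn (strand_speed S l) *
    (if (c (strand_pt (S ! k) (-1)) = c (strand_pt (S ! l) (-1))) = same then -1 else 1)"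

text \<open>No right-hand side contains \<open>m\<close>, which is the content of the third move: at
  the crossing of a given pair of strands neither the order of the slopes nor the relative color
  depends on the side of the arch.\<close>

lemma triangle_crossings:
  assumes m: "m = 1 \<or> m = -1" and pic: "strand_picture D S (triangle m) s" and layered: "layered D S (triangle m) h"
  shows "real_of_int (crossing_sign D (Complex 0 0)) = - crossing_factor S h 0 1" 
    and "real_of_int (crossing_sign D (Complex (m * s) (m * s))) = - crossing_factor S h 0 2" 
    and "real_of_int (crossing_sign D (Complex (- m * s) (m * s))) = crossing_factor S h 1 2" 
    and "c \<in> colorings D \<Longrightarrow> real_of_int (agreement D c (Complex 0 0)) = agreement_at S c 0 1 False" 
    and "c \<in> colorings D \<Longrightarrow> real_of_int (agreement D c (Complex (m * s) (m * s))) = agreement_at S c 0 2 True" 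
    and "c \<in> colorings D \<Longrightarrow> real_of_int (agreement D c (Complex (- m * s) (m * s))) = agreement_at S c 1 2 True"
proof -
  let ?P = "triangle m"
  interpret strand_picture D S ?P s by (rule pic)
  have bound: "-1 < m * s" "m * s < 1" "-1 < - m * s" "- m * s < 1" using m s by auto
  have msI: "m * s \<in> {-1..1}" "- m * s \<in> {-1..1}" using bound by auto
  have val: "(?P ! 0) 0 = Complex 0 0" "(?P ! 1) 0 = Complex 0 0"
    "(?P ! 0) (m * s) = Complex (m * s) (m * s)" "(?P ! 2) (m * s) = Complex (m * s) (m * s)"
    "(?P ! 1) (- m * s) = Complex (- m * s) (m * s)" "(?P ! 2) (- m * s) = Complex (- m * s) (m * s)"
    using arch_meets[OF m msI(1)] arch_meets[OF m msI(2)] by (auto simp: diagonal_def arch_def)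
  have deriv: "((?P ! 0) has_vector_derivative Complex 1 1) (at t)" 
    "((?P ! 1) has_vector_derivative Complex 1 (-1)) (at t)"
    "((?P ! 2) has_vector_derivative Complex 1 (- 2 * m * t * (1 - t\<^sup>2))) (at t)" for t
    using picture_derivs(3,4) by simp_all
  have k: "0 < length ?P" "1 < length ?P" "2 < length ?P" by auto
  have "s * s < 1 * 1" using s by (intro mult_strict_mono) auto
  then have pos: "s * (1 - s\<^sup>2) > 0" using s by (simp add: power2_eq_square)
  \<comment> \<open>The slopes of the arch at the rising and at the falling diagonal;
    \<open>m\<close> enters only through its square.\<close>
  have slope: "- 2 * m * (m * s) * (1 - (m * s)\<^sup>2) = - 2 * (s * (1 - s\<^sup>2))"
    "- 2 * m * (- m * s) * (1 - (- m * s)\<^sup>2) = 2 * (s * (1 - s\<^sup>2))"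
    using m by auto
  show "real_of_int (crossing_sign D (Complex 0 0)) = - crossing_factor S h 0 1"
    using layered_crossing(1)[OF layered _ val(1,2) k(1) _ _ k(2) _ _ deriv(1,2)] by simp
  show "real_of_int (crossing_sign D (Complex (m * s) (m * s))) = - crossing_factor S h 0 2"
    using layered_crossing(1)[OF layered _ val(3,4) k(1) bound(1,2) k(3) bound(1,2) deriv(1,3)] pos
    unfolding slope cdet_graph by (simp add: sgn_if)
  show "real_of_int (crossing_sign D (Complex (- m * s) (m * s))) = crossing_factor S h 1 2"
    using layered_crossing(1)[OF layered _ val(5,6) k(2) bound(3,4) k(3) bound(3,4) deriv(2,3)] pos
    unfolding slope cdet_graph by (simp add: sgn_if)
  assume c: "c \<in> colorings D"
  show "real_of_int (agreement D c (Complex 0 0)) = agreement_at S c 0 1 False"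
    using layered_crossing(2)[OF layered _ val(1,2) k(1) _ _ k(2) _ _ c] m
    unfolding triangle_flips[OF m] agreement_at_def by auto
  show "real_of_int (agreement D c (Complex (m * s) (m * s))) = agreement_at S c 0 2 True"
    using layered_crossing(2)[OF layered _ val(3,4) k(1) bound(1,2) k(3) bound(1,2) c] m
    unfolding triangle_flips[OF m] agreement_at_def by auto
  show "real_of_int (agreement D c (Complex (- m * s) (m * s))) = agreement_at S c 1 2 True"
    using layered_crossing(2)[OF layered _ val(5,6) k(2) bound(3,4) k(3) bound(3,4) c] m
    unfolding triangle_flips[OF m] agreement_at_def by auto
qed

lemma triangle_sum: 
  fixes g :: "complex \<Rightarrow> int"
  assumes m: "m = 1 \<or> m = -1"
  shows "(\<Sum>z\<in>box_crossings (triangle m). g z) 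
    = g (Complex 0 0) + g (Complex (m * s) (m * s)) + g (Complex (- m * s) (m * s))"
  unfolding triangle_picture(5)[OF m] using m s by auto

lemma reidemeister3_invariant_aux:
  assumes D: "virtual_link_diagram D" and D': "virtual_link_diagram D'" 
    and replacement: "local_replacement D D' S (triangle 1) (triangle (-1))"
    and layered: "layered D S (triangle 1) h" "layered D' S (triangle (-1)) h"
  shows "binary_bracket D' = binary_bracket D \<and> writhe D' = writhe D"
proof -
  let ?P = "triangle 1" and ?P' = "triangle (-1)"
  note rep = local_replacementD[OF replacement]
  have m: "(1::real) = 1 \<or> (1::real) = -1" "(-1::real) = 1 \<or> (-1::real) = -1" by auto
  note pic = strand_picture_triangle[OF m(1) D rep(1,3) layered(1)] 
  note pic' = strand_picture_triangle[OF m(2) D' rep(2,4) layered(2)]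
  interpret strand_replacement D D' S ?P ?P' s
    by (intro strand_replacement.intro strand_replacement_axioms.intro replacement pic pic')
  note cr = triangle_crossings[OF m(1) pic layered(1)] 
  note cr' = triangle_crossings[OF m(2) pic' layered(2)]
  have "real_of_int (\<Sum>z\<in>box_crossings ?P'. crossing_sign D' z) = real_of_int (\<Sum>z\<in>box_crossings ?P. crossing_sign D z)"
    unfolding triangle_sum[OF m(1)] triangle_sum[OF m(2)] of_int_add cr(1-3) cr'(1-3) ..
  then have "(\<Sum>z\<in>box_crossings ?P'. crossing_sign D' z) = (\<Sum>z\<in>box_crossings ?P. crossing_sign D z)"
    by (simp only: of_int_eq_iff)
  then have "writhe D' = writhe D" using writhe_difference by linarith
  moreover have "exponent D' (transport S ?P' c) = exponent D c" if c: "c \<in> colorings D" for c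
  proof -
    let ?c = "transport S ?P' c"
    note c' = transport_colorings[OF c]
    \<comment> \<open>Transport keeps the colors at the starts of the strands, the only data of the
      coloring in \<open>agreement_at\<close>.\<close>
    have base: "agreement_at S ?c k l e = agreement_at S c k l e" if "k < 3" "l < 3" for k l e
      using that transport_base[of k c] transport_base[of l c] by (simp add: agreement_at_def)
    have "real_of_int (\<Sum>z\<in>box_crossings ?P'. crossing_sign D' z * agreement D' ?c z) 
        = real_of_int (\<Sum>z\<in>box_crossings ?P. crossing_sign D z * agreement D c z)"
      unfolding triangle_sum[OF m(1)] triangle_sum[OF m(2)] of_int_add of_int_mult cr(1-3) cr'(1-3) 
        cr(4-6)[OF c] cr'(4-6)[OF c'] by (simp add: base)
    then have "(\<Sum>z\<in>box_crossings ?P'. crossing_sign D' z * agreement D' ?c z) 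
        = (\<Sum>z\<in>box_crossings ?P. crossing_sign D z * agreement D c z)"
      by (simp only: of_int_eq_iff)
    then show ?thesis using exponent_difference[OF c] by linarith
  qed
  then have "binary_bracket D' = A_power 0 * binary_bracket D"
    by (intro bracket_transfer[OF D D' transport_bij]) simp
  ultimately show ?thesis by simp
qed

end

lemma reidemeister3_invariant:
  assumes "virtual_link_diagram D" "virtual_link_diagram D'" "reidemeister3 D D'"
  shows "binary_bracket D' = binary_bracket D \<and> writhe D' = writhe D"
proof -
  obtain s where "0 < s" "s < 1" "\<And>t. t \<in> {-1..1} \<Longrightarrow> bump t / 2 = t \<longleftrightarrow> t = s"
    using bump_fixed by blast
  from reidemeister3_invariant_aux[OF this assms(1,2)] assms(3) show ?thesis
    unfolding reidemeister3_def by blast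
qed

section \<open>The first move\<close>

context
  fixes s :: real
  assumes s: "0 < s" "s < 1" and half: "\<And>t. t \<in> {-1..1} \<Longrightarrow> bump t = 1/2 \<longleftrightarrow> t = s \<or> t = -s"
begin

text \<open>Equal heights at distinct parameters force \<open>u = - t\<close>; the horizontal
  coordinate is odd, so it vanishes there, which for \<open>t \<noteq> 0\<close> means
  \<open>bump t = 1/2\<close>.\<close>

lemma kink_picture:
  shows "pic_double [kink] k t l u \<longleftrightarrow> k = 0 \<and> l = 0 \<and> (t = s \<and> u = -s \<or> t = -s \<and> u = s)"
    and "strand_marks [kink] 0 = {-s, s}" "box_crossings [kink] = {kink s}"
proof -
  have bs: "bump s = 1/2" using half[of s] s by simp
  then have ks: "kink (-s) = kink s" by (simp add: kink_def)
  have unique: "t = s \<and> u = -s \<or> t = -s \<and> u = s" 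
    if "t \<in> {-1..1}" "u \<in> {-1..1}" "t \<noteq> u" "kink t = kink u" for t u
  proof -
    have b: "bump t = bump u" and r: "t * (1 - 2 * bump t) = u * (1 - 2 * bump u)"
      using that(4) unfolding kink_def complex.inject by blast+
    have u: "u = - t" using bump_eq_iff[OF that(1,2)] b that(3) by (auto simp: abs_eq_iff)
    have "t * (1 - 2 * bump t) = - (t * (1 - 2 * bump t))"
      using r unfolding u bump_minus by (simp only: mult_minus_left)
    then have "t * (1 - 2 * bump t) = 0" by linarith
    moreover have "t \<noteq> 0" using that(3) u by auto
    ultimately have "bump t = 1/2" by simp
    then show ?thesis using half[OF that(1)] u by auto
  qed
  have d: "pic_double [kink] k t l u \<longleftrightarrow> k = 0 \<and> l = 0 \<and> (t = s \<and> u = -s \<or> t = -s \<and> u = s)" for k t l u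
  proof
    assume "pic_double [kink] k t l u"
    then have "k = 0" "l = 0" "t \<in> {-1..1}" "u \<in> {-1..1}" "t \<noteq> u" "kink t = kink u"
      unfolding pic_double_def by auto
    then show "k = 0 \<and> l = 0 \<and> (t = s \<and> u = -s \<or> t = -s \<and> u = s)" using unique by blast
  qed (use ks s in \<open>auto simp: pic_double_def\<close>)
  then show "pic_double [kink] k t l u \<longleftrightarrow> k = 0 \<and> l = 0 \<and> (t = s \<and> u = -s \<or> t = -s \<and> u = s)" .
  show "strand_marks [kink] 0 = {-s, s}" unfolding strand_marks_def d by auto
  show "box_crossings [kink] = {kink s}" unfolding box_crossings_def d by (auto simp: ks)
qed

lemma level_picture:
  "\<not> pic_double [level 0] k t l u" "strand_marks [level 0] k = {}" "box_crossings [level 0] = {}"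
proof -
  show d: "\<not> pic_double [level 0] k t l u" for k t l u by (auto simp: pic_double_def level_def)
  show "strand_marks [level 0] k = {}" "box_crossings [level 0] = {}"
    using d by (auto simp: strand_marks_def box_crossings_def)
qed

text \<open>The passages of the new crossing are the first and the second change on one strand, so
  the outgoing colors differ and the agreement is 1. Exponents and writhe all change by the sign of
  the crossing, which the normalization cancels.\<close>

lemma reidemeister1_Inv_aux:
  assumes D: "virtual_link_diagram D" and D': "virtual_link_diagram D'" 
    and replacement: "local_replacement D D' [\<sigma>] [level 0] [kink]"
    and crossing: "(\<forall>t\<in>{-1..1}. \<forall>u\<in>{-1..1}. t < u \<and> kink t = kink u \<longrightarrow>
         strand_pt \<sigma> t \<in> overs D' \<and> strand_pt \<sigma> u \<in> unders D') \<or>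
      (\<forall>t\<in>{-1..1}. \<forall>u\<in>{-1..1}. t < u \<and> kink t = kink u \<longrightarrow>
         strand_pt \<sigma> u \<in> overs D' \<and> strand_pt \<sigma> t \<in> unders D')"
  shows "Inv D' = Inv D"
proof -
  let ?e = "crossing_sign D' (kink s)"
  note rep = local_replacementD[OF replacement]
  have sI: "s \<in> {-1..1}" "-s \<in> {-1..1}" using s by auto
  have "pic_double [kink] 0 (-s) 0 s" unfolding kink_picture(1) by simp
  then have ks: "kink (-s) = kink s" by (simp add: pic_double_def)
  have over: "strand_pt \<sigma> (-s) \<in> overs D' \<and> strand_pt \<sigma> s \<in> unders D' \<or> 
      strand_pt \<sigma> s \<in> overs D' \<and> strand_pt \<sigma> (-s) \<in> unders D'"
  proof -
    have "- s < s" using s by simp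
    then show ?thesis using crossing sI ks by blast
  qed
  have "strand_picture D [\<sigma>] [level 0] s"
  proof
    show "([level 0] ! k) t \<in> move_box" if "k < length [level 0]" "t \<in> {-1..1}" for k t
      using that by (auto simp: level_def move_box_def)
  qed (use D rep s level_picture in auto)
  moreover have "strand_picture D' [\<sigma>] [kink] s"
  proof
    show "([kink] ! k) t \<in> move_box" if k: "k < length [kink]" and t: "t \<in> {-1..1}" for k t
    proof -
      \<comment> \<open>The horizontal coordinate stays in the box, as \<open>1 - 2 * bump t\<close>
        lies between -1 and 1.\<close>
      have "\<bar>t\<bar> * \<bar>1 - 2 * bump t\<bar> \<le> 1 * 1" using t bump_bounds[OF t] by (intro mult_mono) auto
      then show ?thesis using k bump_bounds[OF t] by (simp add: kink_def move_box_def abs_mult)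
    qed
    show "strand_pt ([\<sigma>] ! k) t \<in> overs D' \<and> strand_pt ([\<sigma>] ! l) u \<in> unders D' \<or>
      strand_pt ([\<sigma>] ! k) t \<in> unders D' \<and> strand_pt ([\<sigma>] ! l) u \<in> overs D'" if "pic_double [kink] k t l u" for k t l u
      using that over unfolding kink_picture(1) by auto
  qed (use D' rep s kink_picture(2) in auto)
  ultimately interpret strand_replacement D D' "[\<sigma>]" "[level 0]" "[kink]" s
    by (intro strand_replacement.intro strand_replacement_axioms.intro replacement)
  have flip: "strand_flip [kink] 0 (-s)" "\<not> strand_flip [kink] 0 s"
    using s by (simp_all add: strand_flip_def kink_picture(2) parity_pair)
  have agree: "agreement D' c (kink s) = 1" if c: "c \<in> colorings D'" for c
  proof -
    have pos: "pos D' (strand_pt \<sigma> (-s)) = kink s" "pos D' (strand_pt \<sigma> s) = kink s"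
      using new.strand_pos[of 0 "-s"] new.strand_pos[of 0 s] sI ks by simp_all
    from over have "passes D' (kink s) (strand_pt ([\<sigma>] ! 0) (-s)) (strand_pt ([\<sigma>] ! 0) s) \<or>
        passes D' (kink s) (strand_pt ([\<sigma>] ! 0) s) (strand_pt ([\<sigma>] ! 0) (-s))"
      using pos unfolding passes_def by auto
    \<comment> \<open>Both passages have the speed of the same strand, so its sign is squared and
      the orientation drops out.\<close>
    then have "real_of_int (agreement D' c (kink s)) = 1"
      using new.strand_passes_agreement[OF c, of "kink s" 0 "-s" 0 s] 
        new.strand_passes_agreement[OF c, of "kink s" 0 s 0 "-s"] s flip old.strand_speed_nonzero[of 0] 
      by auto
    then show ?thesis by simp
  qed
  have "exponent D' (transport [\<sigma>] [kink] c) = ?e + exponent D c" if c: "c \<in> colorings D" for c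
    using exponent_difference[OF c] agree[OF transport_colorings[OF c]] 
    unfolding kink_picture(3) level_picture(3) by simp
  then have "binary_bracket D' = A_power ?e * binary_bracket D"
    by (rule bracket_transfer[OF D D' transport_bij])
  moreover have "writhe D' = writhe D + ?e"
    using writhe_difference unfolding kink_picture(3) level_picture(3) by simp
  ultimately have "Inv D' = A_power (- (writhe D + ?e) + ?e) * binary_bracket D"
    unfolding Inv_def A_power_add by (simp only: mult.assoc)
  then show ?thesis by (simp add: Inv_def)
qed

end

lemma reidemeister1_Inv:
  assumes "virtual_link_diagram D" "virtual_link_diagram D'" "reidemeister1 D D'"
  shows "Inv D' = Inv D"
proof -
  obtain s where "0 < s" "s < 1" "\<And>t. t \<in> {-1..1} \<Longrightarrow> bump t = 1/2 \<longleftrightarrow> t = s \<or> t = -s"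
    using bump_half by blast
  from reidemeister1_Inv_aux[OF this assms(1,2)] assms(3) show ?thesis
    unfolding reidemeister1_def by blast
qed

section \<open>Sequences of moves\<close>

lemma regular_step_invariant:
  assumes "regular_step E D D'" "E \<subseteq> {1, -1}"
  shows "binary_bracket D' = binary_bracket D \<and> (E = {1} \<longrightarrow> writhe D' = writhe D)"
  using assms reparametrized_invariant[of D D' E] planar_isotopic_invariant[of D D'] 
    detour_move_invariant[of D D'] reidemeister2_invariant[of D D'] reidemeister3_invariant[of D D']
  unfolding regular_step_def by blast

lemma equivclp_invariant:
  assumes "equivclp R x y" and "\<And>x y. R x y \<Longrightarrow> f x = f y" shows "f x = f y"
  using assms(1) by (induction rule: equivclp_induct) (use assms(2) in metis)+

theorem theorem0:
  shows "(\<forall>K K'. virtual_link_diagram K \<and> virtual_link_diagram K' \<and>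
            regularly_isotopic_unoriented K K' \<longrightarrow> binary_bracket K = binary_bracket K') \<and>
         (\<forall>K K'. virtual_link_diagram K \<and> virtual_link_diagram K' \<and>
            virtually_equivalent_oriented K K' \<longrightarrow> Inv K = Inv K')"
proof (intro conjI allI impI; elim conjE)
  fix K K' assume "regularly_isotopic_unoriented K K'"
  then show "binary_bracket K = binary_bracket K'"
    unfolding regularly_isotopic_unoriented_def
    by (rule equivclp_invariant) (use regular_step_invariant in fastforce)
next
  fix K K' assume "virtually_equivalent_oriented K K'"
  then show "Inv K = Inv K'"
    unfolding virtually_equivalent_oriented_def
  proof (rule equivclp_invariant)
    fix D D' assume step: "ambient_step {1} D D'"
    then consider "regular_step {1} D D'" 
      | "virtual_link_diagram D" "virtual_link_diagram D'" "reidemeister1 D D'"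
      unfolding ambient_step_def by blast
    then show "Inv D = Inv D'"
    proof cases
      case 1
      then show ?thesis using regular_step_invariant[OF 1] by (simp add: Inv_def)
    next
      case 2
      then show ?thesis using reidemeister1_Inv by simp
    qed
  qed
qed

end
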